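(* In the noise-limited network described in the context, let $I_E=\sum_{z\in\Phi_E}G_b(\theta_z)L(x^*,z)g_{x^*z}$. The secure connectivity probability in the presence of colluding eavesdroppers, $\tau_c=\Pr\left(\frac{M_sL(x^*,o)h_{x^*o}}{I_E}\ge 1\right)$, is $$\tau_c=\sum_{j\in\{L,N\}}A_j\,\mathbb{E}_{r_j}\left[\sum_{m=0}^{N_j-1}\left(\frac{r_j^{\alpha_j}}{M_sC_j}\right)^m\frac{(-1)^m}{\Gamma(m+1)}\mathcal{L}_{I_E}^{(m)}\left(\frac{r_j^{\alpha_j}}{M_sC_j}\right)\right],$$ where $\mathcal{L}_{I_E}^{(m)}$ is the $m$-th derivative of the Laplace transform $\mathcal{L}_{I_E}(s)=\mathbb{E}(e^{-sI_E})=\exp(\Xi(s))$, and, writing $\delta_j(V)=D^{\alpha_j}/(VC_j)$, $$\Xi(s)=-s\Bigg(2\pi\lambda_E\sum_{j\in\{L,N\}}q_j\sum_{V\in\{M_s,m_s\}}\mathrm{Pr}_{G_b}(V)\frac{(VC_j)^{2/\alpha_j}}{\alpha_j}\sum_{m=0}^{N_j-1}\frac{\delta_j(V)^{m+\frac{2}{\alpha_j}}}{\left(m+\frac{2}{\alpha_j}\right)(s+\delta_j(V))^{m+1}}\,{}_2F_1\left(1,m+1;m+\tfrac{2}{\alpha_j}+1;\tfrac{\delta_j(V)}{\delta_j(V)+s}\right)$$ $$\qquad+2\pi\lambda_E\sum_{V\in\{M_s,m_s\}}\mathrm{Pr}_{G_b}(V)\frac{(VC_N)^{2/\alpha_N}}{\alpha_N}\sum_{m=0}^{N_N-1}\frac{\delta_N(V)^{m+\frac{2}{\alpha_N}}}{\left(1-\frac{2}{\alpha_N}\right)(s+\delta_N(V))^{m+1}}\,{}_2F_1\left(1,m+1;2-\tfrac{2}{\alpha_N};\tfrac{s}{s+\delta_N(V)}\right)\Bigg),$$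 with $q_L=C$, $q_N=1-C$.
   Context: Notation: ${}_2F_1$ is the Gauss hypergeometric function; $\mathrm{gamma}(k,1)$ is the gamma distribution with shape $k$ and scale $1$; $o$ is the origin of $\mathbb{R}^2$. Base stations (BSs). BS locations form a homogeneous Poisson point process (PPP) $\Phi_B$ on $\mathbb{R}^2$ of intensity $\lambda_B>0$. The typical user is at $o$. Blockage. Let $D>0$ and $0\le C\le 1$. Every link (BS to user, or BS to eavesdropper) of length $r$ is line-of-sight (LOS) with probability $C$ if $r\le D$ and $0$ if $r>D$, and non-line-of-sight (NLOS) otherwise, independently over links. $\Phi_L$ and $\Phi_N$ are the sets of BSs whose link to $o$ is LOS, respectively NLOS; they are independent PPPs. Path loss. $L(x,y)=C_L\|x-y\|^{-\alpha_L}$ if the link $x\to y$ is LOS and $L(x,y)=C_N\|x-y\|^{-\alpha_N}$ if it is NLOS, where $C_L>C_N>0$ and $0<\alpha_L<\alpha_N$. Association. The typical user is served by the BS $x^*=\arg\max_{x\in\Phi_B}L(x,o)$. For $j\in\{L,N\}$, $A_j=\Pr(x^*\in\Phi_j)$, and $r_j$ is the distance $\|x^*\|$ conditioned on $x^*\in\Phi_j$; $\mathbb{E}_{r_j}$ is expectation over $r_j$ (a term with $A_j=0$ is read as $0$). Eavesdroppers. Eavesdropper locations form a homogeneous PPP $\Phi_E$ on $\mathbb{R}^2$ of intensity $\lambda_E>0$, independent of $\Phi_B$. Colluding means that the eavesdroppers combine their received signals by maximal-ratio combining. Fading. $h_{x^*o}$ (user) and $g_{x^*z}$ (eavesdropper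 at $z$) are small-scale power gains, mutually independent and independent of everything else given the link states, distributed as $\mathrm{gamma}(N_L,1)$ if the link is LOS and $\mathrm{gamma}(N_N,1)$ if it is NLOS, with $N_L,N_N$ positive integers. Antenna gain. $M_s$ and $m_s$ are the (positive) main-lobe and side-lobe array gains and $\theta_b$ (degrees) is the main-lobe beam width parameter. The serving BS has gain $M_s$ towards its user. Towards an eavesdropper $z$ its gain is an independent random variable $G_b(\theta_z)$ equal to $M_s$ with probability $\mathrm{Pr}_{G_b}(M_s)=\theta_b/180$ and to $m_s$ with probability $\mathrm{Pr}_{G_b}(m_s)=(180-\theta_b)/180$.
   Formalization: The formal statement assumes α_N > 2 (for α_N ≤ 2, I_E is almost surely infinite, so its Laplace transform vanishes and cannot equal exp(Ξ(s))), and asserts the Laplace transform identity for s > 0. *)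

theory Defs
  imports "HOL-Probability.Probability"
begin

section \<open>Deterministic parameters\<close>

type_synonym plane = "real^2"

datatype link_state = LOS | NLOS

text \<open>Lobes, rather than the two gain values, serve as index, so that sums over the antenna gains
  keep two terms even if the two gains coincide.\<close>
datatype lobe = Main | Side

record net_params =
  lamB :: real
  lamE :: real
  block_D :: real
  block_C :: real
  pl_C :: "link_state \<Rightarrow> real"
  pl_exp :: "link_state \<Rightarrow> real"
  nak :: "link_state \<Rightarrow> nat"
  lobe_gain :: "lobe \<Rightarrow> real"
  beam_width :: real

definition los_prob :: "net_params \<Rightarrow> real \<Rightarrow> real" where
  "los_prob P r = (if r \<le> block_D P then block_C P else 0)"

definition state_law :: "net_params \<Rightarrow> real \<Rightarrow> link_state measure" where
  "state_law P r =
     measure_pmf (map_pmf (\<lambda>b. if b then LOS else NLOS) (bernoulli_pmf (los_prob P r)))"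

definition path_loss :: "net_params \<Rightarrow> link_state \<Rightarrow> real \<Rightarrow> real" where
  "path_loss P j r = pl_C P j * r powr (- pl_exp P j)"

definition lobe_prob :: "net_params \<Rightarrow> lobe \<Rightarrow> real" where
  "lobe_prob P v = (case v of Main \<Rightarrow> beam_width P / 180 | Side \<Rightarrow> (180 - beam_width P) / 180)"

definition gain_law :: "net_params \<Rightarrow> real measure" where
  "gain_law P = measure_pmf
     (map_pmf (\<lambda>b. lobe_gain P (if b then Main else Side)) (bernoulli_pmf (lobe_prob P Main)))"

definition gamma_distribution :: "real \<Rightarrow> real \<Rightarrow> real measure" where
  "gamma_distribution k \<theta> = density lborel
     (\<lambda>x. ennreal (if 0 < x then x powr (k - 1) * exp (- x / \<theta>) / (Gamma k * \<theta> powr k) else 0))"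


section \<open>Point processes and conditional independence\<close>

text \<open>Under the first condition \<^const>\<open>card\<close> is, almost surely, the true number of points.\<close>
definition homogeneous_PPP :: "'w measure \<Rightarrow> real \<Rightarrow> ('w \<Rightarrow> plane set) \<Rightarrow> bool" where
  "homogeneous_PPP M lam \<Phi> \<longleftrightarrow>
     (AE \<omega> in M. \<forall>B. bounded B \<longrightarrow> finite (\<Phi> \<omega> \<inter> B)) \<and>
     (\<forall>B. B \<in> sets borel \<and> bounded B \<longrightarrow>
        (\<lambda>\<omega>. card (\<Phi> \<omega> \<inter> B)) \<in> measurable M (count_space UNIV) \<and>
        (\<forall>k. measure M {\<omega> \<in> space M. card (\<Phi> \<omega> \<inter> B) = k} =
              (lam * measure lborel B) ^ k / fact k * exp (- (lam * measure lborel B)))) \<and>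
     (\<forall>(I :: nat set) B. finite I \<and> (\<forall>i\<in>I. B i \<in> sets borel \<and> bounded (B i)) \<and>
        disjoint_family_on B I \<longrightarrow>
        prob_space.indep_vars M (\<lambda>_. count_space UNIV) (\<lambda>i \<omega>. card (\<Phi> \<omega> \<inter> B i)) I)"

definition enumerates :: "'w measure \<Rightarrow> (nat \<Rightarrow> 'w \<Rightarrow> plane) \<Rightarrow> ('w \<Rightarrow> plane set) \<Rightarrow> bool" where
  "enumerates M X \<Phi> \<longleftrightarrow>
     (\<forall>i. X i \<in> borel_measurable M) \<and> (AE \<omega> in M. inj (\<lambda>i. X i \<omega>)) \<and>
     (\<forall>\<omega>\<in>space M. \<Phi> \<omega> = range (\<lambda>i. X i \<omega>))"

text \<open>Given \<open>V\<close>, the variables \<open>Y i\<close> (\<open>i \<in> I\<close>) are conditionally independent and \<open>Y i\<close> has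
  conditional law \<open>\<kappa> i\<close>.  In all uses \<open>\<kappa> i \<omega>\<close> depends on \<open>\<omega>\<close> only through \<open>V \<omega>\<close>.  For constant
  \<open>\<kappa> i\<close> it says that the \<open>Y i\<close> are independent of each other and of \<open>V\<close>.\<close>
definition cond_indep_given ::
    "'w measure \<Rightarrow> 'v measure \<Rightarrow> ('w \<Rightarrow> 'v) \<Rightarrow> 'i set \<Rightarrow> 'b measure \<Rightarrow> ('i \<Rightarrow> 'w \<Rightarrow> 'b) \<Rightarrow>
     ('i \<Rightarrow> 'w \<Rightarrow> 'b measure) \<Rightarrow> bool" where
  "cond_indep_given M N V I K Y \<kappa> \<longleftrightarrow>
     V \<in> measurable M N \<and> (\<forall>i\<in>I. Y i \<in> measurable M K) \<and>
     (\<forall>J B A. J \<subseteq> I \<and> finite J \<and> (\<forall>i\<in>J. B i \<in> sets K) \<and> A \<in> sets N \<longrightarrow>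
        emeasure M {\<omega> \<in> space M. V \<omega> \<in> A \<and> (\<forall>i\<in>J. Y i \<omega> \<in> B i)} =
        (\<integral>\<^sup>+ \<omega>. indicator A (V \<omega>) * (\<Prod>i\<in>J. emeasure (\<kappa> i \<omega>) (B i)) \<partial>M))"


section \<open>The network\<close>

datatype receiver = User | Eve nat

text \<open>The base stations and the eavesdroppers are enumerated (in an arbitrary measurable way), which
  lets marks be attached to points.  \<open>state W i u\<close> is the state of the link from base station \<open>i\<close> to
  receiver \<open>u\<close>; \<open>gain W k\<close> is the serving base station's gain towards eavesdropper \<open>k\<close>, and
  \<open>fading W u\<close> is the power gain of the link from the serving base station to \<open>u\<close>.\<close>
record 'w network =
  BSs :: "'w \<Rightarrow> plane set"
  Eves :: "'w \<Rightarrow> plane set"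
  bs :: "nat \<Rightarrow> 'w \<Rightarrow> plane"
  eve :: "nat \<Rightarrow> 'w \<Rightarrow> plane"
  state :: "nat \<Rightarrow> receiver \<Rightarrow> 'w \<Rightarrow> link_state"
  gain :: "nat \<Rightarrow> 'w \<Rightarrow> real"
  fading :: "receiver \<Rightarrow> 'w \<Rightarrow> real"

definition position :: "'w network \<Rightarrow> receiver \<Rightarrow> 'w \<Rightarrow> plane" where
  "position W u \<omega> = (case u of User \<Rightarrow> 0 | Eve k \<Rightarrow> eve W k \<omega>)"

definition link_length :: "'w network \<Rightarrow> nat \<Rightarrow> receiver \<Rightarrow> 'w \<Rightarrow> real" where
  "link_length W i u \<omega> = norm (bs W i \<omega> - position W u \<omega>)"

definition link_loss :: "net_params \<Rightarrow> 'w network \<Rightarrow> nat \<Rightarrow> receiver \<Rightarrow> 'w \<Rightarrow> real" where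
  "link_loss P W i u \<omega> = path_loss P (state W i u \<omega>) (link_length W i u \<omega>)"

text \<open>Ties for the maximum have probability zero; \<^const>\<open>Least\<close> breaks them measurably.\<close>
definition serving :: "net_params \<Rightarrow> 'w network \<Rightarrow> 'w \<Rightarrow> nat" where
  "serving P W \<omega> = (LEAST i. is_arg_max (\<lambda>k. link_loss P W k User \<omega>) (\<lambda>_. True) i)"

definition serving_bs :: "net_params \<Rightarrow> 'w network \<Rightarrow> 'w \<Rightarrow> plane" where
  "serving_bs P W \<omega> = bs W (serving P W \<omega>) \<omega>"

definition locations :: "'w network \<Rightarrow> 'w \<Rightarrow> (nat \<Rightarrow> plane) \<times> (nat \<Rightarrow> plane)" where
  "locations W \<omega> = (\<lambda>i. bs W i \<omega>, \<lambda>k. eve W k \<omega>)"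

abbreviation location_space :: "((nat \<Rightarrow> plane) \<times> (nat \<Rightarrow> plane)) measure" where
  "location_space \<equiv> PiM UNIV (\<lambda>_. borel) \<Otimes>\<^sub>M PiM UNIV (\<lambda>_. borel)"

definition states :: "'w network \<Rightarrow> 'w \<Rightarrow> nat \<times> receiver \<Rightarrow> link_state" where
  "states W \<omega> = (\<lambda>(i, u). state W i u \<omega>)"

abbreviation state_space :: "(nat \<times> receiver \<Rightarrow> link_state) measure" where
  "state_space \<equiv> PiM UNIV (\<lambda>_. count_space UNIV)"

locale secure_network = prob_space M for M :: "'w measure" +
  fixes P :: net_params and W :: "'w network"
  assumes intensities: "0 < lamB P" "0 < lamE P"
    and blockage: "0 < block_D P" "0 \<le> block_C P" "block_C P \<le> 1"
    and path_loss_const: "0 < pl_C P NLOS" "pl_C P NLOS < pl_C P LOS"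
    and path_loss_exp: "0 < pl_exp P LOS" "pl_exp P LOS < pl_exp P NLOS"
    and fading_shape: "\<And>j. 0 < nak P j"
    and gains_pos: "\<And>v. 0 < lobe_gain P v"
    and beam: "0 \<le> beam_width P" "beam_width P \<le> 180"
    and BSs_PPP: "homogeneous_PPP M (lamB P) (BSs W)" "enumerates M (bs W) (BSs W)"
    and Eves_PPP: "homogeneous_PPP M (lamE P) (Eves W)" "enumerates M (eve W) (Eves W)"
    and BSs_Eves_indep:
      "indep_var (PiM UNIV (\<lambda>_. borel)) (\<lambda>\<omega> i. bs W i \<omega>) (PiM UNIV (\<lambda>_. borel)) (\<lambda>\<omega> k. eve W k \<omega>)"
    and states_law:
      "cond_indep_given M location_space (locations W)
         UNIV (count_space UNIV) (\<lambda>(i, u). state W i u) (\<lambda>(i, u) \<omega>. state_law P (link_length W i u \<omega>))"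
    and gains_law:
      "cond_indep_given M (location_space \<Otimes>\<^sub>M state_space) (\<lambda>\<omega>. (locations W \<omega>, states W \<omega>))
         UNIV borel (gain W) (\<lambda>_ _. gain_law P)"
    and fading_law:
      "cond_indep_given M ((location_space \<Otimes>\<^sub>M state_space) \<Otimes>\<^sub>M PiM UNIV (\<lambda>_. borel))
         (\<lambda>\<omega>. ((locations W \<omega>, states W \<omega>), \<lambda>k. gain W k \<omega>))
         UNIV borel (fading W)
         (\<lambda>u \<omega>. gamma_distribution (real (nak P (state W (serving P W \<omega>) u \<omega>))) 1)"


section \<open>Association, interception and secure connectivity\<close>

definition BSs_in_state :: "'w network \<Rightarrow> link_state \<Rightarrow> 'w \<Rightarrow> plane set" where
  "BSs_in_state W j \<omega> = {bs W i \<omega> | i. state W i User \<omega> = j}"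

definition assoc_event :: "'w measure \<Rightarrow> net_params \<Rightarrow> 'w network \<Rightarrow> link_state \<Rightarrow> 'w set" where
  "assoc_event M P W j = {\<omega> \<in> space M. serving_bs P W \<omega> \<in> BSs_in_state W j \<omega>}"

definition assoc_prob :: "'w measure \<Rightarrow> net_params \<Rightarrow> 'w network \<Rightarrow> link_state \<Rightarrow> real" where
  "assoc_prob M P W j = measure M (assoc_event M P W j)"

text \<open>The law of \<open>r\<^sub>j\<close>; it is the null measure if the conditioning event has probability zero.\<close>
definition serving_dist_law :: "'w measure \<Rightarrow> net_params \<Rightarrow> 'w network \<Rightarrow> link_state \<Rightarrow> real measure" where
  "serving_dist_law M P W j =
     distr (uniform_measure M (assoc_event M P W j)) borel (\<lambda>\<omega>. norm (serving_bs P W \<omega>))"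

definition colluding_signal :: "net_params \<Rightarrow> 'w network \<Rightarrow> 'w \<Rightarrow> ennreal" where
  "colluding_signal P W \<omega> =
     (\<Sum>k. ennreal (gain W k \<omega> * link_loss P W (serving P W \<omega>) (Eve k) \<omega> * fading W (Eve k) \<omega>))"

definition secure_prob_colluding :: "'w measure \<Rightarrow> net_params \<Rightarrow> 'w network \<Rightarrow> real" where
  "secure_prob_colluding M P W = measure M {\<omega> \<in> space M.
     ennreal (lobe_gain P Main * link_loss P W (serving P W \<omega>) User \<omega> * fading W User \<omega>)
       / colluding_signal P W \<omega> \<ge> 1}"

text \<open>\<open>exp (- s * \<infinity>) = 0\<close>\<close>
definition laplace_transform :: "'w measure \<Rightarrow> ('w \<Rightarrow> ennreal) \<Rightarrow> real \<Rightarrow> real" where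
  "laplace_transform M Y s = (\<integral>\<omega>. (if Y \<omega> = \<infinity> then 0 else exp (- s * enn2real (Y \<omega>))) \<partial>M)"


section \<open>The closed form of the exponent\<close>

definition hyp2F1 :: "real \<Rightarrow> real \<Rightarrow> real \<Rightarrow> real \<Rightarrow> real" where
  "hyp2F1 a b c z = eval_fps (fps_hypergeo [a, b] [c] 1) z"

definition delta :: "net_params \<Rightarrow> link_state \<Rightarrow> lobe \<Rightarrow> real" where
  "delta P j v = block_D P powr pl_exp P j / (lobe_gain P v * pl_C P j)"

definition inner_prob :: "net_params \<Rightarrow> link_state \<Rightarrow> real" where
  "inner_prob P j = (case j of LOS \<Rightarrow> block_C P | NLOS \<Rightarrow> 1 - block_C P)"

text \<open>The first summand comes from links of length at most \<open>D\<close>, where \<open>q\<^sub>j\<close> is the probability of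
  state \<open>j\<close>; the second from the longer links, all of them NLOS.  The integral behind the second one
  converges exactly if the NLOS path loss exponent exceeds 2; otherwise the received signal is almost
  surely infinite and the closed form does not describe its Laplace transform.\<close>
definition Xi :: "net_params \<Rightarrow> real \<Rightarrow> real" where
  "Xi P s = - s *
    (2 * pi * lamE P *
       (\<Sum>j\<in>{LOS, NLOS}. inner_prob P j *
         (\<Sum>v\<in>{Main, Side}. lobe_prob P v *
            ((lobe_gain P v * pl_C P j) powr (2 / pl_exp P j) / pl_exp P j) *
            (\<Sum>m<nak P j.
               delta P j v powr (real m + 2 / pl_exp P j)
                 / ((real m + 2 / pl_exp P j) * (s + delta P j v) ^ (m + 1))
               * hyp2F1 1 (real m + 1) (real m + 2 / pl_exp P j + 1)
                   (delta P j v / (delta P j v + s)))))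
     + 2 * pi * lamE P *
       (\<Sum>v\<in>{Main, Side}. lobe_prob P v *
          ((lobe_gain P v * pl_C P NLOS) powr (2 / pl_exp P NLOS) / pl_exp P NLOS) *
          (\<Sum>m<nak P NLOS.
             delta P NLOS v powr (real m + 2 / pl_exp P NLOS)
               / ((1 - 2 / pl_exp P NLOS) * (s + delta P NLOS v) ^ (m + 1))
             * hyp2F1 1 (real m + 1) (2 - 2 / pl_exp P NLOS)
                 (s / (s + delta P NLOS v)))))"

end

theory Submission
  imports Defs "HOL-Real_Asymp.Real_Asymp"
begin

text \<open>
  Let \<open>U\<close> consist of the base stations and their link states towards the user; the serving station is
  a function of \<open>U\<close>.  Integrating out the fadings, then the antenna gains, then the states of the
  links to the eavesdroppers, and finally the eavesdroppers by the Laplace functional of a Poisson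
  process, one sees that the conditional Laplace transform of the colluding signal \<open>I\<close>
  given \<open>U\<close> does not depend on \<open>U\<close>, because Lebesgue measure is translation invariant.
  By uniqueness of Laplace transforms, \<open>I\<close> is independent of \<open>U\<close>.  The user's fading exceeds \<open>x\<close> with probability
  \<open>\<Sum>m<N. x ^ m / fact m * exp (- x)\<close>; for \<open>x = s * I\<close>, the expectation of the \<open>m\<close>-th summand
  is a multiple of the \<open>m\<close>-th derivative of the Laplace transform of \<open>I\<close> at \<open>s\<close>.

  The exponent of the Laplace functional is a radial integral, and with \<open>t = s / r ^ \<alpha>\<close>
  up to constants one has \<open>1 - 1 / (1 + t) ^ N = (\<Sum>m<N. t / (1 + t) ^ (m + 1))\<close>.  Each summand is an
  incomplete beta integral, whose hypergeometric form is verified by differentiation.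
\<close>

section \<open>Hypergeometric form of the exponent\<close>

text \<open>The model fixes conditional laws only for finitely many marks and on measurable sets,
  whereas the signal is an infinite series and the serving station is a random index. Therefore
  products over the first \<open>K\<close> eavesdroppers are integrated, \<open>K\<close> tends to
  infinity only afterwards, and link states are treated on each event that the serving index is
  \<open>i\<close>. The order of integration is dictated by the kernels: the law of a fading depends
  on the link states, that of a state on the link length, so each step removes marks whose kernel
  depends only on what remains. Using \<open>exp (- x)\<close> on \<open>[0, \<infinity>]\<close>,
  with value 0 at infinity, avoids any discussion of whether the signal is finite. Uniqueness of
  Laplace transforms becomes a moment problem: this function maps the signal into the unit interval,
  and the values of the transform at natural numbers are the moments there. Strict positivity of the
  averaged factor of one eavesdropper allows its negative logarithm to serve as test function in the
  Laplace functional.\<close>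

lemma hyp2F1_coeff_Suc:
  fixes b c :: real
  shows "fps_nth (fps_hypergeo [1, b] [c] 1) (Suc n)
    = (b + real n) / (c + real n) * fps_nth (fps_hypergeo [1, b] [c] 1) n"
proof -
  \<comment> \<open>The upper parameter 1 contributes \<open>1 + real n\<close>, which cancels the
    factor coming from the factorial.\<close>
  have "(1 + real n) * (b + real n) / (real (Suc n) * (c + real n)) = (b + real n) / (c + real n)"
    by (simp add: add.commute[of 1])
  then show ?thesis
    unfolding fps_hypergeo_rec by (simp add: mult.commute del: fps_hypergeo_nth)
qed

text \<open>Ratio test: positivity of \<open>b\<close> and \<open>c\<close> keeps every coefficient
  nonzero, and the quotient of consecutive ones tends to 1.\<close>

lemma conv_radius_hyp2F1:
  fixes b c :: real
  assumes "0 < b" "0 < c"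
  shows "fps_conv_radius (fps_hypergeo [1, b] [c] 1) = 1"
proof -
  define f where "f = fps_hypergeo [1, b] [c] (1::real)"
  have nz: "fps_nth f n \<noteq> 0" for n
  proof -
    have "pochhammer b n > 0" "pochhammer c n > 0"
      using assms by (auto intro: pochhammer_pos)
    then show ?thesis
      by (simp add: f_def pochhammer_fact[symmetric])
  qed
  have rec: "fps_nth f (Suc n) = (b + real n) / (c + real n) * fps_nth f n" for n
    unfolding f_def hyp2F1_coeff_Suc using assms by (simp add: field_simps del: fps_hypergeo_nth)
  have "(\<lambda>n. norm (fps_nth f n) / norm (fps_nth f (Suc n))) = (\<lambda>n. (c + real n) / (b + real n))"
  proof
    fix n
    show "norm (fps_nth f n) / norm (fps_nth f (Suc n)) = (c + real n) / (b + real n)"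
      using assms nz[of n] by (simp add: rec abs_mult abs_divide)
  qed
  moreover have "(\<lambda>n. (c + real n) / (b + real n)) \<longlonglongrightarrow> 1"
    by real_asymp
  ultimately have "(\<lambda>n. norm (fps_nth f n) / norm (fps_nth f (Suc n))) \<longlonglongrightarrow> 1"
    by simp
  then have "conv_radius (fps_nth f) = ereal 1"
    using nz by (intro conv_radius_ratio_limit[OF refl]) simp_all
  then show ?thesis
    by (simp add: fps_conv_radius_def f_def one_ereal_def)
qed

text \<open>Since one upper parameter is 1, the coefficient recursion simplifies so far that the
  series solves a first-order inhomogeneous equation instead of the usual second-order one. The
  third parameter is written \<open>a + 1\<close> because \<open>a\<close> becomes an exponent of
  \<open>ibeta\<close>.\<close>

lemma hyp2F1_ODE:
  fixes a b z :: real
  assumes "0 < a" "0 < b" "\<bar>z\<bar> < 1"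
  obtains F' where "(hyp2F1 1 b (a + 1) has_field_derivative F') (at z)"
    "z * (1 - z) * F' + (a - b * z) * hyp2F1 1 b (a + 1) z = a"
proof
  define f where "f = fps_hypergeo [1, b] [a + 1] (1::real)"
  have R: "fps_conv_radius f = 1"
    unfolding f_def using assms by (intro conv_radius_hyp2F1) auto
  have hyp: "hyp2F1 1 b (a + 1) = eval_fps f"
    by (auto simp: hyp2F1_def f_def)
  show "(hyp2F1 1 b (a + 1) has_field_derivative eval_fps (fps_deriv f) z) (at z)"
    unfolding hyp using assms R by (intro has_field_derivative_eval_fps) (auto simp: one_ereal_def)
  have rec: "(a + 1 + real n) * fps_nth f (Suc n) = (b + real n) * fps_nth f n" for n
  proof -
    have "a + 1 + real n \<noteq> 0"
      using assms by linarith
    then show ?thesis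
      unfolding f_def hyp2F1_coeff_Suc by (simp del: fps_hypergeo_nth)
  qed
  have f0: "fps_nth f 0 = 1"
    by (simp add: f_def)
  \<comment> \<open>The coefficient of index \<open>k + 1\<close> vanishes by \<open>rec\<close> at
    \<open>k\<close>; the constant coefficient gives the right-hand side \<open>a\<close>.\<close>
  have id: "fps_X * ((1 - fps_X) * fps_deriv f) + (fps_const a - fps_const b * fps_X) * f = fps_const a"
  proof (rule fps_ext)
    fix n
    show "fps_nth (fps_X * ((1 - fps_X) * fps_deriv f) + (fps_const a - fps_const b * fps_X) * f) n
        = fps_nth (fps_const a) n"
    proof (cases n)
      case (Suc k)
      then show ?thesis
        using rec[of k] by (cases k) (simp_all add: algebra_simps f0)
    qed (simp add: algebra_simps f0)
  qed
  \<comment> \<open>Evaluation is additive and multiplicative only where all the series involved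
    converge, hence the radius of each factor.\<close>
  have zR: "ereal (norm z) < fps_conv_radius f" "ereal (norm z) < fps_conv_radius (fps_deriv f)"
    using assms R fps_conv_radius_deriv[of f] less_le_trans[of "ereal \<bar>z\<bar>" "ereal 1"]
    by (auto simp: one_ereal_def)
  have z1: "ereal (norm z) < fps_conv_radius (1 - fps_X :: real fps)"
    using fps_conv_radius_diff[of "1 :: real fps" fps_X] by simp
  have z2: "ereal (norm z) < fps_conv_radius (fps_const a - fps_const b * fps_X)"
    by (rule less_le_trans[OF _ fps_conv_radius_diff])
      (rule less_le_trans[of _
          "\<infinity>"], simp, rule min.boundedI, simp, rule order_trans[OF _ fps_conv_radius_mult], simp)
  have zb: "ereal (norm z) < fps_conv_radius (fps_const b * fps_X)"
    by (rule less_le_trans[OF _ fps_conv_radius_mult]) simp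
  have z3: "ereal (norm z) < fps_conv_radius ((1 - fps_X) * fps_deriv f)"
    by (rule less_le_trans[OF _ fps_conv_radius_mult]) (use z1 zR in auto)
  have z4: "ereal (norm z) < fps_conv_radius (fps_X * ((1 - fps_X) * fps_deriv f))"
    by (rule less_le_trans[OF _ fps_conv_radius_mult]) (use z3 in auto)
  have z5: "ereal (norm z) < fps_conv_radius ((fps_const a - fps_const b * fps_X) * f)"
    by (rule less_le_trans[OF _ fps_conv_radius_mult]) (use z2 zR in auto)
  have "eval_fps (fps_X * ((1 - fps_X) * fps_deriv f) + (fps_const a - fps_const b * fps_X) * f) z
      = z * ((1 - z) * eval_fps (fps_deriv f) z) + (a - b * z) * eval_fps f z"
    using zR z1 z2 z3 z4 z5 zb
    by (simp add: eval_fps_add eval_fps_mult eval_fps_diff)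
  then show "z * (1 - z) * eval_fps (fps_deriv f) z + (a - b * z) * hyp2F1 1 b (a + 1) z = a"
    unfolding id hyp by (simp add: mult.assoc)
qed

lemma hyp2F1_0: "hyp2F1 a b c 0 = 1"
  by (simp add: hyp2F1_def eval_fps_at_0)

text \<open>For positive \<open>a\<close> and \<open>b\<close> and \<open>0 < z < 1\<close> this is
  the incomplete beta integral of \<open>t powr (a - 1) * (1 - t) powr (b - a - 1)\<close> over
  \<open>t\<close> from 0 to \<open>z\<close>, in hypergeometric form. The analytic facts used about
  it are its derivative and its limit at 0.\<close>

definition ibeta :: "real \<Rightarrow> real \<Rightarrow> real \<Rightarrow> real" where
  "ibeta a b z = z powr a * (1 - z) powr (b - a) * hyp2F1 1 b (a + 1) z / a"

text \<open>The product rule leaves \<open>z powr (a - 1) * (1 - z) powr (b - a - 1) / a\<close>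
  times the left-hand side of the equation in \<open>hyp2F1_ODE\<close>, and that side equals
  \<open>a\<close>.\<close>

lemma ibeta_deriv:
  assumes "0 < a" "0 < b" "0 < z" "z < 1"
  shows "(ibeta a b has_field_derivative z powr (a - 1) * (1 - z) powr (b - a - 1)) (at z)"
proof -
  obtain F' where F': "(hyp2F1 1 b (a + 1) has_field_derivative F') (at z)"
    "z * (1 - z) * F' + (a - b * z) * hyp2F1 1 b (a + 1) z = a"
    by (rule hyp2F1_ODE[of a b z]) (use assms in auto)
  have p: "z powr a = z powr (a - 1) * z" "(1 - z) powr (b - a) = (1 - z) powr (b - a - 1) * (1 - z)"
    using assms powr_add[of z "a - 1" 1] powr_add[of "1 - z" "b - a - 1" 1] by simp_all
  let ?F = "hyp2F1 1 b (a + 1) z"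
  have "(ibeta a b has_field_derivative
      ((a * z powr (a - 1) * (1 - z) powr (b - a) - z powr a * ((b - a) * (1 - z) powr (b - a - 1)))
          * ?F
        + z powr a * (1 - z) powr (b - a) * F') / a) (at z)"
    unfolding ibeta_def using assms
    by (auto intro!: derivative_eq_intros F'(1)[unfolded add.commute[of a]] simp: field_simps)
  also have "((a * z powr (a - 1) * (1 - z) powr (b - a) - z powr a
      * ((b - a) * (1 - z) powr (b - a - 1))) * ?F
        + z powr a * (1 - z) powr (b - a) * F') / a
      = z powr (a - 1) * (1 - z) powr (b - a - 1) * (z * (1 - z) * F' + (a - b * z) * ?F) / a"
    unfolding p by (simp add: algebra_simps)
  finally show ?thesis
    unfolding F'(2) using assms by simp
qed

lemma ibeta_tendsto_0:
  assumes "0 < a" "0 < b"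
  shows "(ibeta a b \<longlongrightarrow> 0) (at_right 0)"
proof -
  obtain F' where F': "(hyp2F1 1 b (a + 1) has_field_derivative F') (at 0)"
    by (rule hyp2F1_ODE[of a b 0]) (use assms in auto)
  then have "(hyp2F1 1 b (a + 1) \<longlongrightarrow> 1) (at 0)"
    using DERIV_isCont[OF F'] by (simp add: isCont_def hyp2F1_0)
  then have 1: "(hyp2F1 1 b (a + 1) \<longlongrightarrow> 1) (at_right 0)"
    by (rule tendsto_mono[rotated]) (simp add: at_le)
  have 2: "((\<lambda>z::real. z powr a) \<longlongrightarrow> 0) (at_right 0)"
      "((\<lambda>z::real. (1 - z) powr (b - a)) \<longlongrightarrow> 1) (at_right 0)"
    using assms by real_asymp+
  have "((\<lambda>z. z powr a * (1 - z) powr (b - a) * hyp2F1 1 b (a + 1) z / a) \<longlongrightarrow> 0 * 1 * 1 / a) (at_right 0)"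
    by (intro tendsto_intros 1 2) (use assms in auto)
  then show ?thesis
    by (simp add: ibeta_def[abs_def])
qed

section \<open>Polar coordinates in the plane\<close>

text \<open>The disc of radius \<open>a\<close> has area \<open>pi * a\<^sup>2\<close>, whose
  derivative in \<open>a\<close> is the radial density; closed half-lines generate the Borel
  sets.\<close>

lemma distr_norm_plane:
  "distr lborel borel (norm :: plane \<Rightarrow> real)
    = density lborel (\<lambda>r. ennreal (2 * pi * r) * indicator {0..} r)"
proof (rule measure_eqI_generator_eq[where E = "range atMost" and \<Omega> = UNIV and A = "\<lambda>i. {.. real i}"])
  show "Int_stable (range (atMost :: real \<Rightarrow> real set))"
    by (auto simp: Int_stable_def)
  show "sets (distr lborel borel norm) = sigma_sets UNIV (range (atMost :: real \<Rightarrow> real set))"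
    "sets (density lborel (\<lambda>r. ennreal (2 * pi * r) * indicator {0..} r))
        = sigma_sets UNIV (range atMost)"
    by (simp_all add: borel_eq_atMost)
  have disk: "emeasure (distr lborel borel (norm :: plane \<Rightarrow> real)) {..a} = ennreal (pi * a\<^sup>2)"
      if "0 \<le> a" for a
  proof -
    have "norm -` {..a} \<inter> space lborel = cball (0::plane) a"
      by (auto simp: dist_norm)
    then show ?thesis
      using that by (simp add: emeasure_distr emeasure_cball unit_ball_vol_2 del: space_lborel)
  qed
  have dens: "emeasure (density lborel (\<lambda>r. ennreal (2 * pi * r) * indicator {0..} r)) {..a}
      = ennreal (pi * a\<^sup>2)"
    if "0 \<le> a" for a :: real
  proof -
    have "(\<integral>\<^sup>+ r. ennreal (2 * pi * r) * indicator {0..a} r \<partial>lborel) = ennreal (pi * a\<^sup>2 - pi * 0\<^sup>2)"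
      using that by (intro nn_integral_FTC_Icc) (auto intro!: derivative_eq_intros)
    then show ?thesis
      by (simp add: emeasure_density mult.assoc indicator_inter_arith[symmetric] atLeastAtMost_def)
  qed
  show "emeasure (distr lborel borel (norm :: plane \<Rightarrow> real)) {..real i} \<noteq> \<infinity>" for i
    by (simp add: disk)
  show "(\<Union>i. {..real i}) = UNIV"
    using real_arch_simple by auto
  fix X :: "real set"
  assume "X \<in> range atMost"
  then obtain a where X: "X = {..a}"
    by auto
  show "emeasure (distr lborel borel (norm :: plane \<Rightarrow> real)) X
      = emeasure (density lborel (\<lambda>r. ennreal (2 * pi * r) * indicator {0..} r)) X"
  proof (cases "0 \<le> a")
    case False
    then have "norm -` {..a} \<inter> space lborel = ({} :: plane set)"
      by (auto simp: not_le) (metis norm_ge_zero not_le order_trans)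
    moreover have "(\<integral>\<^sup>+ r. ennreal (2 * pi * r) * indicator {0..} r * indicator {..a} r \<partial>lborel)
        = (\<integral>\<^sup>+ r. 0 \<partial>(lborel :: real measure))"
      using False by (intro nn_integral_cong) (auto split: split_indicator)
    ultimately show ?thesis
      by (simp add: X emeasure_distr emeasure_density)
  qed (simp add: X disk dens)
qed auto

lemma nn_integral_radial:
  assumes [measurable]: "f \<in> borel_measurable borel"
  shows "(\<integral>\<^sup>+ z. f (norm z) \<partial>(lborel :: plane measure))
    = (\<integral>\<^sup>+ r. ennreal (2 * pi * r) * indicator {0..} r * f r \<partial>lborel)"
proof -
  have "(\<integral>\<^sup>+ z. f (norm z) \<partial>(lborel :: plane measure))
      = (\<integral>\<^sup>+ r. f r \<partial>distr lborel borel (norm :: plane \<Rightarrow> real))"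
    by (simp add: nn_integral_distr)
  also have "\<dots> = (\<integral>\<^sup>+ r. ennreal (2 * pi * r) * indicator {0..} r * f r \<partial>lborel)"
    unfolding distr_norm_plane by (simp add: nn_integral_density)
  finally show ?thesis .
qed

section \<open>Radial integrals as incomplete beta functions\<close>

text \<open>For nonnegative \<open>x\<close>, one minus the Laplace transform at \<open>x\<close> of
  the gamma distribution with shape \<open>N\<close> and scale 1.\<close>

definition fade_loss :: "nat \<Rightarrow> real \<Rightarrow> real" where
  "fade_loss N x = 1 - 1 / (1 + x) ^ N"

lemma fade_loss_eq_sum:
  assumes "0 < s" "0 < t"
  shows "fade_loss N (s / t) = (\<Sum>m<N. s * t ^ m / (s + t) ^ (m + 1))"
proof -
  have "1 - (t / (s + t)) ^ N = (1 - t / (s + t)) * (\<Sum>m<N. (t / (s + t)) ^ m)"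
    by (rule one_diff_power_eq)
  also have "1 - t / (s + t) = s / (s + t)"
    using assms by (simp add: field_simps)
  also have "s / (s + t) * (\<Sum>m<N. (t / (s + t)) ^ m) = (\<Sum>m<N. s * t ^ m / (s + t) ^ (m + 1))"
    by (simp add: sum_distrib_left power_divide)
  also have "t / (s + t) = 1 / (1 + s / t)"
    using assms by (simp add: field_simps)
  finally show ?thesis
    by (simp add: fade_loss_def power_divide)
qed

text \<open>Products of powers with symbolic exponents are compared as exponentials, which reduces
  the comparison to linear arithmetic in logarithms.\<close>

lemma powr_eq_exp: "0 < x \<Longrightarrow> x powr a = exp (a * ln x)" for x a :: real
  by (simp add: powr_def)

lemma power_eq_exp: "0 < x \<Longrightarrow> x ^ n = exp (real n * ln x)" for x :: real
  by (simp add: exp_of_nat_mult)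

text \<open>At \<open>x / (x + y)\<close> the complement is \<open>y / (x + y)\<close>, so both
  powers share a denominator. The factor \<open>(x + y)\<^sup>2\<close> is kept apart because the
  derivative of the quotient in the chain rule brings its inverse.\<close>

lemma ibeta_deriv_quotient:
  fixes x y :: real
  assumes "0 < x" "0 < y" "0 < a"
  shows "(ibeta a (real m + 1) has_field_derivative
    x powr (a - 1) * y powr (real m - a) / (x + y) ^ (m + 1) * (x + y)\<^sup>2) (at (x / (x + y)))"
proof -
  have z: "1 - x / (x + y) = y / (x + y)" "0 < x / (x + y)" "x / (x + y) < 1"
    using assms by (simp_all add: field_simps)
  have "(x / (x + y)) powr (a - 1) * (y / (x + y)) powr (real m + 1 - a - 1)
      = exp ((a - 1) * (ln x - ln (x + y)) + (real m + 1 - a - 1) * (ln y - ln (x + y)))"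
    using assms by (simp add: powr_eq_exp ln_div exp_add)
  also have "(a - 1) * (ln x - ln (x + y)) + (real m + 1 - a - 1) * (ln y - ln (x + y))
      = (a - 1) * ln x + (real m - a) * ln y - real (m + 1) * ln (x + y) + 2 * ln (x + y)"
    by (simp add: algebra_simps)
  also have "exp ((a - 1) * ln x + (real m - a) * ln y - real (m + 1) * ln (x + y) + 2 * ln (x + y))
      = x powr (a - 1) * y powr (real m - a) / (x + y) ^ (m + 1) * (x + y)\<^sup>2"
    using assms by (simp add: exp_add exp_diff powr_eq_exp power_eq_exp
        del: power_Suc of_nat_Suc of_nat_add)
  finally have eq: "(x / (x + y)) powr (a - 1) * (y / (x + y)) powr (real m + 1 - a - 1)
      = x powr (a - 1) * y powr (real m - a) / (x + y) ^ (m + 1) * (x + y)\<^sup>2" .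
  have "0 < real m + 1"
    by simp
  from ibeta_deriv[OF assms(3) this z(2,3)] show ?thesis
    unfolding z(1) eq .
qed

text \<open>The left-hand side is what the chain rule gives for the antiderivatives below.\<close>
lemma radial_chain_rule:
  fixes s c \<alpha> r t :: real
  assumes pos: "0 < s" "0 < c" "0 < \<alpha>" "0 < r" and t: "t = r powr \<alpha> / c"
  shows "c powr (2 / \<alpha>) / \<alpha> * s * (s powr (2 / \<alpha> - 1)
      * (s powr (- (2 / \<alpha>)) * t powr (real m + 2 / \<alpha> - 1) / (s + t) ^ (m + 1) * (\<alpha> * s * t / r)))
    = s * t ^ m / (s + t) ^ (m + 1) * r"
proof -
  have t0: "0 < t"
    using pos by (simp add: t)
  have lnt: "ln t = \<alpha> * ln r - ln c"
    using pos by (simp add: t ln_div ln_powr)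
  have "c powr (2 / \<alpha>) / \<alpha> * s * (s powr (2 / \<alpha> - 1)
      * (s powr (- (2 / \<alpha>)) * t powr (real m + 2 / \<alpha> - 1) / (s + t) ^ (m + 1) * (\<alpha> * s * t / r)))
    = c powr (2 / \<alpha>) * s * s powr (2 / \<alpha> - 1) * s powr (- (2 / \<alpha>)) * t powr (real m + 2 / \<alpha> - 1) * s
        * t / r / (s + t) ^ (m + 1)"
    using pos by (simp add: mult_ac)
  also have "c powr (2 / \<alpha>) * s * s powr (2 / \<alpha> - 1) * s powr (- (2 / \<alpha>))
      * t powr (real m + 2 / \<alpha> - 1) * s * t / r
    = exp (2 / \<alpha> * ln c + ln s + (2 / \<alpha> - 1) * ln s + (- (2 / \<alpha>)) * ln s + (real m + 2 / \<alpha> - 1) * ln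
        t + ln s + ln t - ln r)"
    using pos t0
    by (simp add: powr_eq_exp exp_add exp_diff exp_minus exp_double)
        (simp add: field_simps power2_eq_square)
  also have "2 / \<alpha> * ln c + ln s + (2 / \<alpha> - 1) * ln s + (- (2 / \<alpha>)) * ln s + (real m + 2 / \<alpha> - 1)
      * ln t + ln s + ln t - ln r
    = ln s + real m * ln t + ln r"
    using pos by (simp add: lnt field_simps)
  also have "exp (ln s + real m * ln t + ln r) = s * t ^ m * r"
    using pos t0 by (simp add: exp_add power_eq_exp)
  finally show ?thesis
    by simp
qed

text \<open>The substitution \<open>z = t / (t + s)\<close> with
  \<open>t = r powr \<alpha> / c\<close> turns the \<open>m\<close>-th radial summand into a beta
  integrand with \<open>a = m + 2 / \<alpha>\<close> and \<open>b = m + 1\<close>; \<open>z\<close>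
  vanishes at \<open>r = 0\<close>, which suits an integral starting there.\<close>

lemma near_antideriv:
  fixes s c \<alpha> r :: real
  assumes pos: "0 < s" "0 < c" "0 < \<alpha>" "0 < r"
  shows "((\<lambda>r. c powr (2 / \<alpha>) / \<alpha> * s * (s powr (2 / \<alpha> - 1)
      * ibeta (real m + 2 / \<alpha>) (real m + 1) (r powr \<alpha> / c / (r powr \<alpha> / c + s))))
    has_field_derivative s * (r powr \<alpha> / c) ^ m / (s + r powr \<alpha> / c) ^ (m + 1) * r) (at r)"
proof -
  define t where "t = r powr \<alpha> / c"
  have t: "0 < t"
    using pos by (simp add: t_def)
  have T: "((\<lambda>r. r powr \<alpha> / c) has_field_derivative \<alpha> * t / r) (at r)"
    using pos by (auto intro!: derivative_eq_intros simp: t_def powr_diff)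
  have Z: "((\<lambda>r. r powr \<alpha> / c / (r powr \<alpha> / c + s)) has_field_derivative \<alpha> * s * t / r
      / (t + s)\<^sup>2) (at r)"
    using t pos
    by (intro DERIV_cong[OF DERIV_divide[OF T DERIV_add[OF T DERIV_const]]])
      (auto simp: t_def[symmetric] field_simps power2_eq_square)
  have B: "(ibeta (real m + 2 / \<alpha>) (real m + 1) has_field_derivative
      t powr (real m + 2 / \<alpha> - 1) * s powr (real m - (real m + 2 / \<alpha>)) / (t + s) ^ (m + 1) * (t + s)\<^sup>2)
      (at (r powr \<alpha> / c / (r powr \<alpha> / c + s)))"
    unfolding t_def[symmetric] using t pos by (intro ibeta_deriv_quotient add_nonneg_pos) auto
  have ts: "(t + s)\<^sup>2 \<noteq> 0" "real m - (real m + 2 / \<alpha>) = - (2 / \<alpha>)"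
    using t pos by simp_all
  have BZ: "x * y / d * (t + s)\<^sup>2 * (q / (t + s)\<^sup>2) = y * x / d * q" for x y d q :: real
    using ts(1) by simp
  have D: "((\<lambda>r. ibeta (real m + 2 / \<alpha>) (real m + 1) (r powr \<alpha> / c / (r powr \<alpha> / c + s)))
      has_field_derivative
      s powr (- (2 / \<alpha>)) * t powr (real m + 2 / \<alpha> - 1) / (s + t) ^ (m + 1) * (\<alpha> * s * t / r)) (at r)"
    using DERIV_chain2[OF B Z] unfolding BZ unfolding ts(2) add.commute[of t s] .
  show ?thesis
    using DERIV_cmult[OF DERIV_cmult[OF D, of "s powr (2 / \<alpha> - 1)"], of "c powr (2 / \<alpha>) / \<alpha> * s"]
    unfolding radial_chain_rule[OF pos t_def] unfolding t_def .
qed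

text \<open>The complementary variable \<open>s / (s + t)\<close> is used, as it vanishes for
  \<open>r\<close> tending to infinity; it decreases in \<open>r\<close>, whence the minus sign. The
  beta exponent is now \<open>1 - 2 / \<alpha>\<close>, positive because \<alpha> exceeds 2.\<close>

lemma far_antideriv:
  fixes s c \<alpha> r :: real
  assumes "0 < s" "0 < c" "2 < \<alpha>" "0 < r"
  shows "((\<lambda>r. - (c powr (2 / \<alpha>) / \<alpha> * s * (s powr (2 / \<alpha> - 1)
      * ibeta (1 - 2 / \<alpha>) (real m + 1) (s / (s + r powr \<alpha> / c)))))
    has_field_derivative s * (r powr \<alpha> / c) ^ m / (s + r powr \<alpha> / c) ^ (m + 1) * r) (at r)"
proof -
  define t where "t = r powr \<alpha> / c"
  have pos: "0 < s" "0 < c" "0 < \<alpha>" "0 < r"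
    using assms by auto
  have t: "0 < t"
    using pos by (simp add: t_def)
  have T: "((\<lambda>r. r powr \<alpha> / c) has_field_derivative \<alpha> * t / r) (at r)"
    using pos by (auto intro!: derivative_eq_intros simp: t_def powr_diff)
  have Z: "((\<lambda>r. s / (s + r powr \<alpha> / c)) has_field_derivative - (\<alpha> * s * t / r) / (s + t)\<^sup>2) (at r)"
    using t pos
    by (intro DERIV_cong[OF DERIV_divide[OF DERIV_const DERIV_add[OF DERIV_const T]]])
      (auto simp: t_def[symmetric] field_simps power2_eq_square)
  have B: "(ibeta (1 - 2 / \<alpha>) (real m + 1) has_field_derivative
      s powr (1 - 2 / \<alpha> - 1) * t powr (real m - (1 - 2 / \<alpha>)) / (s + t) ^ (m + 1) * (s + t)\<^sup>2)
      (at (s / (s + r powr \<alpha> / c)))"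
    unfolding t_def[symmetric] using t assms by (intro ibeta_deriv_quotient) auto
  have ts: "(s + t)\<^sup>2 \<noteq> 0" "real m - (1 - 2 / \<alpha>) = real m + 2 / \<alpha> - 1" "1 - 2 / \<alpha> - 1 = - (2 / \<alpha>)"
    using t pos by simp_all
  have BZ: "x * y / d * (s + t)\<^sup>2 * (- q / (s + t)\<^sup>2) = - (x * y / d * q)" for x y d q :: real
    using ts(1) by simp
  have D: "((\<lambda>r. - ibeta (1 - 2 / \<alpha>) (real m + 1) (s / (s + r powr \<alpha> / c))) has_field_derivative
      s powr (- (2 / \<alpha>)) * t powr (real m + 2 / \<alpha> - 1) / (s + t) ^ (m + 1) * (\<alpha> * s * t / r)) (at r)"
    using DERIV_minus[OF DERIV_chain2[OF B Z]] unfolding BZ unfolding ts(2,3) minus_minus .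
  show ?thesis
    using DERIV_cmult[OF DERIV_cmult[OF D, of "s powr (2 / \<alpha> - 1)"], of "c powr (2 / \<alpha>) / \<alpha> * s"]
    unfolding radial_chain_rule[OF pos t_def] mult_minus_right unfolding t_def .
qed

lemma fade_loss_bounds: "0 \<le> x \<Longrightarrow> 0 \<le> fade_loss N x \<and> fade_loss N x < 1"
  by (simp add: fade_loss_def)

text \<open>Limits replace endpoint values, so that one statement serves an interval starting at 0,
  where formulas are at hand for positive radii only, and one ending at infinity.
  \<open>A \<le> B\<close> is recorded because \<open>ennreal\<close> would truncate a negative
  difference.\<close>

lemma nn_integral_einterval_FTC:
  fixes f F :: "real \<Rightarrow> real" and a b :: ereal
  assumes ab: "a < b"
    and F: "\<And>x. a < ereal x \<Longrightarrow> ereal x < b \<Longrightarrow> DERIV F x :> f x"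
    and f: "\<And>x. a < ereal x \<Longrightarrow> ereal x < b \<Longrightarrow> isCont f x"
    and nonneg: "\<And>x. a < ereal x \<Longrightarrow> ereal x < b \<Longrightarrow> 0 \<le> f x"
    and lims: "((F \<circ> real_of_ereal) \<longlongrightarrow> A) (at_right a)" "((F \<circ> real_of_ereal) \<longlongrightarrow> B) (at_left b)"
  shows "(\<integral>\<^sup>+ x. ennreal (f x) * indicator (einterval a b) x \<partial>lborel) = ennreal (B - A)" "A \<le> B"
proof -
  note FTC = interval_integral_FTC_nonneg[OF ab F f _ lims]
  have int: "set_integrable lborel (einterval a b) f" and eq: "(LBINT x=a..b. f x) = B - A"
    using FTC nonneg by auto
  have pos: "0 \<le> indicator (einterval a b) x *\<^sub>R f x" for x
    using nonneg[of x] by (auto simp: einterval_def split: split_indicator)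
  have "(\<integral>\<^sup>+ x. ennreal (f x) * indicator (einterval a b) x \<partial>lborel)
      = (\<integral>\<^sup>+ x. ennreal (indicator (einterval a b) x *\<^sub>R f x) \<partial>lborel)"
    by (intro nn_integral_cong) (auto split: split_indicator)
  also have "\<dots> = ennreal (LBINT x=a..b. f x)"
    using less_imp_le[OF ab] int pos unfolding set_integrable_def
    by (subst nn_integral_eq_integral)
        (auto simp: interval_lebesgue_integral_def set_lebesgue_integral_def)
  finally show "(\<integral>\<^sup>+ x. ennreal (f x) * indicator (einterval a b) x \<partial>lborel) = ennreal (B - A)"
    unfolding eq .
  have "0 \<le> (LBINT x=a..b. f x)"
    using less_imp_le[OF ab] pos by (simp add: interval_lebesgue_integral_def set_lebesgue_integral_def)
  then show "A \<le> B"
    by (simp add: eq)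
qed

lemma fade_loss_powr_eq_sum:
  fixes s c \<alpha> r :: real
  assumes "0 < s" "0 < c" "0 < r"
  shows "fade_loss N (s * (c * r powr (- \<alpha>))) * r
    = (\<Sum>m<N. s * (r powr \<alpha> / c) ^ m / (s + r powr \<alpha> / c) ^ (m + 1) * r)"
proof -
  have "s * (c * r powr (- \<alpha>)) = s / (r powr \<alpha> / c)"
    using assms by (simp add: powr_minus field_simps)
  then show ?thesis
    using fade_loss_eq_sum[of s "r powr \<alpha> / c" N] assms by (simp add: sum_distrib_right)
qed

text \<open>The share of the shorter links in the bracket of \<open>Xi\<close> for one state and one
  lobe, without the probabilities and the factor \<open>2 * pi * lamE P\<close>. Here
  \<open>c\<close> is gain times path loss constant, and \<delta> is
  \<open>D powr \<alpha> / c\<close>.\<close>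

definition near_term :: "real \<Rightarrow> real \<Rightarrow> real \<Rightarrow> real \<Rightarrow> nat \<Rightarrow> real" where
  "near_term s \<alpha> c \<delta> N = c powr (2 / \<alpha>) / \<alpha> *
     (\<Sum>m<N. \<delta> powr (real m + 2 / \<alpha>) / ((real m + 2 / \<alpha>) * (s + \<delta>) ^ (m + 1))
        * hyp2F1 1 (real m + 1) (real m + 2 / \<alpha> + 1) (\<delta> / (\<delta> + s)))"

text \<open>Counterpart of \<open>near_term\<close> for the longer links; the third parameter
  \<open>2 - 2 / \<alpha>\<close> is the beta exponent \<open>1 - 2 / \<alpha>\<close> plus
  one.\<close>

definition far_term :: "real \<Rightarrow> real \<Rightarrow> real \<Rightarrow> real \<Rightarrow> nat \<Rightarrow> real" where
  "far_term s \<alpha> c \<delta> N = c powr (2 / \<alpha>) / \<alpha> *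
     (\<Sum>m<N. \<delta> powr (real m + 2 / \<alpha>) / ((1 - 2 / \<alpha>) * (s + \<delta>) ^ (m + 1))
        * hyp2F1 1 (real m + 1) (2 - 2 / \<alpha>) (s / (s + \<delta>)))"

lemma ibeta_quotient:
  fixes x y :: real
  assumes "0 < x" "0 < y"
  shows "ibeta a (real m + 1) (x / (x + y))
    = x powr a * y powr (real m + 1 - a) / (x + y) ^ (m + 1) * hyp2F1 1 (real m + 1) (a + 1)
        (x / (x + y)) / a"
proof -
  have "1 - x / (x + y) = y / (x + y)"
    using assms by (simp add: field_simps)
  moreover have "(x / (x + y)) powr a * (y / (x + y)) powr (real m + 1 - a)
      = x powr a * y powr (real m + 1 - a) / (x + y) ^ (m + 1)"
  proof -
    have "(x / (x + y)) powr a * (y / (x + y)) powr (real m + 1 - a)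
        = exp (a * (ln x - ln (x + y)) + (real m + 1 - a) * (ln y - ln (x + y)))"
      using assms by (simp add: powr_eq_exp ln_div exp_add)
    also have "a * (ln x - ln (x + y)) + (real m + 1 - a) * (ln y - ln (x + y))
        = a * ln x + (real m + 1 - a) * ln y - real (m + 1) * ln (x + y)"
      by (simp add: algebra_simps)
    also have "exp (a * ln x + (real m + 1 - a) * ln y - real (m + 1) * ln (x + y))
        = x powr a * y powr (real m + 1 - a) / (x + y) ^ (m + 1)"
      using assms by (simp add: exp_add exp_diff powr_eq_exp power_eq_exp del: power_Suc of_nat_Suc
          of_nat_add)
    finally show ?thesis .
  qed
  ultimately show ?thesis
    by (simp only: ibeta_def)
qed

text \<open>The prefactor \<open>s powr (2 / \<alpha> - 1)\<close> carried by the antiderivatives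
  cancels the power \<open>s powr (1 - 2 / \<alpha>)\<close> that \<open>ibeta\<close> contributes
  at this argument.\<close>

lemma near_term_ibeta:
  assumes "0 < s" "0 < \<delta>" "0 < \<alpha>"
  shows "s * near_term s \<alpha> c \<delta> N = (\<Sum>m<N. c powr (2 / \<alpha>) / \<alpha> * s * (s powr (2 / \<alpha> - 1)
      * ibeta (real m + 2 / \<alpha>) (real m + 1) (\<delta> / (\<delta> + s))))"
proof -
  have *: "s powr (2 / \<alpha> - 1) * s powr (1 - 2 / \<alpha>) = 1"
    using assms by (simp add: powr_add[symmetric])
  have e: "real m + 1 - (real m + 2 / \<alpha>) = 1 - 2 / \<alpha>" for m
    by simp
  have "s powr (2 / \<alpha> - 1) * ibeta (real m + 2 / \<alpha>) (real m + 1) (\<delta> / (\<delta> + s))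
      = (s powr (2 / \<alpha> - 1) * s powr (1 - 2 / \<alpha>)) * (\<delta> powr (real m + 2 / \<alpha>) / (\<delta> + s) ^ (m + 1)
        * hyp2F1 1 (real m + 1) (real m + 2 / \<alpha> + 1) (\<delta> / (\<delta> + s)) / (real m + 2 / \<alpha>))" for m
    unfolding ibeta_quotient[OF assms(2,1)] e
    by (simp only: mult.assoc mult.left_commute times_divide_eq_left times_divide_eq_right)
  then show ?thesis
    unfolding near_term_def * by (simp add: sum_distrib_left mult_ac add.commute[of s])
qed

lemma far_term_ibeta:
  assumes "0 < s" "0 < \<delta>" "2 < \<alpha>"
  shows "s * far_term s \<alpha> c \<delta> N = (\<Sum>m<N. c powr (2 / \<alpha>) / \<alpha> * s * (s powr (2 / \<alpha> - 1)
      * ibeta (1 - 2 / \<alpha>) (real m + 1) (s / (s + \<delta>))))"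
proof -
  have *: "s powr (2 / \<alpha> - 1) * s powr (1 - 2 / \<alpha>) = 1"
    using assms by (simp add: powr_add[symmetric])
  have e: "real m + 1 - (1 - 2 / \<alpha>) = real m + 2 / \<alpha>" "1 - 2 / \<alpha> + 1 = 2 - 2 / \<alpha>" for m
    by simp_all
  have "s powr (2 / \<alpha> - 1) * ibeta (1 - 2 / \<alpha>) (real m + 1) (s / (s + \<delta>))
      = (s powr (2 / \<alpha> - 1) * s powr (1 - 2 / \<alpha>)) * (\<delta> powr (real m + 2 / \<alpha>) / (s + \<delta>) ^ (m + 1)
        * hyp2F1 1 (real m + 1) (2 - 2 / \<alpha>) (s / (s + \<delta>)) / (1 - 2 / \<alpha>))" for m
    unfolding ibeta_quotient[OF assms(1,2)] e
        by (simp only: mult.assoc times_divide_eq_left times_divide_eq_right)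
  then show ?thesis
    unfolding far_term_def * by (simp add: sum_distrib_left mult_ac)
qed

text \<open>Common part of the near and the far integral: the antiderivatives of the summands are
  added, and the two cases differ only in the one-sided limits at the ends.\<close>

lemma nn_integral_fade_loss:
  fixes G :: "nat \<Rightarrow> real \<Rightarrow> real" and a b :: ereal
  assumes pos: "0 < s" "0 < c" and ab: "0 \<le> a" "a < b"
    and G: "\<And>m r. 0 < r \<Longrightarrow>
      (G m has_field_derivative s * (r powr \<alpha> / c) ^ m / (s + r powr \<alpha> / c) ^ (m + 1) * r) (at r)"
    and lims: "\<And>m. ((G m \<circ> real_of_ereal) \<longlongrightarrow> A m) (at_right a)"
      "\<And>m. ((G m \<circ> real_of_ereal) \<longlongrightarrow> B m) (at_left b)"
  shows "(\<integral>\<^sup>+ r. ennreal (fade_loss N (s * (c * r powr (- \<alpha>))) * r)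
      * indicator (einterval a b) r \<partial>lborel)
      = ennreal (\<Sum>m<N. B m - A m)"
    "0 \<le> (\<Sum>m<N. B m - A m)"
proof -
  have r0: "0 < r" if "a < ereal r" for r
    using order.strict_trans1[OF ab(1) that] by simp
  have D: "((\<lambda>r. \<Sum>m<N. G m r) has_field_derivative fade_loss N (s * (c * r powr (- \<alpha>))) * r) (at r)"
      if "0 < r" for r
    using G[OF that] unfolding fade_loss_powr_eq_sum[OF pos that] by (rule DERIV_sum)
  have cont: "isCont (\<lambda>r. fade_loss N (s * (c * r powr (- \<alpha>))) * r) r" if "0 < r" for r
  proof -
    have "0 < 1 + s * (c * r powr (- \<alpha>))"
      using pos by (intro add_pos_nonneg) auto
    then show ?thesis
      using that unfolding fade_loss_def by (intro continuous_intros) auto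
  qed
  have nonneg: "0 \<le> fade_loss N (s * (c * r powr (- \<alpha>))) * r" if "0 < r" for r
    using that pos by (simp add: fade_loss_bounds)
  have l: "(((\<lambda>r. \<Sum>m<N. G m r) \<circ> real_of_ereal) \<longlongrightarrow> (\<Sum>m<N. A m)) (at_right a)"
    using lims(1) unfolding comp_def by (intro tendsto_sum)
  have u: "(((\<lambda>r. \<Sum>m<N. G m r) \<circ> real_of_ereal) \<longlongrightarrow> (\<Sum>m<N. B m)) (at_left b)"
    using lims(2) unfolding comp_def by (intro tendsto_sum)
  note FTC = nn_integral_einterval_FTC[OF ab(2),
      where f = "\<lambda>r. fade_loss N (s * (c * r powr (- \<alpha>))) * r", OF _ _ _ l u]
  show "(\<integral>\<^sup>+ r. ennreal (fade_loss N (s * (c * r powr (- \<alpha>))) * r)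
      * indicator (einterval a b) r \<partial>lborel)
      = ennreal (\<Sum>m<N. B m - A m)"
    unfolding sum_subtractf by (rule FTC(1)) (intro D cont nonneg r0; simp)+
  have "(\<Sum>m<N. A m) \<le> (\<Sum>m<N. B m)"
    by (rule FTC(2)) (intro D cont nonneg r0; simp)+
  then show "0 \<le> (\<Sum>m<N. B m - A m)"
    by (simp add: sum_subtractf)
qed

lemma nn_integral_near:
  fixes s c \<alpha> D :: real
  assumes "0 < s" "0 < c" "0 < \<alpha>" "0 < D"
  shows "(\<integral>\<^sup>+ r. ennreal (fade_loss N (s * (c * r powr (- \<alpha>))) * r) * indicator {0<..<D} r \<partial>lborel)
      = ennreal (s * near_term s \<alpha> c (D powr \<alpha> / c) N)"
    "0 \<le> near_term s \<alpha> c (D powr \<alpha> / c) N"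
proof -
  define G where "G m r = c powr (2 / \<alpha>) / \<alpha> * s * (s powr (2 / \<alpha> - 1)
      * ibeta (real m + 2 / \<alpha>) (real m + 1) (r powr \<alpha> / c / (r powr \<alpha> / c + s)))" for m r
  have G: "(G m has_field_derivative s * (r powr \<alpha> / c) ^ m / (s + r powr \<alpha> / c) ^ (m + 1) * r) (at r)"
    if "0 < r" for m r
    unfolding G_def using assms that by (intro near_antideriv)
  have "filterlim (\<lambda>r. r powr \<alpha> / c / (r powr \<alpha> / c + s)) (at_right 0) (at_right 0)"
    using assms by real_asymp
  then have "((\<lambda>r. ibeta (real m + 2 / \<alpha>) (real m + 1) (r powr \<alpha> / c / (r powr \<alpha> / c + s))) \<longlongrightarrow> 0)
      (at_right 0)" for m
    using assms by (intro filterlim_compose[OF ibeta_tendsto_0]) (auto intro: add_nonneg_pos)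
  then have "(G m \<longlongrightarrow> c powr (2 / \<alpha>) / \<alpha> * s * (s powr (2 / \<alpha> - 1) * 0)) (at_right 0)" for m
    unfolding G_def[abs_def] by (intro tendsto_mult tendsto_const)
  then have l: "((G m \<circ> real_of_ereal) \<longlongrightarrow> 0) (at_right (ereal 0))" for m
    by (simp add: ereal_tendsto_simps del: zero_ereal_def)
  have "(G m \<longlongrightarrow> G m D) (at D)" for m
    using DERIV_isCont[OF G[OF assms(4)]] by (simp add: isCont_def)
  then have u: "((G m \<circ> real_of_ereal) \<longlongrightarrow> G m D) (at_left (ereal D))" for m
    by (simp add: ereal_tendsto_simps filterlim_at_split)
  have ein: "einterval (ereal 0) (ereal D) = {0<..<D}"
    by (auto simp: einterval_def)
  have GD: "(\<Sum>m<N. G m D - 0) = s * near_term s \<alpha> c (D powr \<alpha> / c) N"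
    using assms by (subst near_term_ibeta) (auto simp: G_def)
  have "0 \<le> ereal 0" "ereal 0 < ereal D"
    using assms by simp_all
  note int = nn_integral_fade_loss[OF assms(1,2) this G l u, of N, unfolded GD ein]
  show "(\<integral>\<^sup>+ r. ennreal (fade_loss N (s * (c * r powr (- \<alpha>))) * r) * indicator {0<..<D} r \<partial>lborel)
      = ennreal (s * near_term s \<alpha> c (D powr \<alpha> / c) N)"
    by (rule int(1))
  show "0 \<le> near_term s \<alpha> c (D powr \<alpha> / c) N"
    using int(2) assms by (simp add: zero_le_mult_iff)
qed

lemma nn_integral_far:
  fixes s c \<alpha> D :: real
  assumes "0 < s" "0 < c" "2 < \<alpha>" "0 < D"
  shows "(\<integral>\<^sup>+ r. ennreal (fade_loss N (s * (c * r powr (- \<alpha>))) * r) * indicator {D<..} r \<partial>lborel)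
      = ennreal (s * far_term s \<alpha> c (D powr \<alpha> / c) N)"
    "0 \<le> far_term s \<alpha> c (D powr \<alpha> / c) N"
proof -
  define G where "G m r = - (c powr (2 / \<alpha>) / \<alpha> * s * (s powr (2 / \<alpha> - 1)
      * ibeta (1 - 2 / \<alpha>) (real m + 1) (s / (s + r powr \<alpha> / c))))" for m r
  have G: "(G m has_field_derivative s * (r powr \<alpha> / c) ^ m / (s + r powr \<alpha> / c) ^ (m + 1) * r) (at r)"
    if "0 < r" for m r
    unfolding G_def using assms that by (intro far_antideriv)
  have "filterlim (\<lambda>r. s / (s + r powr \<alpha> / c)) (at_right 0) at_top"
    using assms by real_asymp
  then have "((\<lambda>r. ibeta (1 - 2 / \<alpha>) (real m + 1) (s / (s + r powr \<alpha> / c))) \<longlongrightarrow> 0) at_top" for m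
    using assms by (intro filterlim_compose[OF ibeta_tendsto_0]) auto
  then have "(G m \<longlongrightarrow> - (c powr (2 / \<alpha>) / \<alpha> * s * (s powr (2 / \<alpha> - 1) * 0))) at_top" for m
    unfolding G_def[abs_def] by (intro tendsto_minus tendsto_mult tendsto_const)
  then have u: "((G m \<circ> real_of_ereal) \<longlongrightarrow> 0) (at_left \<infinity>)" for m
    by (simp add: ereal_tendsto_simps)
  have "(G m \<longlongrightarrow> G m D) (at D)" for m
    using DERIV_isCont[OF G[OF assms(4)]] by (simp add: isCont_def)
  then have l: "((G m \<circ> real_of_ereal) \<longlongrightarrow> G m D) (at_right (ereal D))" for m
    by (simp add: ereal_tendsto_simps filterlim_at_split)
  have ein: "einterval (ereal D) \<infinity> = {D<..}"
    by (auto simp: einterval_def)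
  have GD: "(\<Sum>m<N. 0 - G m D) = s * far_term s \<alpha> c (D powr \<alpha> / c) N"
    using assms by (subst far_term_ibeta) (auto simp: G_def)
  have "0 \<le> ereal D" "ereal D < \<infinity>"
    using assms by simp_all
  note int = nn_integral_fade_loss[OF assms(1,2) this G l u, of N, unfolded GD ein]
  show "(\<integral>\<^sup>+ r. ennreal (fade_loss N (s * (c * r powr (- \<alpha>))) * r) * indicator {D<..} r \<partial>lborel)
      = ennreal (s * far_term s \<alpha> c (D powr \<alpha> / c) N)"
    by (rule int(1))
  show "0 \<le> far_term s \<alpha> c (D powr \<alpha> / c) N"
    using int(2) assms by (simp add: zero_le_mult_iff)
qed

section \<open>Averaging over a single eavesdropper\<close>

definition state_prob :: "net_params \<Rightarrow> link_state \<Rightarrow> real \<Rightarrow> real" where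
  "state_prob P j r = (case j of LOS \<Rightarrow> los_prob P r | NLOS \<Rightarrow> 1 - los_prob P r)"

text \<open>Laplace transform at \<open>s\<close> of the signal received over one link of state
  \<open>j\<close> and path loss \<open>l\<close>, with fading and antenna gain averaged
  out.\<close>

definition link_laplace :: "net_params \<Rightarrow> real \<Rightarrow> link_state \<Rightarrow> real \<Rightarrow> real" where
  "link_laplace P s j l = (\<Sum>v\<in>{Main, Side}. lobe_prob P v
      * (1 / (1 + s * (lobe_gain P v * l)) ^ nak P j))"

text \<open>The link state is averaged out as well; \<open>r\<close> is the distance from the
  serving station to the eavesdropper.\<close>

definition eve_laplace :: "net_params \<Rightarrow> real \<Rightarrow> real \<Rightarrow> real" where
  "eve_laplace P s r = (\<Sum>j\<in>{LOS, NLOS}. state_prob P j r * link_laplace P s j (path_loss P j r))"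

lemma convex_comb_bounds:
  fixes p q x y :: real
  assumes "0 \<le> p" "0 \<le> q" "p + q = 1" "0 < x" "x \<le> 1" "0 < y" "y \<le> 1"
  shows "0 < p * x + q * y" "p * x + q * y \<le> 1"
proof -
  show "p * x + q * y \<le> 1"
    using assms by (intro convex_bound_le) auto
  have "p * min x y + q * min x y \<le> p * x + q * y"
    using assms by (intro add_mono mult_left_mono) auto
  also have "p * min x y + q * min x y = min x y"
    using assms by (simp add: distrib_right[symmetric])
  finally show "0 < p * x + q * y"
    using assms by simp
qed

context secure_network
begin

lemma pl_C_pos: "0 < pl_C P j"
  using path_loss_const by (cases j) auto

lemma pl_exp_pos: "0 < pl_exp P j"
  using path_loss_exp by (cases j) auto

lemma lobe_prob_nonneg: "0 \<le> lobe_prob P v" and sum_lobe_prob: "lobe_prob P Main + lobe_prob P Side = 1"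
  using beam by (auto simp: lobe_prob_def field_simps split: lobe.split)

lemma los_prob_bounds: "0 \<le> los_prob P r" "los_prob P r \<le> 1"
  using blockage by (auto simp: los_prob_def)

lemma state_prob_nonneg: "0 \<le> state_prob P j r"
    and sum_state_prob: "state_prob P LOS r + state_prob P NLOS r = 1"
  using los_prob_bounds[of r] by (auto simp: state_prob_def split: link_state.split)

lemma path_loss_nonneg: "0 \<le> path_loss P j r"
  using pl_C_pos[of j] by (simp add: path_loss_def)

lemma link_laplace_bounds:
  assumes "0 < s" "0 \<le> l"
  shows "0 < link_laplace P s j l" "link_laplace P s j l \<le> 1"
proof -
  define a where "a v = 1 / (1 + s * (lobe_gain P v * l)) ^ nak P j" for v
  have a: "0 < a v" "a v \<le> 1" for v
  proof -
    have "1 \<le> 1 + s * (lobe_gain P v * l)"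
      using assms gains_pos[of v] by simp
    then show "0 < a v" "a v \<le> 1"
      by (auto simp: a_def intro!: zero_less_power one_le_power)
  qed
  have eq: "link_laplace P s j l = lobe_prob P Main * a Main + lobe_prob P Side * a Side"
    by (simp add: link_laplace_def a_def)
  show "0 < link_laplace P s j l" "link_laplace P s j l \<le> 1"
    unfolding eq by (intro convex_comb_bounds a lobe_prob_nonneg sum_lobe_prob)+
qed

text \<open>Strict positivity makes \<open>- ln (eve_laplace P s r)\<close> the logarithm of a
  genuine factor, and the bound 1 makes it nonnegative; it is the test function for the Laplace
  functional.\<close>

lemma eve_laplace_bounds:
  assumes "0 < s"
  shows "0 < eve_laplace P s r" "eve_laplace P s r \<le> 1"
proof -
  define a where "a j = link_laplace P s j (path_loss P j r)" for j
  have a: "0 < a j" "a j \<le> 1" for j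
    using link_laplace_bounds[OF assms path_loss_nonneg] by (simp_all add: a_def)
  have eq: "eve_laplace P s r = state_prob P LOS r * a LOS + state_prob P NLOS r * a NLOS"
    by (simp add: eve_laplace_def a_def)
  show "0 < eve_laplace P s r" "eve_laplace P s r \<le> 1"
    unfolding eq by (intro convex_comb_bounds a state_prob_nonneg sum_state_prob)+
qed

lemma borel_measurable_eve_laplace [measurable]: "eve_laplace P s \<in> borel_measurable borel"
proof -
  have [measurable]: "state_prob P j \<in> borel_measurable borel" for j
    by (cases j) (simp_all add: state_prob_def[abs_def] los_prob_def[abs_def])
  show ?thesis
    unfolding eve_laplace_def[abs_def] link_laplace_def path_loss_def by measurable
qed

lemma one_minus_eve_laplace:
  "1 - eve_laplace P s r = (\<Sum>j\<in>{LOS, NLOS}. state_prob P j r * (\<Sum>v\<in>{Main, Side}. lobe_prob P v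
      * fade_loss (nak P j) (s * (lobe_gain P v * pl_C P j * r powr (- pl_exp P j)))))"
proof -
  have "1 - link_laplace P s j (path_loss P j r) = (\<Sum>v\<in>{Main, Side}. lobe_prob P v
      * fade_loss (nak P j) (s * (lobe_gain P v * pl_C P j * r powr (- pl_exp P j))))" for j
    using sum_lobe_prob by (simp add: link_laplace_def fade_loss_def path_loss_def
        right_diff_distrib mult.assoc)
  then have "(\<Sum>j\<in>{LOS, NLOS}. state_prob P j r * (\<Sum>v\<in>{Main, Side}. lobe_prob P v
      * fade_loss (nak P j) (s * (lobe_gain P v * pl_C P j * r powr (- pl_exp P j)))))
      = (\<Sum>j\<in>{LOS, NLOS}. state_prob P j r * (1 - link_laplace P s j (path_loss P j r)))"
    by simp
  also have "\<dots> = 1 - eve_laplace P s r"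
    using sum_state_prob[of r] by (simp add: eve_laplace_def right_diff_distrib)
  finally show ?thesis ..
qed

text \<open>In polar coordinates the state probabilities are constant on either side of the blockage
  radius: \<open>inner_prob\<close> inside, NLOS alone outside. The sign of \<open>Xi\<close> is
  stated too, so that \<open>ennreal (- Xi P s)\<close> loses no information.\<close>

lemma nn_integral_one_minus_eve_laplace:
  assumes s: "0 < s" and \<alpha>: "2 < pl_exp P NLOS"
  shows "ennreal (lamE P) * (\<integral>\<^sup>+z. ennreal (1 - eve_laplace P s (norm (z::plane))) \<partial>lborel)
      = ennreal (- Xi P s)"
    "Xi P s \<le> 0"
proof -
  define c where "c j v = lobe_gain P v * pl_C P j" for j v
  have c: "0 < c j v" for j v
    using gains_pos[of v] pl_C_pos[of j] by (simp add: c_def)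
  define g where "g j v r = fade_loss (nak P j) (s * (c j v * r powr (- pl_exp P j))) * r" for j v r
  define near where "near j v = near_term s (pl_exp P j) (c j v) (block_D P powr pl_exp P j
      / c j v) (nak P j)" for j v
  define far where "far v = far_term s (pl_exp P NLOS) (c NLOS v) (block_D P powr pl_exp P NLOS
      / c NLOS v) (nak P NLOS)" for v
  note D = blockage(1)
  have near: "(\<integral>\<^sup>+r. ennreal (g j v r) * indicator {0<..<block_D P} r \<partial>lborel)
      = ennreal (s * near j v)" "0 \<le> near j v" for j v
    using nn_integral_near[OF s c pl_exp_pos D] by (simp_all add: g_def near_def)
  have far: "(\<integral>\<^sup>+r. ennreal (g NLOS v r) * indicator {block_D P<..} r \<partial>lborel)
      = ennreal (s * far v)" "0 \<le> far v" for v
    using nn_integral_far[OF s c \<alpha> D] by (simp_all add: g_def far_def)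
  have g_nonneg: "0 \<le> g j v r" if "0 < r" for j v r
    using that s c[of j v] by (simp add: g_def fade_loss_bounds)
  have [measurable]: "g j v \<in> borel_measurable borel" for j v
    unfolding g_def[abs_def] fade_loss_def by measurable
  have ip: "0 \<le> inner_prob P j" for j
    using blockage by (simp add: inner_prob_def split: link_state.split)
  let ?N = "\<lambda>r. \<Sum>j\<in>{LOS, NLOS}. \<Sum>v\<in>{Main, Side}. ennreal (inner_prob P j * lobe_prob P v)
      * (ennreal (g j v r) * indicator {0<..<block_D P} r)"
  let ?F = "\<lambda>r. \<Sum>v\<in>{Main, Side}. ennreal (lobe_prob P v)
      * (ennreal (g NLOS v r) * indicator {block_D P<..} r)"
  have "(\<integral>\<^sup>+z. ennreal (1 - eve_laplace P s (norm (z::plane))) \<partial>lborel)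
      = (\<integral>\<^sup>+r. ennreal (2 * pi * r) * indicator {0..} r * ennreal (1 - eve_laplace P s r) \<partial>lborel)"
    by (rule nn_integral_radial) measurable
  also have "\<dots> = (\<integral>\<^sup>+r. ennreal (2 * pi) * (?N r + ?F r) \<partial>lborel)"
  proof (rule nn_integral_cong_AE)
    \<comment> \<open>The open intervals of \<open>near\<close> and \<open>far\<close> omit the two
      radii 0 and \<open>block_D P\<close>, a null set.\<close>
    have "AE r in lborel. r \<noteq> (0::real)" "AE r in lborel. r \<noteq> block_D P"
      by (rule AE_lborel_singleton)+
    then show "AE r in lborel. ennreal (2 * pi * r) * indicator {0..} r
        * ennreal (1 - eve_laplace P s r) = ennreal (2 * pi) * (?N r + ?F r)"
    proof eventually_elim
      case (elim r)
      consider "r < 0" | "0 < r" "r < block_D P" | "block_D P < r"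
        using elim by linarith
      then show ?case
      proof cases
        case 1
        then show ?thesis
          using D by simp
      next
        case 2
        have q: "state_prob P j r = inner_prob P j" for j
          using 2 by (simp add: state_prob_def inner_prob_def los_prob_def split: link_state.split)
        have "r * (1 - eve_laplace P s r)
            = (\<Sum>j\<in>{LOS, NLOS}. \<Sum>v\<in>{Main, Side}. inner_prob P j * lobe_prob P v * g j v r)"
          unfolding one_minus_eve_laplace q by (simp add: g_def c_def algebra_simps)
        then have "2 * pi * r * (1 - eve_laplace P s r)
            = 2 * pi * (\<Sum>j\<in>{LOS, NLOS}. \<Sum>v\<in>{Main, Side}. inner_prob P j * lobe_prob P v * g j v r)"
          by simp
        moreover have "ennreal (2 * pi * r) * indicator {0..} r * ennreal (1 - eve_laplace P s r)
            = ennreal (2 * pi * r * (1 - eve_laplace P s r))"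
          using 2 eve_laplace_bounds[OF s] by (simp add: ennreal_mult)
        moreover have "?N r + ?F r
            = ennreal (\<Sum>j\<in>{LOS, NLOS}. \<Sum>v\<in>{Main, Side}. inner_prob P j * lobe_prob P v * g j v r)"
          using 2 g_nonneg[OF 2(1)] ip lobe_prob_nonneg
          by (simp add: ennreal_mult[symmetric] ennreal_plus[symmetric] del: ennreal_plus)
        ultimately show ?thesis
          by (simp only: ennreal_mult'[symmetric] pi_ge_zero mult_nonneg_nonneg zero_le_numeral)
      next
        case 3
        then have r: "0 < r"
          using D by simp
        have q: "state_prob P LOS r = 0" "state_prob P NLOS r = 1"
          using 3 by (simp_all add: state_prob_def los_prob_def)
        have "r * (1 - eve_laplace P s r) = (\<Sum>v\<in>{Main, Side}. lobe_prob P v * g NLOS v r)"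
          unfolding one_minus_eve_laplace by (simp add: q g_def c_def algebra_simps)
        then have "2 * pi * r * (1 - eve_laplace P s r)
            = 2 * pi * (\<Sum>v\<in>{Main, Side}. lobe_prob P v * g NLOS v r)"
          by simp
        moreover have "ennreal (2 * pi * r) * indicator {0..} r * ennreal (1 - eve_laplace P s r)
            = ennreal (2 * pi * r * (1 - eve_laplace P s r))"
          using r eve_laplace_bounds[OF s] by (simp add: ennreal_mult)
        moreover have "?N r + ?F r = ennreal (\<Sum>v\<in>{Main, Side}. lobe_prob P v * g NLOS v r)"
          using 3 r g_nonneg[OF r] lobe_prob_nonneg
          by (simp add: ennreal_mult[symmetric] ennreal_plus[symmetric] del: ennreal_plus)
        ultimately show ?thesis
          by (simp only: ennreal_mult'[symmetric] pi_ge_zero mult_nonneg_nonneg zero_le_numeral)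
      qed
    qed
  qed
  also have "\<dots> = ennreal (2 * pi)
      * ((\<Sum>j\<in>{LOS, NLOS}. \<Sum>v\<in>{Main, Side}. ennreal (inner_prob P j * lobe_prob P v) * ennreal
          (s * near j v))
      + (\<Sum>v\<in>{Main, Side}. ennreal (lobe_prob P v) * ennreal (s * far v)))"
    by (simp add: nn_integral_cmult nn_integral_add near far)
  also have "\<dots> = ennreal (2 * pi
      * ((\<Sum>j\<in>{LOS, NLOS}. \<Sum>v\<in>{Main, Side}. inner_prob P j * lobe_prob P v * (s * near j v))
      + (\<Sum>v\<in>{Main, Side}. lobe_prob P v * (s * far v))))"
    using ip lobe_prob_nonneg near(2) far(2) s
    by (simp add: ennreal_mult[symmetric] ennreal_plus[symmetric] del: ennreal_plus)
  finally have eq: "(\<integral>\<^sup>+z. ennreal (1 - eve_laplace P s (norm (z::plane))) \<partial>lborel) = \<dots>" .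
  have "Xi P s = - s * (2 * pi * lamE P
      * (\<Sum>j\<in>{LOS, NLOS}. inner_prob P j * (\<Sum>v\<in>{Main, Side}. lobe_prob P v * near j v))
      + 2 * pi * lamE P * (\<Sum>v\<in>{Main, Side}. lobe_prob P v * far v))"
    unfolding Xi_def near_def near_term_def far_def far_term_def c_def delta_def
        by (simp add: mult.assoc)
  then have Xi: "- Xi P s = lamE P
      * (2 * pi * ((\<Sum>j\<in>{LOS, NLOS}. \<Sum>v\<in>{Main, Side}. inner_prob P j * lobe_prob P v * (s * near j v))
      + (\<Sum>v\<in>{Main, Side}. lobe_prob P v * (s * far v))))"
    by (simp add: algebra_simps)
  show "ennreal (lamE P) * (\<integral>\<^sup>+z. ennreal (1 - eve_laplace P s (norm (z::plane))) \<partial>lborel)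
      = ennreal (- Xi P s)"
    unfolding eq Xi using intensities by (intro ennreal_mult'[symmetric]) simp
  have "0 \<le> - Xi P s"
    unfolding Xi using ip lobe_prob_nonneg near(2) far(2) s intensities
    by (intro mult_nonneg_nonneg add_nonneg_nonneg sum_nonneg) auto
  then show "Xi P s \<le> 0"
    by simp
qed

end

section \<open>Conditional independence\<close>

lemma emeasure_distr_density:
  assumes [measurable]: "V \<in> measurable M N" "g \<in> borel_measurable M" "A \<in> sets N"
  shows "emeasure (distr (density M g) N V) A = (\<integral>\<^sup>+w. indicator A (V w) * g w \<partial>M)"
proof -
  have "emeasure (distr (density M g) N V) A = (\<integral>\<^sup>+w. g w * indicator (V -` A \<inter> space M) w \<partial>M)"
    by (simp add: emeasure_distr emeasure_density)
  also have "\<dots> = (\<integral>\<^sup>+w. indicator A (V w) * g w \<partial>M)"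
    by (intro nn_integral_cong) (auto split: split_indicator)
  finally show ?thesis .
qed

text \<open>Equality tested on events of \<open>V\<close> makes the two weighted laws of
  \<open>V\<close> equal measures, so it extends to functions of \<open>V\<close>; in other words,
  \<open>g\<close> and \<open>h\<close> have the same conditional expectation given
  \<open>V\<close>.\<close>

lemma nn_integral_cong_of_emeasure_vimage:
  assumes V: "V \<in> measurable M N"
    and g [measurable]: "g \<in> borel_measurable M" and h [measurable]: "h \<in> borel_measurable M"
    and eq: "\<And>A. A \<in> sets N \<Longrightarrow>
      (\<integral>\<^sup>+w. indicator A (V w) * g w \<partial>M) = (\<integral>\<^sup>+w. indicator A (V w) * h w \<partial>M)"
    and F: "F \<in> borel_measurable N"
  shows "(\<integral>\<^sup>+w. F (V w) * g w \<partial>M) = (\<integral>\<^sup>+w. F (V w) * h w \<partial>M)"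
proof -
  note V [measurable] F [measurable]
  have "distr (density M g) N V = distr (density M h) N V"
  proof (rule measure_eqI)
    fix A
    assume "A \<in> sets (distr (density M g) N V)"
    then have A [measurable]: "A \<in> sets N"
      by simp
    show "emeasure (distr (density M g) N V) A = emeasure (distr (density M h) N V) A"
      using eq[OF A] by (simp add: emeasure_distr_density)
  qed simp
  then have "(\<integral>\<^sup>+x. F x \<partial>distr (density M g) N V) = (\<integral>\<^sup>+x. F x \<partial>distr (density M h) N V)"
    by simp
  then show ?thesis
    by (simp add: nn_integral_distr nn_integral_density mult.commute)
qed

text \<open>Disintegration: the joint law of \<open>U\<close> and \<open>Y\<close> agrees on
  rectangles with the semidirect product of the law of \<open>U\<close> and the kernel, and
  rectangles are an intersection-stable generator.\<close>

lemma nn_integral_kernel: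
  assumes M: "finite_measure M" and U: "U \<in> measurable M N" and Y: "Y \<in> measurable M K"
    and \<kappa>: "\<kappa> \<in> measurable N (subprob_algebra K)"
    and rect: "\<And>A B. A \<in> sets N \<Longrightarrow> B \<in> sets K \<Longrightarrow>
      emeasure M {w \<in> space M. U w \<in> A \<and> Y w \<in> B} = (\<integral>\<^sup>+w. indicator A (U w) * emeasure (\<kappa> (U w)) B \<partial>M)"
    and F: "F \<in> borel_measurable (N \<Otimes>\<^sub>M K)"
  shows "(\<integral>\<^sup>+w. F (U w, Y w) \<partial>M) = (\<integral>\<^sup>+w. (\<integral>\<^sup>+y. F (U w, y) \<partial>\<kappa> (U w)) \<partial>M)"
proof (cases "space M = {}")
  case True
  then show ?thesis
    by (simp add: nn_integral_empty)
next
  case False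
  interpret finite_measure M by fact
  note U [measurable] Y [measurable] \<kappa> [measurable] F [measurable]
  \<comment> \<open>The law of a pair sampled in two stages: \<open>u\<close> from the law of
    \<open>U\<close>, then \<open>y\<close> from the kernel at \<open>u\<close>.\<close>
  define R where "R = distr M N U \<bind> (\<lambda>u. \<kappa> u \<bind> (\<lambda>y. return (N \<Otimes>\<^sub>M K) (u, y)))"
  have sets_\<kappa>: "sets (\<kappa> u) = sets K" if "u \<in> space N" for u
    using sets_kernel[OF \<kappa> that] .
  have ker: "(\<lambda>u. \<kappa> u \<bind> (\<lambda>y. return (N \<Otimes>\<^sub>M K) (u, y))) \<in> measurable N (subprob_algebra (N \<Otimes>\<^sub>M K))"
    by measurable
  \<comment> \<open>A \<open>bind\<close> has the expected measurable sets over a nonempty space,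
    which is why an empty \<open>M\<close> was treated separately.\<close>
  have ne: "space N \<noteq> {}"
    using measurable_space[OF U] False by auto
  have nnR: "(\<integral>\<^sup>+x. G x \<partial>R) = (\<integral>\<^sup>+w. (\<integral>\<^sup>+y. G (U w, y) \<partial>\<kappa> (U w)) \<partial>M)"
    if G [measurable]: "G \<in> borel_measurable (N \<Otimes>\<^sub>M K)" for G
  proof -
    have "(\<integral>\<^sup>+x. G x \<partial>R) = (\<integral>\<^sup>+u. (\<integral>\<^sup>+x. G x \<partial>(\<kappa> u \<bind> (\<lambda>y. return (N \<Otimes>\<^sub>M K) (u, y)))) \<partial>distr M N U)"
      unfolding R_def by (rule nn_integral_bind[OF G]) (use ker in simp)
    also have "\<dots> = (\<integral>\<^sup>+u. (\<integral>\<^sup>+y. G (u, y) \<partial>\<kappa> u) \<partial>distr M N U)"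
    proof (rule nn_integral_cong)
      fix u
      assume "u \<in> space (distr M N U)"
      then have u [measurable]: "u \<in> space N"
        by simp
      have 1: "(\<lambda>y. return (N \<Otimes>\<^sub>M K) (u, y)) \<in> measurable (\<kappa> u) (subprob_algebra (N \<Otimes>\<^sub>M K))"
        using u by (simp cong: measurable_cong_sets add: sets_\<kappa>)
      have "(\<integral>\<^sup>+x. G x \<partial>(\<kappa> u \<bind> (\<lambda>y. return (N \<Otimes>\<^sub>M K) (u, y))))
          = (\<integral>\<^sup>+y. (\<integral>\<^sup>+x. G x \<partial>return (N \<Otimes>\<^sub>M K) (u, y)) \<partial>\<kappa> u)"
        by (rule nn_integral_bind[OF G 1])
      also have "\<dots> = (\<integral>\<^sup>+y. G (u, y) \<partial>\<kappa> u)"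
        using u sets_eq_imp_space_eq[OF sets_\<kappa>[OF u]]
        by (intro nn_integral_cong nn_integral_return) (auto simp: space_pair_measure)
      finally show "(\<integral>\<^sup>+x. G x \<partial>(\<kappa> u \<bind> (\<lambda>y. return (N \<Otimes>\<^sub>M K) (u, y)))) = (\<integral>\<^sup>+y. G (u, y) \<partial>\<kappa> u)" .
    qed
    also have "\<dots> = (\<integral>\<^sup>+w. (\<integral>\<^sup>+y. G (U w, y) \<partial>\<kappa> (U w)) \<partial>M)"
    proof (rule nn_integral_distr[OF U])
      show "(\<lambda>u. \<integral>\<^sup>+y. G (u, y) \<partial>\<kappa> u) \<in> borel_measurable (distr M N U)"
        using nn_integral_measurable_subprob_algebra2[of "\<lambda>u y. G (u, y)" N K \<kappa>] by simp
    qed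
    finally show ?thesis .
  qed
  have sR: "sets R = sets (N \<Otimes>\<^sub>M K)"
    unfolding R_def
  proof (rule sets_bind)
    show "sets (\<kappa> u \<bind> (\<lambda>y. return (N \<Otimes>\<^sub>M K) (u, y))) = sets (N \<Otimes>\<^sub>M K)" if "u \<in> space (distr M N U)"
        for u
      using that by (intro sets_kernel[OF ker]) simp
  qed (use ne in simp)
  have emR: "emeasure R (A \<times> B) = (\<integral>\<^sup>+w. indicator A (U w) * emeasure (\<kappa> (U w)) B \<partial>M)"
    if [measurable]: "A \<in> sets N" "B \<in> sets K" for A B
  proof -
    have "emeasure R (A \<times> B) = (\<integral>\<^sup>+x. indicator (A \<times> B) x \<partial>R)"
      using that by (simp add: sR)
    also have "\<dots> = (\<integral>\<^sup>+w. (\<integral>\<^sup>+y. indicator (A \<times> B) (U w, y) \<partial>\<kappa> (U w)) \<partial>M)"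
      by (rule nnR) measurable
    also have "\<dots> = (\<integral>\<^sup>+w. indicator A (U w) * emeasure (\<kappa> (U w)) B \<partial>M)"
    proof (rule nn_integral_cong)
      fix w
      assume "w \<in> space M"
      then have "B \<in> sets (\<kappa> (U w))"
        using that measurable_space[OF U] by (simp add: sets_\<kappa>)
      then show "(\<integral>\<^sup>+y. indicator (A \<times> B) (U w, y) \<partial>\<kappa> (U w)) = indicator A (U w) * emeasure (\<kappa> (U w)) B"
        by (simp add: indicator_times nn_integral_cmult_indicator)
    qed
    finally show ?thesis .
  qed
  have "distr M (N \<Otimes>\<^sub>M K) (\<lambda>w. (U w, Y w)) = R"
  proof (rule measure_eqI_generator_eq[OF Int_stable_pair_measure_generator pair_measure_closed,
        where A = "\<lambda>_. space N \<times> space K"])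
    fix X
    assume "X \<in> {a \<times> b |a b. a \<in> sets N \<and> b \<in> sets K}"
    then obtain A B where X: "X = A \<times> B" and AB [measurable]: "A \<in> sets N" "B \<in> sets K"
      by auto
    have "(\<lambda>w. (U w, Y w)) -` (A \<times> B) \<inter> space M = {w \<in> space M. U w \<in> A \<and> Y w \<in> B}"
      by auto
    then show "emeasure (distr M (N \<Otimes>\<^sub>M K) (\<lambda>w. (U w, Y w))) X = emeasure R X"
      unfolding X using rect[OF AB] by (simp add: emeasure_distr emR)
  next
    show "emeasure (distr M (N \<Otimes>\<^sub>M K) (\<lambda>w. (U w, Y w))) (space N \<times> space K) \<noteq> \<infinity>"
      by (simp add: emeasure_distr)
  qed (auto simp: sR sets_pair_measure)
  then have "(\<integral>\<^sup>+x. F x \<partial>distr M (N \<Otimes>\<^sub>M K) (\<lambda>w. (U w, Y w))) = (\<integral>\<^sup>+x. F x \<partial>R)"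
    by simp
  then show ?thesis
    by (simp add: nn_integral_distr nnR)
qed

text \<open>Rectangles whose second side is a finite-dimensional cylinder form an
  intersection-stable generator of the product, so they determine a finite measure.\<close>

lemma measure_eq_pair_PiM:
  assumes sets: "sets P = sets (N \<Otimes>\<^sub>M PiM I (\<lambda>_. K))" "sets Q = sets (N \<Otimes>\<^sub>M PiM I (\<lambda>_. K))"
    and fin: "finite_measure P"
    and eq: "\<And>A J B. A \<in> sets N \<Longrightarrow> finite J \<Longrightarrow> J \<subseteq> I \<Longrightarrow> (\<And>i. i \<in> J \<Longrightarrow> B i \<in> sets K) \<Longrightarrow>
      emeasure P (A \<times> {f \<in> space (PiM I (\<lambda>_. K)). \<forall>i\<in>J. f i \<in> B i})
      = emeasure Q (A \<times> {f \<in> space (PiM I (\<lambda>_. K)). \<forall>i\<in>J. f i \<in> B i})"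
  shows "P = Q"
proof -
  let ?PI = "PiM I (\<lambda>_. K)"
  let ?E = "{a \<times> b | a b. a \<in> sets N \<and> b \<in> prod_algebra I (\<lambda>_. K)}"
  interpret finite_measure P by fact
  have top: "space ?PI \<in> prod_algebra I (\<lambda>_. K)"
    unfolding space_PiM by (rule space_in_prod_algebra)
  have into: "prod_algebra I (\<lambda>_. K) \<subseteq> Pow (space ?PI)"
    unfolding space_PiM by (rule prod_algebra_sets_into_space)
  have gen: "sets (N \<Otimes>\<^sub>M ?PI) = sigma_sets (space N \<times> space ?PI) ?E"
  proof -
    have "sets (N \<Otimes>\<^sub>M ?PI) = sets (sigma (space N \<times> space ?PI) ?E)"
      using into top
      by (intro sets_pair_eq[where Ca = "{space N}" and Cb = "{space ?PI}"])
        (auto simp: sets.sigma_sets_eq sets.space_closed sets_PiM space_PiM)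
    also have "\<dots> = sigma_sets (space N \<times> space ?PI) ?E"
      using into sets.space_closed[of N] by (intro sets_measure_of) blast
    finally show ?thesis .
  qed
  show ?thesis
  proof (rule measure_eqI_generator_eq[where E = ?E and A = "\<lambda>_. space N \<times> space ?PI"])
    show "Int_stable ?E"
    proof (rule Int_stableI)
      fix X Y
      assume "X \<in> ?E" "Y \<in> ?E"
      then obtain a b a' b' where "X = a \<times> b" "Y = a' \<times> b'" and a: "a \<in> sets N" "a' \<in> sets N"
        and b: "b \<in> prod_algebra I (\<lambda>_. K)" "b' \<in> prod_algebra I (\<lambda>_. K)"
        by auto
      then have "X \<inter> Y = (a \<inter> a') \<times> (b \<inter> b')"
        by auto
      moreover have "b \<inter> b' \<in> prod_algebra I (\<lambda>_. K)"
        using Int_stable_prod_algebra b by (rule Int_stableD)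
      ultimately show "X \<inter> Y \<in> ?E"
        using a by blast
    qed
    show "?E \<subseteq> Pow (space N \<times> space ?PI)"
      using into sets.space_closed[of N] by blast
    show "range (\<lambda>_. space N \<times> space ?PI) \<subseteq> ?E"
      using top by blast
    fix X
    assume "X \<in> ?E"
    then obtain a b where X: "X = a \<times> b" "a \<in> sets N" "b \<in> prod_algebra I (\<lambda>_. K)"
      by auto
    from X(3) obtain J B where J: "b = prod_emb I (\<lambda>_. K) J (\<Pi>\<^sub>E j\<in>J. B j)" "finite J" "J \<subseteq> I"
      "\<And>i. i \<in> J \<Longrightarrow> B i \<in> sets K"
      by (rule prod_algebraE) blast
    have "b = {f \<in> space ?PI. \<forall>i\<in>J. f i \<in> B i}"
      using J(3) by (auto simp: J(1) prod_emb_def space_PiM)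
    then show "emeasure P X = emeasure Q X"
      using eq[OF X(2) J(2,3,4)] by (simp add: X(1))
  qed (auto simp: sets gen)
qed

lemma nn_integral_indicator_Collect:
  assumes "{w \<in> space M. Q w} \<in> sets M" "\<And>w. w \<in> space M \<Longrightarrow> f w = (if Q w then 1 else 0)"
  shows "(\<integral>\<^sup>+w. f w \<partial>M) = emeasure M {w \<in> space M. Q w}"
proof -
  have "(\<integral>\<^sup>+w. f w \<partial>M) = (\<integral>\<^sup>+w. indicator {w \<in> space M. Q w} w \<partial>M)"
    by (intro nn_integral_cong) (auto simp: assms(2))
  then show ?thesis
    using assms(1) by simp
qed

text \<open>Enlarges the conditioning from \<open>V\<close> to \<open>V\<close> together with the
  whole family \<open>Y\<close>; tests on cylinders suffice. The bound \<open>g w \<le> 1\<close>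
  makes the weighted law finite, as uniqueness from a generator requires.\<close>

lemma nn_integral_indicator_restrict_cong:
  assumes M: "finite_measure M"
    and V [measurable]: "V \<in> measurable M N" and Y: "\<And>i. i \<in> I \<Longrightarrow> Y i \<in> measurable M K"
    and g [measurable]: "g \<in> borel_measurable M" and h [measurable]: "h \<in> borel_measurable M"
    and g_le: "\<And>w. w \<in> space M \<Longrightarrow> g w \<le> 1"
    and rect: "\<And>A L C. A \<in> sets N \<Longrightarrow> finite L \<Longrightarrow> L \<subseteq> I \<Longrightarrow> (\<And>i. i \<in> L \<Longrightarrow> C i \<in> sets K) \<Longrightarrow>
      (\<integral>\<^sup>+w. indicator A (V w) * indicator {w. \<forall>i\<in>L. Y i w \<in> C i} w * g w \<partial>M)
      = (\<integral>\<^sup>+w. indicator A (V w) * indicator {w. \<forall>i\<in>L. Y i w \<in> C i} w * h w \<partial>M)"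
    and A: "A \<in> sets (N \<Otimes>\<^sub>M PiM I (\<lambda>_. K))"
  shows "(\<integral>\<^sup>+w. indicator A (V w, \<lambda>i\<in>I. Y i w) * g w \<partial>M)
    = (\<integral>\<^sup>+w. indicator A (V w, \<lambda>i\<in>I. Y i w) * h w \<partial>M)"
proof -
  interpret finite_measure M by fact
  let ?N = "N \<Otimes>\<^sub>M PiM I (\<lambda>_. K)" and ?U = "\<lambda>w. (V w, \<lambda>i\<in>I. Y i w)"
  have U [measurable]: "?U \<in> measurable M ?N"
    using Y by (intro measurable_Pair measurable_restrict) auto
  have "distr (density M g) ?N ?U = distr (density M h) ?N ?U"
  proof (rule measure_eq_pair_PiM)
    have "(\<integral>\<^sup>+w. g w \<partial>M) \<le> (\<integral>\<^sup>+w. 1 \<partial>M)"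
      by (intro nn_integral_mono g_le)
    also have "\<dots> < \<infinity>"
      by (simp add: less_top[symmetric])
    finally have "(\<integral>\<^sup>+w. g w \<partial>M) < \<infinity>" .
    then show "finite_measure (distr (density M g) ?N ?U)"
      by (intro finite_measure.finite_measure_distr finite_measureI)
        (auto simp: emeasure_density cong: nn_integral_cong)
    fix A L C
    assume A: "A \<in> sets N" and L: "finite L" "L \<subseteq> I" "\<And>i. i \<in> L \<Longrightarrow> C i \<in> sets K"
    let ?R = "A \<times> {f \<in> space (PiM I (\<lambda>_. K)). \<forall>i\<in>L. f i \<in> C i}"
    have "Measurable.pred (PiM I (\<lambda>_. K)) (\<lambda>f. \<forall>i\<in>L. f i \<in> C i)"
      using L by (intro pred_intros_finite)
          (auto intro!: pred_sets1[OF _ measurable_component_singleton])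
    then have R: "?R \<in> sets ?N"
      using A by (intro pair_measureI) auto
    have "indicator ?R (?U w) = (indicator A (V w) * indicator {w. \<forall>i\<in>L. Y i w \<in> C i} w :: ennreal)"
      if "w \<in> space M" for w
      using L(2) measurable_space[OF U that] by (auto simp: space_pair_measure split: split_indicator)
    then show "emeasure (distr (density M g) ?N ?U) ?R = emeasure (distr (density M h) ?N ?U) ?R"
      using rect[OF A L] by (simp add: emeasure_distr_density[OF U _ R] cong: nn_integral_cong)
  qed simp_all
  then show ?thesis
    using emeasure_distr_density[OF U g A] emeasure_distr_density[OF U h A] by simp
qed

lemma nn_integral_indicator_vimage:
  assumes "U \<in> measurable M N" "A \<in> sets N"
  shows "(\<integral>\<^sup>+w. indicator A (U w) \<partial>M) = emeasure M {w \<in> space M. U w \<in> A}"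
  using assms by (intro nn_integral_indicator_Collect) (auto split: split_indicator)

text \<open>Independence is the case of a constant kernel, the law of \<open>Y\<close>; the inner
  integral over a copy \<open>w'\<close> spares later statements any mention of that law.\<close>

lemma (in prob_space) nn_integral_indep:
  assumes U [measurable]: "U \<in> measurable M N" and Y [measurable]: "Y \<in> measurable M K"
    and rect: "\<And>A B. A \<in> sets N \<Longrightarrow> B \<in> sets K \<Longrightarrow> emeasure M {w \<in> space M. U w \<in> A \<and> Y w \<in> B}
      = emeasure M {w \<in> space M. U w \<in> A} * emeasure M {w \<in> space M. Y w \<in> B}"
    and F [measurable]: "F \<in> borel_measurable (N \<Otimes>\<^sub>M K)"
  shows "(\<integral>\<^sup>+w. F (U w, Y w) \<partial>M) = (\<integral>\<^sup>+w. (\<integral>\<^sup>+w'. F (U w, Y w') \<partial>M) \<partial>M)"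
proof -
  interpret D: prob_space "distr M K Y"
    by (rule prob_space_distr[OF Y])
  have "(\<integral>\<^sup>+w. F (U w, Y w) \<partial>M) = (\<integral>\<^sup>+w. (\<integral>\<^sup>+y. F (U w, y) \<partial>(\<lambda>_. distr M K Y) (U w)) \<partial>M)"
  proof (rule nn_integral_kernel[OF finite_measure_axioms U Y _ _ F])
    show "(\<lambda>_. distr M K Y) \<in> measurable N (subprob_algebra K)"
      by (intro measurable_const)
        (simp add: space_subprob_algebra prob_space_imp_subprob_space D.prob_space_axioms)
    fix A B
    assume [measurable]: "A \<in> sets N" "B \<in> sets K"
    have "emeasure (distr M K Y) B = emeasure M {w \<in> space M. Y w \<in> B}"
      by (subst emeasure_distr) (auto intro!: arg_cong[where f = "emeasure M"])
    then show "emeasure M {w \<in> space M. U w \<in> A \<and> Y w \<in> B}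
        = (\<integral>\<^sup>+w. indicator A (U w) * emeasure ((\<lambda>_. distr M K Y) (U w)) B \<partial>M)"
      by (simp add: rect nn_integral_multc nn_integral_indicator_vimage[OF U])
  qed
  also have "\<dots> = (\<integral>\<^sup>+w. (\<integral>\<^sup>+w'. F (U w, Y w') \<partial>M) \<partial>M)"
  proof (rule nn_integral_cong)
    fix w
    assume "w \<in> space M"
    then have [measurable]: "U w \<in> space N"
      by (rule measurable_space[OF U])
    show "(\<integral>\<^sup>+y. F (U w, y) \<partial>(\<lambda>_. distr M K Y) (U w)) = (\<integral>\<^sup>+w'. F (U w, Y w') \<partial>M)"
      by (subst nn_integral_distr[OF Y]) simp_all
  qed
  finally show ?thesis .
qed

section \<open>Integrating out conditionally independent marks\<close>

text \<open>Passes from the events of \<open>V\<close> in the definition to arbitrary nonnegative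
  weights in \<open>V\<close>; products of kernels will occur as such weights.\<close>

lemma cond_indep_given_nn_integral:
  assumes cig: "cond_indep_given M N V I K Y (\<lambda>i w. k i (V w))"
    and k: "\<And>i. i \<in> I \<Longrightarrow> k i \<in> measurable N (subprob_algebra K)"
    and J: "finite J" "J \<subseteq> I" "\<And>i. i \<in> J \<Longrightarrow> B i \<in> sets K"
    and F: "F \<in> borel_measurable N"
  shows "(\<integral>\<^sup>+w. F (V w) * indicator {w. \<forall>i\<in>J. Y i w \<in> B i} w \<partial>M)
    = (\<integral>\<^sup>+w. F (V w) * (\<Prod>i\<in>J. emeasure (k i (V w)) (B i)) \<partial>M)"
proof (rule nn_integral_cong_of_emeasure_vimage[OF _ _ _ _ F])
  show V [measurable]: "V \<in> measurable M N"
    using cig by (simp add: cond_indep_given_def)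
  have [measurable]: "Y i \<in> measurable M K" if "i \<in> J" for i
    using cig that J by (auto simp: cond_indep_given_def)
  have [measurable]: "B i \<in> sets K" if "i \<in> J" for i
    using J that by auto
  note k' = measurable_compose[OF V measurable_emeasure_kernel[OF k]]
  have S: "Measurable.pred M (\<lambda>w. \<forall>i\<in>J. Y i w \<in> B i)"
    using J(1) by (intro pred_intros_finite) auto
  then show "(\<lambda>w. indicator {w. \<forall>i\<in>J. Y i w \<in> B i} w :: ennreal) \<in> borel_measurable M"
    by (auto simp: indicator_def[abs_def])
  show "(\<lambda>w. \<Prod>i\<in>J. emeasure (k i (V w)) (B i)) \<in> borel_measurable M"
    using J by (intro borel_measurable_prod_ennreal k') auto
  fix A
  assume A [measurable]: "A \<in> sets N"
  have "(\<integral>\<^sup>+w. indicator A (V w) * indicator {w. \<forall>i\<in>J. Y i w \<in> B i} w \<partial>M)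
      = emeasure M {w \<in> space M. V w \<in> A \<and> (\<forall>i\<in>J. Y i w \<in> B i)}"
    using S by (intro nn_integral_indicator_Collect) (auto split: split_indicator)
  then show "(\<integral>\<^sup>+w. indicator A (V w) * indicator {w. \<forall>i\<in>J. Y i w \<in> B i} w \<partial>M)
      = (\<integral>\<^sup>+w. indicator A (V w) * (\<Prod>i\<in>J. emeasure (k i (V w)) (B i)) \<partial>M)"
    using cig J A by (simp add: cond_indep_given_def)
qed

text \<open>Marks may be moved into the conditioning without changing the kernels of the others. On
  a cylinder the events of absorbed and remaining marks are together replaced by kernels; then the
  absorbed ones are changed back, the kernels of the rest being a weight in
  \<open>V\<close>.\<close>

lemma cond_indep_given_absorb:
  assumes cig: "cond_indep_given M N V I K Y (\<lambda>i w. k i (V w))"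
    and M: "finite_measure M"
    and k: "\<And>i. i \<in> I \<Longrightarrow> k i \<in> measurable N (subprob_algebra K)"
    and I: "I1 \<subseteq> I" "I2 \<subseteq> I" "I1 \<inter> I2 = {}"
  shows "cond_indep_given M (N \<Otimes>\<^sub>M PiM I1 (\<lambda>_. K)) (\<lambda>w. (V w, \<lambda>i\<in>I1. Y i w)) I2 K Y (\<lambda>i w. k i (V w))"
  unfolding cond_indep_given_def
proof (intro conjI allI impI; (elim conjE)?)
  let ?U = "\<lambda>w. (V w, \<lambda>i\<in>I1. Y i w)"
  interpret finite_measure M by fact
  have V [measurable]: "V \<in> measurable M N"
    using cig by (simp add: cond_indep_given_def)
  have Y [measurable]: "Y i \<in> measurable M K" if "i \<in> I" for i
    using cig that by (auto simp: cond_indep_given_def)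
  show "\<forall>i\<in>I2. Y i \<in> measurable M K"
    using I Y by auto
  have U [measurable]: "(\<lambda>w. \<lambda>i\<in>I1. Y i w) \<in> measurable M (PiM I1 (\<lambda>_. K))"
    using I Y by (intro measurable_restrict) auto
  show VU [measurable]: "?U \<in> measurable M (N \<Otimes>\<^sub>M PiM I1 (\<lambda>_. K))"
    by measurable
  fix J B and A :: "('b \<times> ('c \<Rightarrow> 'd)) set"
  assume J: "J \<subseteq> I2" "finite J" "\<forall>i\<in>J. B i \<in> sets K" and A: "A \<in> sets (N \<Otimes>\<^sub>M PiM I1 (\<lambda>_. K))"
  define g :: "'a \<Rightarrow> ennreal" where "g = (\<lambda>w. indicator {w. \<forall>i\<in>J. Y i w \<in> B i} w)"
  define h where "h = (\<lambda>w. \<Prod>i\<in>J. emeasure (k i (V w)) (B i))"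
  have S: "Measurable.pred M (\<lambda>w. \<forall>i\<in>L. Y i w \<in> C i)"
      if "finite L" "L \<subseteq> I" "\<And>i. i \<in> L \<Longrightarrow> C i \<in> sets K" for L C
    using that Y by (intro pred_intros_finite) (auto intro!: pred_sets1[OF _ Y])
  note k' = measurable_compose[OF V measurable_emeasure_kernel[OF k]]
  have SJ: "Measurable.pred M (\<lambda>w. \<forall>i\<in>J. Y i w \<in> B i)"
    using J I by (intro S) auto
  then have g [measurable]: "g \<in> borel_measurable M"
    by (auto simp: g_def indicator_def[abs_def])
  have h [measurable]: "h \<in> borel_measurable M"
    unfolding h_def using J I by (intro borel_measurable_prod_ennreal k') auto
  have "(\<integral>\<^sup>+w. indicator A (?U w) * g w \<partial>M) = (\<integral>\<^sup>+w. indicator A (?U w) * h w \<partial>M)"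
  proof (rule nn_integral_indicator_restrict_cong[OF M V _ g h _ _ A])
    fix A' L C
    assume [measurable]: "A' \<in> sets N" and L: "finite L" "L \<subseteq> I1" "\<And>i. i \<in> L \<Longrightarrow> C i \<in> sets K"
    let ?L = "\<lambda>w. indicator {w. \<forall>i\<in>L. Y i w \<in> C i} w :: ennreal"
    let ?BC = "\<lambda>i. if i \<in> L then C i else B i"
    have dis: "L \<inter> J = {}"
      using L J I by auto
    have "(\<integral>\<^sup>+w. indicator A' (V w) * ?L w * g w \<partial>M)
        = (\<integral>\<^sup>+w. indicator A' (V w) * indicator {w. \<forall>i\<in>L \<union> J. Y i w \<in> ?BC i} w \<partial>M)"
      using dis by (intro nn_integral_cong) (auto simp: g_def split: split_indicator)
    also have "\<dots> = (\<integral>\<^sup>+w. indicator A' (V w) * (\<Prod>i\<in>L \<union> J. emeasure (k i (V w)) (?BC i)) \<partial>M)"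
      using L J I by (intro cond_indep_given_nn_integral[OF cig k]) auto
    also have "\<dots> = (\<integral>\<^sup>+w. (indicator A' (V w) * h w) * (\<Prod>i\<in>L. emeasure (k i (V w)) (C i)) \<partial>M)"
    proof -
      have "(\<Prod>i\<in>L \<union> J. emeasure (k i (V w)) (?BC i)) = (\<Prod>i\<in>L. emeasure (k i (V w)) (C i)) * h w" for w
        unfolding h_def using L J dis
        by (subst prod.union_disjoint) (auto intro!: arg_cong2[where f = "(*)"] prod.cong)
      then show ?thesis
        by (simp add: mult_ac)
    qed
    also have "\<dots> = (\<integral>\<^sup>+w. (indicator A' (V w) * h w) * ?L w \<partial>M)"
      unfolding h_def
      using L J I by (intro cond_indep_given_nn_integral[OF cig k, symmetric,
            where F = "\<lambda>v. indicator A' v * (\<Prod>i\<in>J. emeasure (k i v) (B i))"])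
        (auto intro!: borel_measurable_times_ennreal borel_measurable_prod_ennreal
            measurable_emeasure_kernel[OF k])
    finally show "(\<integral>\<^sup>+w. indicator A' (V w) * ?L w * g w \<partial>M)
        = (\<integral>\<^sup>+w. indicator A' (V w) * ?L w * h w \<partial>M)"
      by (simp add: mult_ac)
  qed (use I Y in \<open>auto simp: g_def split: split_indicator\<close>)
  moreover have "(\<integral>\<^sup>+w. indicator A (?U w) * g w \<partial>M)
      = emeasure M {w \<in> space M. ?U w \<in> A \<and> (\<forall>i\<in>J. Y i w \<in> B i)}"
    using SJ A VU by (intro nn_integral_indicator_Collect) (auto simp: g_def split: split_indicator)
  ultimately show "emeasure M {w \<in> space M. ?U w \<in> A \<and> (\<forall>i\<in>J. Y i w \<in> B i)}
      = (\<integral>\<^sup>+w. indicator A (?U w) * (\<Prod>i\<in>J. emeasure (k i (V w)) (B i)) \<partial>M)"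
    by (simp add: h_def)
qed

text \<open>The marks in \<open>I1\<close> may still occur in the integrand: they belong to the
  conditioning while \<open>Y j\<close> is integrated against its kernel.\<close>

lemma cond_indep_given_single:
  assumes cig: "cond_indep_given M N V I K Y (\<lambda>i w. k i (V w))"
    and M: "finite_measure M"
    and k: "\<And>i. i \<in> I \<Longrightarrow> k i \<in> measurable N (subprob_algebra K)"
    and I: "I1 \<subseteq> I" "j \<in> I" "j \<notin> I1"
    and F: "F \<in> borel_measurable ((N \<Otimes>\<^sub>M PiM I1 (\<lambda>_. K)) \<Otimes>\<^sub>M K)"
  shows "(\<integral>\<^sup>+w. F ((V w, \<lambda>i\<in>I1. Y i w), Y j w) \<partial>M)
    = (\<integral>\<^sup>+w. (\<integral>\<^sup>+y. F ((V w, \<lambda>i\<in>I1. Y i w), y) \<partial>k j (V w)) \<partial>M)"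
proof -
  let ?U = "\<lambda>w. (V w, \<lambda>i\<in>I1. Y i w)" and ?N = "N \<Otimes>\<^sub>M PiM I1 (\<lambda>_. K)"
  have abs: "cond_indep_given M ?N ?U {j} K Y (\<lambda>i w. k i (V w))"
    using I by (intro cond_indep_given_absorb[OF cig M k]) auto
  have "(\<integral>\<^sup>+w. F (?U w, Y j w) \<partial>M)
    = (\<integral>\<^sup>+w. (\<integral>\<^sup>+y. F (?U w, y) \<partial>(\<lambda>u. k j (fst u)) (?U w)) \<partial>M)"
  proof (rule nn_integral_kernel[OF M _ _ _ _ F])
    show "?U \<in> measurable M ?N" "Y j \<in> measurable M K"
      using abs by (simp_all add: cond_indep_given_def)
    show "(\<lambda>u. k j (fst u)) \<in> measurable ?N (subprob_algebra K)"
      by (rule measurable_compose[OF measurable_fst k[OF I(2)]])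
    fix A B
    assume AB: "A \<in> sets ?N" "B \<in> sets K"
    have "\<forall>J B A. J \<subseteq> {j} \<and> finite J \<and> (\<forall>i\<in>J. B i \<in> sets K) \<and> A \<in> sets ?N \<longrightarrow>
        emeasure M {w \<in> space M. ?U w \<in> A \<and> (\<forall>i\<in>J. Y i w \<in> B i)} =
        (\<integral>\<^sup>+ w. indicator A (?U w) * (\<Prod>i\<in>J. emeasure (k i (V w)) (B i)) \<partial>M)"
      using abs by (simp add: cond_indep_given_def)
    from this[THEN spec[of _ "{j}"], THEN spec[of _ "\<lambda>_. B"], THEN spec[of _ A]] AB
    show "emeasure M {w \<in> space M. ?U w \<in> A \<and> Y j w \<in> B} =
        (\<integral>\<^sup>+ w. indicator A (?U w) * emeasure (k j (fst (?U w))) B \<partial>M)"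
      by simp
  qed
  then show ?thesis
    by simp
qed

text \<open>Induction on \<open>J\<close>: the integral of the factor for \<open>j\<close> is a
  function of \<open>V\<close> and joins the weight \<open>H\<close>, which is therefore kept
  arbitrary.\<close>

lemma cond_indep_given_prod:
  assumes cig: "cond_indep_given M N V I K Y (\<lambda>i w. k i (V w))"
    and M: "finite_measure M"
    and k: "\<And>i. i \<in> I \<Longrightarrow> k i \<in> measurable N (subprob_algebra K)"
    and J: "finite J" "J \<subseteq> I"
    and F: "\<And>i. i \<in> J \<Longrightarrow> F i \<in> borel_measurable (N \<Otimes>\<^sub>M K)"
    and H: "H \<in> borel_measurable N"
  shows "(\<integral>\<^sup>+w. H (V w) * (\<Prod>i\<in>J. F i (V w, Y i w)) \<partial>M)
    = (\<integral>\<^sup>+w. H (V w) * (\<Prod>i\<in>J. \<integral>\<^sup>+y. F i (V w, y) \<partial>k i (V w)) \<partial>M)"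
  using J F H
proof (induction J arbitrary: H rule: finite_induct)
  case (insert j J)
  note [measurable] = insert.prems(3)
  have F [measurable]: "F i \<in> borel_measurable (N \<Otimes>\<^sub>M K)" if "i \<in> insert j J" for i
    using insert.prems that by auto
  have j: "j \<in> I"
    using insert.prems by auto
  have V: "V \<in> measurable M N"
    using cig by (simp add: cond_indep_given_def)
  let ?F = "\<lambda>x. H (fst (fst x)) * (\<Prod>i\<in>J. F i (fst (fst x), snd (fst x) i)) * F j (fst (fst x), snd x)"
  have PF: "(\<lambda>x. \<Prod>i\<in>J. F i (fst (fst x), snd (fst x) i))
      \<in> borel_measurable ((N \<Otimes>\<^sub>M PiM J (\<lambda>_. K)) \<Otimes>\<^sub>M K)"
    by (intro borel_measurable_prod_ennreal measurable_compose[OF _ F]) measurable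
  then have F': "?F \<in> borel_measurable ((N \<Otimes>\<^sub>M PiM J (\<lambda>_. K)) \<Otimes>\<^sub>M K)"
    by measurable
  let ?H = "\<lambda>v. H v * (\<integral>\<^sup>+y. F j (v, y) \<partial>k j v)"
  have H': "?H \<in> borel_measurable N"
    using nn_integral_measurable_subprob_algebra2[OF _ k[OF j], of "\<lambda>v y. F j (v, y)"] by simp
  have "(\<integral>\<^sup>+w. H (V w) * (\<Prod>i\<in>insert j J. F i (V w, Y i w)) \<partial>M)
      = (\<integral>\<^sup>+w. ?F ((V w, \<lambda>i\<in>J. Y i w), Y j w) \<partial>M)"
    using insert.hyps by (intro nn_integral_cong) (simp add: mult_ac)
  also have "\<dots> = (\<integral>\<^sup>+w. (\<integral>\<^sup>+y. ?F ((V w, \<lambda>i\<in>J. Y i w), y) \<partial>k j (V w)) \<partial>M)"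
    using insert.hyps insert.prems j by (intro cond_indep_given_single[OF cig M k _ _ _ F']) auto
  also have "\<dots> = (\<integral>\<^sup>+w. ?H (V w) * (\<Prod>i\<in>J. F i (V w, Y i w)) \<partial>M)"
  proof (rule nn_integral_cong)
    fix w
    assume w: "w \<in> space M"
    have "(\<lambda>y. F j (V w, y)) \<in> borel_measurable (k j (V w))"
      using measurable_space[OF V w] sets_kernel[OF k[OF j], of "V w"]
      by (simp cong: measurable_cong_sets)
    then show "(\<integral>\<^sup>+y. ?F ((V w, \<lambda>i\<in>J. Y i w), y) \<partial>k j (V w)) = ?H (V w) * (\<Prod>i\<in>J. F i (V w, Y i w))"
      by (simp add: nn_integral_cmult nn_integral_multc mult_ac)
  qed
  also have "\<dots> = (\<integral>\<^sup>+w. ?H (V w) * (\<Prod>i\<in>J. \<integral>\<^sup>+y. F i (V w, y) \<partial>k i (V w)) \<partial>M)"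
    using insert.prems by (intro insert.IH[OF _ _ H']) auto
  also have "\<dots> = (\<integral>\<^sup>+w. H (V w) * (\<Prod>i\<in>insert j J. \<integral>\<^sup>+y. F i (V w, y) \<partial>k i (V w)) \<partial>M)"
    using insert.hyps by (intro nn_integral_cong) (simp add: mult_ac)
  finally show ?case .
qed simp

text \<open>The kernels depend on \<open>X\<close> and not on \<open>Z\<close>. On a cylinder the
  events of \<open>Y\<close> therefore become functions of \<open>X\<close>, then the indicator of
  \<open>Z\<close> is replaced by its mean \<open>c\<close>, and finally the kernels become events
  again.\<close>

lemma cond_indep_given_pair_indep:
  assumes cig: "cond_indep_given M (N1 \<Otimes>\<^sub>M N2) (\<lambda>w. (X w, Z w)) I K Y (\<lambda>i w. k i (X w))"
    and M: "prob_space M"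
    and k: "\<And>i. i \<in> I \<Longrightarrow> k i \<in> measurable N1 (subprob_algebra K)"
    and indep: "prob_space.indep_var M N1 X N2 Z"
    and A: "A \<in> sets (N1 \<Otimes>\<^sub>M PiM I (\<lambda>_. K))" and C: "C \<in> sets N2"
  shows "emeasure M {w \<in> space M. (X w, \<lambda>i\<in>I. Y i w) \<in> A \<and> Z w \<in> C}
    = emeasure M {w \<in> space M. (X w, \<lambda>i\<in>I. Y i w) \<in> A} * emeasure M {w \<in> space M. Z w \<in> C}"
proof -
  interpret prob_space M by fact
  have X [measurable]: "X \<in> measurable M N1" and Z [measurable]: "Z \<in> measurable M N2"
    using indep by (auto dest: indep_var_rv1 indep_var_rv2)
  have Y [measurable]: "Y i \<in> measurable M K" if "i \<in> I" for i
    using cig that by (auto simp: cond_indep_given_def)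
  note C [measurable]
  have XY [measurable]: "(\<lambda>w. (X w, \<lambda>i\<in>I. Y i w)) \<in> measurable M (N1 \<Otimes>\<^sub>M PiM I (\<lambda>_. K))"
    using Y by (intro measurable_Pair measurable_restrict) auto
  define c where "c = emeasure M {w \<in> space M. Z w \<in> C}"
  define g :: "'a \<Rightarrow> ennreal" where "g = (\<lambda>w. indicator C (Z w))"
  have g [measurable]: "g \<in> borel_measurable M"
    by (simp add: g_def)
  \<comment> \<open>Against functions of \<open>X\<close> alone, the indicator of \<open>Z\<close>
    acts like the constant \<open>c\<close>.\<close>
  have XZ: "(\<integral>\<^sup>+w. F (X w) * g w \<partial>M) = (\<integral>\<^sup>+w. F (X w) * c \<partial>M)"
    if F: "F \<in> borel_measurable N1" for F
  proof (rule nn_integral_cong_of_emeasure_vimage[OF X g _ _ F])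
    fix A
    assume A [measurable]: "A \<in> sets N1"
    have "(\<integral>\<^sup>+w. indicator A (X w) * g w \<partial>M) = emeasure M {w \<in> space M. X w \<in> A \<and> Z w \<in> C}"
      by (intro nn_integral_indicator_Collect) (auto simp: g_def split: split_indicator)
    also have "{w \<in> space M. X w \<in> A \<and> Z w \<in> C} = (\<lambda>w. (X w, Z w)) -` (A \<times> C) \<inter> space M"
      by auto
    also have "emeasure M \<dots> = emeasure M (X -` A \<inter> space M) * emeasure M (Z -` C \<inter> space M)"
      using indep_varD[OF indep A C] by (simp add: emeasure_eq_measure ennreal_mult)
    also have "\<dots> = (\<integral>\<^sup>+w. indicator A (X w) \<partial>M) * c"
      by (subst nn_integral_indicator_Collect[where Q = "\<lambda>w. X w \<in> A"])
        (auto simp: c_def vimage_def Int_def conj_commute split: split_indicator)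
    finally show "(\<integral>\<^sup>+w. indicator A (X w) * g w \<partial>M) = (\<integral>\<^sup>+w. indicator A (X w) * c \<partial>M)"
      by (simp add: nn_integral_multc)
  qed simp
  let ?U = "\<lambda>w. (X w, \<lambda>i\<in>I. Y i w)"
  have "(\<integral>\<^sup>+w. indicator A (?U w) * g w \<partial>M) = (\<integral>\<^sup>+w. indicator A (?U w) * c \<partial>M)"
  proof (rule nn_integral_indicator_restrict_cong[OF finite_measure_axioms X Y g _ _ _ A])
    fix A' L B
    assume A' [measurable]: "A' \<in> sets N1" and L: "finite L" "L \<subseteq> I" "\<And>i. i \<in> L \<Longrightarrow> B i \<in> sets K"
    let ?P = "\<lambda>x. \<Prod>i\<in>L. emeasure (k i x) (B i)"
    let ?L = "\<lambda>w. indicator {w. \<forall>i\<in>L. Y i w \<in> B i} w :: ennreal"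
    have k': "k i \<in> measurable N1 (subprob_algebra K)" "B i \<in> sets K" if "i \<in> L" for i
      using k L that by auto
    have P [measurable]: "?P \<in> borel_measurable N1"
      by (intro borel_measurable_prod_ennreal measurable_emeasure_kernel[OF k'])
    have cond: "(\<integral>\<^sup>+w. (indicator A' (X w) * G (Z w)) * ?L w \<partial>M)
        = (\<integral>\<^sup>+w. (indicator A' (X w) * G (Z w)) * ?P (X w) \<partial>M)"
      if [measurable]: "G \<in> borel_measurable N2" for G
    proof -
      have "cond_indep_given M (N1 \<Otimes>\<^sub>M N2) (\<lambda>w. (X w, Z w)) I K Y (\<lambda>i w. (\<lambda>v. k i (fst v)) (X w, Z w))"
        using cig by simp
      from cond_indep_given_nn_integral[OF this _ L, where F = "\<lambda>v. indicator A' (fst v) * G (snd v)"]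
      show ?thesis
        using k by (simp add: measurable_compose[OF measurable_fst])
    qed
    have "(\<integral>\<^sup>+w. indicator A' (X w) * ?L w * g w \<partial>M)
        = (\<integral>\<^sup>+w. (indicator A' (X w) * indicator C (Z w)) * ?L w \<partial>M)"
      by (simp add: g_def mult_ac)
    also have "\<dots> = (\<integral>\<^sup>+w. (indicator A' (X w) * ?P (X w)) * g w \<partial>M)"
      by (subst cond) (simp_all add: g_def mult_ac)
    also have "\<dots> = (\<integral>\<^sup>+w. (indicator A' (X w) * ?P (X w)) * c \<partial>M)"
      using P by (intro XZ[of "\<lambda>x. indicator A' x * ?P x"]) simp
    also have "\<dots> = (\<integral>\<^sup>+w. (indicator A' (X w) * c) * ?L w \<partial>M)"
      by (subst cond[of "\<lambda>_. c"]) (simp_all add: mult_ac)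
    finally show "(\<integral>\<^sup>+w. indicator A' (X w) * ?L w * g w \<partial>M) = (\<integral>\<^sup>+w. indicator A' (X w) * ?L w * c \<partial>M)"
      by (simp add: mult_ac)
  qed (auto simp: g_def split: split_indicator)
  moreover have "(\<integral>\<^sup>+w. indicator A (?U w) * g w \<partial>M)
      = emeasure M {w \<in> space M. ?U w \<in> A \<and> Z w \<in> C}"
    using A pred_sets2[OF A XY]
    by (intro nn_integral_indicator_Collect) (auto simp: g_def split: split_indicator)
  moreover have "(\<integral>\<^sup>+w. indicator A (?U w) * c \<partial>M)
      = emeasure M {w \<in> space M. ?U w \<in> A} * c"
  proof -
    have "(\<integral>\<^sup>+w. indicator A (?U w) * c \<partial>M) = (\<integral>\<^sup>+w. indicator A (?U w) \<partial>M) * c"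
      using A XY by (intro nn_integral_multc measurable_compose[OF XY]) simp
    also have "(\<integral>\<^sup>+w. indicator A (?U w) \<partial>M) = emeasure M {w \<in> space M. ?U w \<in> A}"
      by (rule nn_integral_indicator_vimage[OF XY A])
    finally show ?thesis .
  qed
  ultimately show ?thesis
    by (simp add: c_def)
qed

section \<open>Laplace functional of a Poisson process\<close>

text \<open>Real-valued, so that it serves under \<open>ennreal\<close> and in Bochner integrals
  alike; with this value at infinity it is continuous on \<open>[0, \<infinity>]\<close> and turns
  sums into products.\<close>

definition expneg :: "ennreal \<Rightarrow> real" where
  "expneg x = (if x = \<infinity> then 0 else exp (- enn2real x))"

lemma expneg_simps [simp]: "expneg \<top> = 0" "expneg \<infinity> = 0" "expneg 0 = 1" "0 \<le> x \<Longrightarrow> expneg (ennreal x)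
    = exp (- x)"
  by (simp_all add: expneg_def)

lemma expneg_nonneg [simp]: "0 \<le> expneg x" and expneg_le_1 [simp]: "expneg x \<le> 1"
  by (simp_all add: expneg_def)

lemma expneg_add: "expneg (x + y) = expneg x * expneg y"
  by (cases x; cases y) (simp_all add: exp_add[symmetric] ennreal_plus[symmetric] del: ennreal_plus)

lemma expneg_sum: "expneg (\<Sum>i\<in>A. f i) = (\<Prod>i\<in>A. expneg (f i))"
  by (induction A rule: infinite_finite_induct) (simp_all add: expneg_add)

lemma expneg_of_nat_mult: "expneg (of_nat n * x) = expneg x ^ n"
  by (induction n) (simp_all add: distrib_right expneg_add)

lemma expneg_antimono: "x \<le> y \<Longrightarrow> expneg y \<le> expneg x"
  by (cases x; cases y) (auto simp: top_unique)

lemma borel_measurable_expneg [measurable]: "expneg \<in> borel_measurable borel"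
  unfolding expneg_def[abs_def] by measurable

lemma tendsto_expneg:
  assumes f: "(f \<longlongrightarrow> x) F"
  shows "((\<lambda>i. expneg (f i)) \<longlongrightarrow> expneg x) F"
proof (cases x)
  case (real r)
  then have "(f \<longlongrightarrow> ennreal r) F"
    using f by simp
  then have "((\<lambda>i. enn2real (f i)) \<longlongrightarrow> r) F"
    using real(1) by (rule tendsto_enn2real)
  then have "((\<lambda>i. exp (- enn2real (f i))) \<longlongrightarrow> exp (- r)) F"
    by (intro tendsto_exp tendsto_minus)
  moreover have "eventually (\<lambda>i. f i < \<infinity>) F"
    using order_tendstoD(2)[OF f, of \<infinity>] real by simp
  then have "eventually (\<lambda>i. exp (- enn2real (f i)) = expneg (f i)) F"
    by eventually_elim (simp add: expneg_def)
  ultimately show ?thesis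
    using real by (simp add: tendsto_cong)
next
  case top
  show ?thesis
    unfolding top
  proof (rule order_tendstoI)
    fix e :: real
    assume e: "expneg \<top> < e"
    \<comment> \<open>The absolute value dominates \<open>- ln e\<close> and is nonnegative, so
      \<open>ennreal\<close> does not truncate the bound.\<close>
    have "eventually (\<lambda>i. ennreal (\<bar>ln e\<bar>) < f i) F"
      using order_tendstoD(1)[OF f, of "ennreal (\<bar>ln e\<bar>)"] top by simp
    then show "eventually (\<lambda>i. expneg (f i) < e) F"
    proof eventually_elim
      case (elim i)
      show ?case
      proof (cases "f i")
        case (real r)
        then have "- ln e < r"
          using elim by (simp add: ennreal_less_iff)
        then have "exp (- r) < exp (ln e)"
          by simp
        also have "\<dots> = e"
          using e by simp
        finally show ?thesis
          using real by simp
      qed (use e in simp)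
    qed
  next
    fix e :: real
    assume "e < expneg \<top>"
    then have "e < expneg (f i)" for i
      by (intro less_le_trans[OF _ expneg_nonneg]) simp
    then show "eventually (\<lambda>i. e < expneg (f i)) F"
      by simp
  qed
qed

text \<open>Splitting by the value \<open>k\<close> of the variable leaves the exponential series at
  \<open>\<mu> * exp (- x)\<close>.\<close>

lemma (in prob_space) poisson_laplace:
  assumes N [measurable]: "N \<in> measurable M (count_space (UNIV :: nat set))"
    and pois: "\<And>k. measure M {w \<in> space M. N w = k} = \<mu> ^ k / fact k * exp (- \<mu>)"
    and \<mu>: "0 \<le> \<mu>"
  shows "(\<integral>\<^sup>+w. ennreal (exp (- (x * real (N w)))) \<partial>M) = ennreal (exp (- (\<mu> * (1 - exp (- x)))))"
proof -
  have "(\<integral>\<^sup>+w. ennreal (exp (- (x * real (N w)))) \<partial>M)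
      = (\<integral>\<^sup>+w. (\<Sum>k. ennreal (exp (- (x * real k))) * indicator {w \<in> space M. N w = k} w) \<partial>M)"
  proof (rule nn_integral_cong)
    fix w
    assume "w \<in> space M"
    then have "(\<Sum>k. ennreal (exp (- (x * real k))) * indicator {w \<in> space M. N w = k} w)
        = (\<Sum>k\<in>{N w}. ennreal (exp (- (x * real k))) * indicator {w \<in> space M. N w = k} w)"
      by (intro suminf_finite) (auto split: split_indicator)
    then show "ennreal (exp (- (x * real (N w))))
        = (\<Sum>k. ennreal (exp (- (x * real k))) * indicator {w \<in> space M. N w = k} w)"
      using \<open>w \<in> space M\<close> by simp
  qed
  also have "\<dots> = (\<Sum>k. ennreal (exp (- (x * real k))) * emeasure M {w \<in> space M. N w = k})"
    by (subst nn_integral_suminf) (simp_all add: nn_integral_cmult_indicator)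
  also have "\<dots> = (\<Sum>k. ennreal ((\<mu> * exp (- x)) ^ k /\<^sub>R fact k * exp (- \<mu>)))"
  proof (rule suminf_cong)
    fix k
    have "exp (- (x * real k)) = exp (- x) ^ k"
      by (simp add: exp_of_nat_mult[symmetric] mult.commute)
    then show "ennreal (exp (- (x * real k))) * emeasure M {w \<in> space M. N w = k}
        = ennreal ((\<mu> * exp (- x)) ^ k /\<^sub>R fact k * exp (- \<mu>))"
      using \<mu> by (simp add: emeasure_eq_measure pois ennreal_mult[symmetric] power_mult_distrib
          field_simps)
  qed
  also have "\<dots> = ennreal (exp (\<mu> * exp (- x)) * exp (- \<mu>))"
    using \<mu> by (intro suminf_ennreal_eq sums_mult2 exp_converges) simp
  also have "exp (\<mu> * exp (- x)) * exp (- \<mu>) = exp (- (\<mu> * (1 - exp (- x))))"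
    by (simp add: exp_add[symmetric] algebra_simps)
  finally show ?thesis .
qed

text \<open>An injective enumeration hits each point once, so indices and points in \<open>B\<close>
  are equinumerous.\<close>

lemma suminf_indicator_enumeration:
  assumes "inj x" "finite (range x \<inter> B)"
  shows "(\<Sum>k. indicator B (x k) :: ennreal) = of_nat (card (range x \<inter> B))"
proof -
  have *: "x ` {k. x k \<in> B} = range x \<inter> B"
    by auto
  then have fin: "finite {k. x k \<in> B}"
    using assms by (metis finite_imageD inj_on_subset subset_UNIV)
  have "(\<Sum>k. indicator B (x k) :: ennreal) = (\<Sum>k\<in>{k. x k \<in> B}. indicator B (x k))"
    using fin by (intro suminf_finite) auto
  also have "\<dots> = of_nat (card {k. x k \<in> B})"
    by simp
  also have "card {k. x k \<in> B} = card (range x \<inter> B)"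
    using assms(1) by (subst *[symmetric], subst card_image) (auto intro: inj_on_subset)
  finally show ?thesis .
qed

text \<open>For a step function on disjoint bounded sets the sum over the points is a linear
  combination of counts, which are independent and Poisson.\<close>

lemma (in prob_space) PPP_laplace_finite:
  fixes B :: "nat \<Rightarrow> plane set" and c :: "nat \<Rightarrow> real"
  assumes PPP: "homogeneous_PPP M lam \<Phi>" and enum: "enumerates M X \<Phi>" and lam: "0 \<le> lam"
    and B: "\<And>i. i < n \<Longrightarrow> B i \<in> sets borel" "\<And>i. i < n \<Longrightarrow> bounded (B i)" "disjoint_family_on B {..<n}"
    and c: "\<And>i. i < n \<Longrightarrow> 0 \<le> c i"
  shows "(\<integral>\<^sup>+w. ennreal (expneg (\<Sum>k. \<Sum>i<n. ennreal (c i) * indicator (B i) (X k w))) \<partial>M)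
    = ennreal (exp (- (lam * (\<Sum>i<n. measure lborel (B i) * (1 - exp (- c i))))))"
proof -
  have N [measurable]: "(\<lambda>w. card (\<Phi> w \<inter> B i)) \<in> measurable M (count_space UNIV)" if "i < n" for i
    using PPP B that by (auto simp: homogeneous_PPP_def)
  have pois: "measure M {w \<in> space M. card (\<Phi> w \<inter> B i) = k}
      = (lam * measure lborel (B i)) ^ k / fact k * exp (- (lam * measure lborel (B i)))" if "i < n"
          for i k
    using PPP B that by (auto simp: homogeneous_PPP_def)
  have indep: "indep_vars (\<lambda>_. count_space UNIV) (\<lambda>i w. card (\<Phi> w \<inter> B i)) {..<n}"
    using PPP B by (auto simp: homogeneous_PPP_def)
  have inj: "AE w in M. inj (\<lambda>i. X i w)" and \<Phi>: "\<And>w. w \<in> space M \<Longrightarrow> \<Phi> w = range (\<lambda>i. X i w)"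
    using enum by (auto simp: enumerates_def)
  have fin: "AE w in M. \<forall>B. bounded B \<longrightarrow> finite (\<Phi> w \<inter> B)"
    using PPP by (auto simp: homogeneous_PPP_def)
  have "(\<integral>\<^sup>+w. ennreal (expneg (\<Sum>k. \<Sum>i<n. ennreal (c i) * indicator (B i) (X k w))) \<partial>M)
      = (\<integral>\<^sup>+w. (\<Prod>i<n. ennreal (exp (- (c i * real (card (\<Phi> w \<inter> B i)))))) \<partial>M)"
  proof (rule nn_integral_cong_AE)
    show "AE w in M. ennreal (expneg (\<Sum>k. \<Sum>i<n. ennreal (c i) * indicator (B i) (X k w)))
        = (\<Prod>i<n. ennreal (exp (- (c i * real (card (\<Phi> w \<inter> B i))))))"
      using inj fin AE_space
    proof eventually_elim
      case (elim w)
      have "(\<Sum>k. \<Sum>i<n. ennreal (c i) * indicator (B i) (X k w))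
          = (\<Sum>i<n. \<Sum>k. ennreal (c i) * indicator (B i) (X k w))"
        by (rule suminf_sum) simp
      also have "\<dots> = (\<Sum>i<n. ennreal (c i) * (\<Sum>k. indicator (B i) (X k w)))"
        by simp
      also have "\<dots> = (\<Sum>i<n. ennreal (c i * real (card (\<Phi> w \<inter> B i))))"
      proof (rule sum.cong[OF refl])
        fix i
        assume "i \<in> {..<n}"
        then have i: "i < n"
          by simp
        have "(\<Sum>k. indicator (B i) (X k w) :: ennreal) = of_nat (card (\<Phi> w \<inter> B i))"
          using elim B(2)[OF i] by (simp add: \<Phi> suminf_indicator_enumeration)
        then show "ennreal (c i) * (\<Sum>k. indicator (B i) (X k w))
            = ennreal (c i * real (card (\<Phi> w \<inter> B i)))"
          using c[OF i] by (simp add: ennreal_mult ennreal_of_nat_eq_real_of_nat)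
      qed
      finally have "expneg (\<Sum>k. \<Sum>i<n. ennreal (c i) * indicator (B i) (X k w))
          = (\<Prod>i<n. exp (- (c i * real (card (\<Phi> w \<inter> B i)))))"
        using c by (simp add: expneg_sum)
      then show ?case
        by (simp add: prod_ennreal)
    qed
  qed
  also have "\<dots> = (\<Prod>i<n. \<integral>\<^sup>+w. ennreal (exp (- (c i * real (card (\<Phi> w \<inter> B i))))) \<partial>M)"
  proof (rule indep_vars_nn_integral)
    have "indep_vars (\<lambda>_. borel)
        (\<lambda>i. (\<lambda>k. ennreal (exp (- (c i * real k)))) \<circ> (\<lambda>w. card (\<Phi> w \<inter> B i))) {..<n}"
      by (rule indep_vars_compose[OF indep]) simp
    then show "indep_vars (\<lambda>_. borel) (\<lambda>i w. ennreal (exp (- (c i * real (card (\<Phi> w \<inter> B i)))))) {..<n}"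
      by (simp add: comp_def)
  qed simp_all
  also have "\<dots> = (\<Prod>i<n. ennreal (exp (- (lam * measure lborel (B i) * (1 - exp (- c i))))))"
    using lam by (intro prod.cong refl poisson_laplace N pois) auto
  also have "\<dots> = ennreal (exp (- (lam * (\<Sum>i<n. measure lborel (B i) * (1 - exp (- c i))))))"
    by (simp add: prod_ennreal exp_sum[symmetric] sum_negf sum_distrib_left mult.assoc)
  finally show ?thesis .
qed

text \<open>The pieces are the level sets of the nonzero values: leaving out the value 0 keeps them
  bounded and changes neither side.\<close>

lemma (in prob_space) PPP_laplace_simple:
  fixes h :: "plane \<Rightarrow> ennreal"
  assumes PPP: "homogeneous_PPP M lam \<Phi>" and enum: "enumerates M X \<Phi>" and lam: "0 \<le> lam"
    and h: "h \<in> borel_measurable borel" "finite (range h)" "\<And>z. h z < \<infinity>" "bounded {z. h z \<noteq> 0}"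
  shows "(\<integral>\<^sup>+w. ennreal (expneg (\<Sum>k. h (X k w))) \<partial>M)
    = ennreal (expneg (ennreal lam * (\<integral>\<^sup>+z. ennreal (1 - expneg (h z)) \<partial>lborel)))"
proof -
  let ?S = "range h - {0}"
  obtain e where e: "bij_betw e {..<card ?S} ?S"
    using ex_bij_betw_nat_finite[of ?S] h(2) by (auto simp: atLeast0LessThan)
  define n where "n = card ?S"
  define B where "B i = h -` {e i}" for i
  define c where "c i = enn2real (e i)" for i
  have eS: "e i \<in> ?S" if "i < n" for i
    using bij_betw_apply[OF e, of i] that unfolding n_def by simp
  have ce: "ennreal (c i) = e i" if "i < n" for i
  proof -
    have "\<exists>z. e i = h z"
      using eS[OF that] by auto
    then have "e i < \<infinity>"
      using h(3) by auto
    then show ?thesis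
      by (simp add: c_def)
  qed
  have B: "B i \<in> sets borel" "bounded (B i)" if "i < n" for i
  proof -
    show "B i \<in> sets borel"
      using measurable_sets[OF h(1), of "{e i}"] by (simp add: B_def)
    have "B i \<subseteq> {z. h z \<noteq> 0}"
      using eS[OF that] by (auto simp: B_def)
    then show "bounded (B i)"
      using h(4) bounded_subset by blast
  qed
  have inj: "i = j" if "e i = e j" "i < n" "j < n" for i j
    using bij_betw_imp_inj_on[OF e] that unfolding n_def[symmetric] by (auto dest: inj_onD)
  have disj: "disjoint_family_on B {..<n}"
    unfolding disjoint_family_on_def
  proof (intro ballI impI)
    fix i j
    assume "i \<in> {..<n}" "j \<in> {..<n}" "i \<noteq> j"
    then have "e i \<noteq> e j"
      using inj by blast
    then show "B i \<inter> B j = {}"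
      by (auto simp: B_def)
  qed
  \<comment> \<open>Stated for a general \<open>g\<close> with \<open>g 0 = 0\<close>: the identity
    yields the sum over the points, and \<open>1 - expneg x\<close> the intensity integral.\<close>
  have split: "(\<Sum>i<n. g (e i) * indicator (B i) z) = g (h z)" if "g 0 = 0"
      for g :: "ennreal \<Rightarrow> ennreal" and z
  proof (cases "h z = 0")
    case True
    then have "indicator (B i) z = (0::ennreal)" if "i < n" for i
      using eS[OF that] by (auto simp: B_def)
    then show ?thesis
      using True \<open>g 0 = 0\<close> by simp
  next
    case False
    then have "h z \<in> e ` {..<n}"
      using bij_betw_imp_surj_on[OF e] unfolding n_def by blast
    then obtain j where j: "j < n" "h z = e j"
      by auto
    have "(\<Sum>i<n. g (e i) * indicator (B i) z) = (\<Sum>i<n. if i = j then g (e i) else 0)"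
      using j inj by (intro sum.cong refl) (auto simp: B_def split: split_indicator)
    then show ?thesis
      using j by simp
  qed
  have c: "0 \<le> c i" for i
    by (simp add: c_def)
  have "(\<Sum>k. h (X k w)) = (\<Sum>k. \<Sum>i<n. ennreal (c i) * indicator (B i) (X k w))" for w
  proof (rule suminf_cong)
    fix k
    have "h (X k w) = (\<Sum>i<n. e i * indicator (B i) (X k w))"
      by (rule split[of "\<lambda>x. x", symmetric]) simp
    also have "\<dots> = (\<Sum>i<n. ennreal (c i) * indicator (B i) (X k w))"
      by (intro sum.cong refl) (simp add: ce)
    finally show "h (X k w) = (\<Sum>i<n. ennreal (c i) * indicator (B i) (X k w))" .
  qed
  then have "(\<integral>\<^sup>+w. ennreal (expneg (\<Sum>k. h (X k w))) \<partial>M)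
      = ennreal (exp (- (lam * (\<Sum>i<n. measure lborel (B i) * (1 - exp (- c i))))))"
    using PPP_laplace_finite[OF PPP enum lam B disj c] by simp
  moreover have "(\<integral>\<^sup>+z. ennreal (1 - expneg (h z)) \<partial>lborel)
      = ennreal (\<Sum>i<n. measure lborel (B i) * (1 - exp (- c i)))"
  proof -
    have fin: "emeasure lborel (B i) = ennreal (measure lborel (B i))" if "i < n" for i
      using emeasure_bounded_finite[OF B(2)[OF that]] by (intro emeasure_eq_ennreal_measure) simp
    have "(\<integral>\<^sup>+z. ennreal (1 - expneg (h z)) \<partial>lborel)
        = (\<integral>\<^sup>+z. (\<Sum>i<n. ennreal (1 - expneg (e i)) * indicator (B i) z) \<partial>lborel)"
      by (simp only: split[of "\<lambda>x. ennreal (1 - expneg x)"] expneg_simps diff_self ennreal_0)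
    also have "\<dots> = (\<Sum>i<n. ennreal (1 - expneg (e i)) * emeasure lborel (B i))"
      using B by (subst nn_integral_sum) (auto intro!: sum.cong nn_integral_cmult_indicator)
    also have "\<dots> = (\<Sum>i<n. ennreal (measure lborel (B i) * (1 - exp (- c i))))"
    proof (intro sum.cong refl)
      fix i
      assume "i \<in> {..<n}"
      then have i: "i < n"
        by simp
      have "expneg (e i) = exp (- c i)"
        using c by (simp add: ce[OF i, symmetric])
      then show "ennreal (1 - expneg (e i)) * emeasure lborel (B i)
          = ennreal (measure lborel (B i) * (1 - exp (- c i)))"
        using c by (simp add: fin[OF i] ennreal_mult mult.commute)
    qed
    also have "\<dots> = ennreal (\<Sum>i<n. measure lborel (B i) * (1 - exp (- c i)))"
      using c by (intro sum_ennreal) simp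
    finally show ?thesis .
  qed
  moreover have "0 \<le> (\<Sum>i<n. measure lborel (B i) * (1 - exp (- c i)))"
    using c by (intro sum_nonneg) simp
  ultimately show ?thesis
    using lam by (simp add: ennreal_mult[symmetric])
qed

text \<open>Simple functions cut off at balls increase to \<open>f\<close>; the balls supply the
  bounded support on which counts are described. The expectation converges by domination, the
  intensity integral by monotonicity, and continuity of \<open>expneg\<close> at infinity covers an
  infinite exponent.\<close>

lemma (in prob_space) PPP_laplace_functional:
  fixes f :: "plane \<Rightarrow> ennreal"
  assumes PPP: "homogeneous_PPP M lam \<Phi>" and enum: "enumerates M X \<Phi>" and lam: "0 \<le> lam"
    and f [measurable]: "f \<in> borel_measurable borel"
  shows "(\<integral>\<^sup>+w. ennreal (expneg (\<Sum>k. f (X k w))) \<partial>M)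
    = ennreal (expneg (ennreal lam * (\<integral>\<^sup>+z. ennreal (1 - expneg (f z)) \<partial>lborel)))"
proof -
  have X [measurable]: "X k \<in> borel_measurable M" for k
    using enum by (simp add: enumerates_def)
  obtain g where g: "\<And>i. simple_function borel (g i)" "incseq g" "\<And>i z. g i z
      < \<top>" "\<And>z. (SUP i. g i z) = f z"
    using borel_measurable_implies_simple_function_sequence'[OF f] by blast
  define h where "h i z = g i z * indicator (ball 0 (real i)) z" for i z
  have gm [measurable]: "g i \<in> borel_measurable borel" for i
    using g(1) by (rule borel_measurable_simple_function)
  have hm [measurable]: "h i \<in> borel_measurable borel" for i
  proof -
    have [measurable]: "ball (0::plane) (real i) \<in> sets borel"
      by simp
    show ?thesis
      unfolding h_def[abs_def] by measurable
  qed
  have h_inc: "h i z \<le> h j z" if "i \<le> j" for i j z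
    using that incseqD[OF g(2) that] by (auto simp: h_def le_fun_def split: split_indicator)
  have h_lim: "(\<lambda>i. h i z) \<longlonglongrightarrow> f z" for z
  proof -
    have "(\<lambda>i. g i z) \<longlonglongrightarrow> f z"
      using LIMSEQ_SUP[of "\<lambda>i. g i z"] g(2,4) by (simp add: incseq_def le_fun_def)
    moreover have "eventually (\<lambda>i. norm z < real i) sequentially"
      by real_asymp
    then have "eventually (\<lambda>i. g i z = h i z) sequentially"
      by eventually_elim (simp add: h_def)
    ultimately show ?thesis
      by (rule Lim_transform_eventually)
  qed
  \<comment> \<open>The series is an integral over the counting measure, so monotone convergence
    applies to it.\<close>
  have sum_lim: "(\<lambda>i. \<Sum>k. h i (x k)) \<longlonglongrightarrow> (\<Sum>k. f (x k))" for x :: "nat \<Rightarrow> plane"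
    unfolding nn_integral_count_space_nat[symmetric]
    by (rule nn_integral_LIMSEQ) (auto simp: incseq_def le_fun_def h_inc h_lim)
  have "(\<lambda>i. \<integral>\<^sup>+w. ennreal (expneg (\<Sum>k. h i (X k w))) \<partial>M) \<longlonglongrightarrow> (\<integral>\<^sup>+w. ennreal (expneg (\<Sum>k. f (X k w))) \<partial>M)"
  proof (rule nn_integral_dominated_convergence[where w = "\<lambda>_. 1"])
    show "AE w in M. (\<lambda>i. ennreal (expneg (\<Sum>k. h i (X k w)))) \<longlonglongrightarrow> ennreal (expneg (\<Sum>k. f (X k w)))"
      by (intro AE_I2 tendsto_ennrealI tendsto_expneg sum_lim)
  qed (auto simp: less_top[symmetric])
  moreover have "(\<lambda>i. \<integral>\<^sup>+z. ennreal (1 - expneg (h i z)) \<partial>lborel) \<longlonglongrightarrow>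
      (\<integral>\<^sup>+z. ennreal (1 - expneg (f z)) \<partial>lborel)"
  proof (rule nn_integral_LIMSEQ)
    show "incseq (\<lambda>i z. ennreal (1 - expneg (h i z)))"
      by (simp add: incseq_def le_fun_def ennreal_leI expneg_antimono h_inc)
    show "(\<lambda>i. ennreal (1 - expneg (h i z))) \<longlonglongrightarrow> ennreal (1 - expneg (f z))" for z
      by (intro tendsto_ennrealI tendsto_diff tendsto_const tendsto_expneg h_lim)
  qed simp
  then have "(\<lambda>i. ennreal (expneg (ennreal lam * (\<integral>\<^sup>+z. ennreal (1 - expneg (h i z)) \<partial>lborel))))
      \<longlonglongrightarrow> ennreal (expneg (ennreal lam * (\<integral>\<^sup>+z. ennreal (1 - expneg (f z)) \<partial>lborel)))"
    by (intro tendsto_ennrealI tendsto_expneg ennreal_tendsto_cmult) simp_all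
  moreover have "(\<integral>\<^sup>+w. ennreal (expneg (\<Sum>k. h i (X k w))) \<partial>M)
      = ennreal (expneg (ennreal lam * (\<integral>\<^sup>+z. ennreal (1 - expneg (h i z)) \<partial>lborel)))" for i
  proof (rule PPP_laplace_simple[OF PPP enum lam hm])
    have "range (h i) \<subseteq> insert 0 (range (g i))"
      by (auto simp: h_def split: split_indicator)
    moreover have "finite (range (g i))"
      using simple_functionD(1)[OF g(1)[of i]] by simp
    ultimately show "finite (range (h i))"
      by (meson finite_insert finite_subset)
    show "h i z < \<infinity>" for z
      using g(3)[of i z] by (auto simp: h_def split: split_indicator)
    have "{z. h i z \<noteq> 0} \<subseteq> ball 0 (real i)"
      by (auto simp: h_def split: split_indicator_asm)
    then show "bounded {z. h i z \<noteq> 0}"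
      using bounded_ball bounded_subset by blast
  qed
  ultimately show ?thesis
    by (simp add: LIMSEQ_unique)
qed

section \<open>Gamma distribution and Laplace transforms\<close>

text \<open>An integer shape gives an Erlang law, whose index counts from 0: shape \<open>n\<close>
  has index \<open>n - 1\<close>.\<close>

lemma gamma_distribution_eq_erlang:
  assumes "0 < n"
  shows "gamma_distribution (real n) 1 = density lborel (\<lambda>x. ennreal (erlang_density (n - 1) 1 x))"
  unfolding gamma_distribution_def
proof (rule density_cong)
  \<comment> \<open>At 0 the Erlang density of shape one equals 1, whereas the gamma density is set
    to 0 there.\<close>
  have "AE x in lborel. x \<noteq> (0::real)"
    by (rule AE_lborel_singleton)
  then show "AE x in lborel. ennreal (if 0
      < x then x powr (real n - 1) * exp (- x / 1) / (Gamma (real n) * 1 powr real n) else 0)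
      = ennreal (erlang_density (n - 1) 1 x)"
  proof eventually_elim
    case (elim x)
    have "x powr (real n - 1) = x ^ (n - 1)" if "0 < x"
      using that assms powr_realpow[of x "n - 1"] by (simp add: of_nat_diff)
    moreover have "Gamma (real n) = fact (n - 1)"
      using Gamma_fact[of "n - 1", where ?'a = real] assms by (simp add: of_nat_diff)
    ultimately show ?case
      using elim by (auto simp: erlang_density_def)
  qed
qed simp_all

lemma prob_space_gamma: "0 < n \<Longrightarrow> prob_space (gamma_distribution (real n) 1)"
  by (simp add: gamma_distribution_eq_erlang prob_space_erlang_density)

lemma sets_gamma [simp, measurable_cong]: "sets (gamma_distribution k \<theta>) = sets borel"
  by (simp add: gamma_distribution_def)

text \<open>Exponential tilting: the density of rate 1 times \<open>exp (- c * y)\<close> is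
  \<open>1 / (1 + c) ^ n\<close> times the density of rate \<open>1 + c\<close>, which has mass
  1.\<close>

lemma gamma_laplace:
  assumes "0 < n" "0 \<le> c"
  shows "(\<integral>\<^sup>+y. ennreal (expneg (ennreal (c * y))) \<partial>gamma_distribution (real n) 1)
      = ennreal (1 / (1 + c) ^ n)"
proof -
  let ?k = "n - 1"
  have n: "Suc ?k = n"
    using assms by simp
  have "(\<integral>\<^sup>+y. ennreal (expneg (ennreal (c * y))) \<partial>gamma_distribution (real n) 1)
      = (\<integral>\<^sup>+y. ennreal (erlang_density ?k 1 y) * ennreal (expneg (ennreal (c * y))) \<partial>lborel)"
    using assms by (simp add: gamma_distribution_eq_erlang nn_integral_density)
  also have "\<dots> = (\<integral>\<^sup>+y. ennreal (1 / (1 + c) ^ n) * ennreal (erlang_density ?k (1 + c) y) \<partial>lborel)"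
  proof (rule nn_integral_cong)
    fix y
    show "ennreal (erlang_density ?k 1 y) * ennreal (expneg (ennreal (c * y)))
        = ennreal (1 / (1 + c) ^ n) * ennreal (erlang_density ?k (1 + c) y)"
    proof (cases "y < 0")
      case False
      then have "erlang_density ?k 1 y * expneg (ennreal (c * y))
          = 1 / (1 + c) ^ n * erlang_density ?k (1 + c) y"
        using assms by (simp add: erlang_density_def n exp_add[symmetric] algebra_simps)
      then show ?thesis
        using assms by (simp add: ennreal_mult[symmetric])
    qed (simp add: erlang_density_def)
  qed
  also have "\<dots> = ennreal (1 / (1 + c) ^ n) * (\<integral>\<^sup>+y. ennreal (erlang_density ?k (1 + c) y) \<partial>lborel)"
    by (intro nn_integral_cmult) simp
  also have "(\<integral>\<^sup>+y. ennreal (erlang_density ?k (1 + c) y) \<partial>lborel) = 1"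
    using prob_space.emeasure_space_1[OF prob_space_erlang_density[of "1 + c" ?k]] assms
    by (simp add: emeasure_density)
  finally show ?thesis
    by simp
qed

text \<open>For nonnegative \<open>x\<close>, the probability that a Poisson variable of mean
  \<open>x\<close> stays below \<open>n\<close>; for positive \<open>n\<close> it is also the tail
  at \<open>x\<close> of the gamma distribution with shape \<open>n\<close>.\<close>

definition gamma_tail :: "nat \<Rightarrow> real \<Rightarrow> real" where
  "gamma_tail n x = (\<Sum>m<n. x ^ m / fact m * exp (- x))"

lemma emeasure_gamma_atLeast:
  assumes n: "0 < n" and x: "0 \<le> x"
  shows "emeasure (gamma_distribution (real n) 1) {x..} = ennreal (gamma_tail n x)"
proof -
  interpret prob_space "gamma_distribution (real n) 1"
    using n by (rule prob_space_gamma)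
  have sp: "space (gamma_distribution (real n) 1) = UNIV"
    by (simp add: gamma_distribution_def)
  have cdf: "erlang_CDF (n - 1) 1 x = 1 - gamma_tail n x"
  proof -
    have "{..n - 1} = {..<n}"
      using n by auto
    then show ?thesis
      using x by (simp add: erlang_CDF_def gamma_tail_def)
  qed
  have "emeasure (gamma_distribution (real n) 1) {x..}
      = emeasure (gamma_distribution (real n) 1) {x<..}"
  proof (rule emeasure_eq_AE)
    have "AE y in lborel. y \<noteq> x"
      by (rule AE_lborel_singleton)
    then have "AE y in gamma_distribution (real n) 1. y \<noteq> x"
      unfolding gamma_distribution_eq_erlang[OF n] by (subst AE_density) (auto elim: eventually_mono)
    then show "AE y in gamma_distribution (real n) 1. y \<in> {x..} \<longleftrightarrow> y \<in> {x<..}"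
      by eventually_elim auto
  qed simp_all
  also have "\<dots> = ennreal (prob (space (gamma_distribution (real n) 1) - {..x}))"
    by (simp add: sp emeasure_eq_measure Compl_eq_Diff_UNIV[symmetric] flip: Compl_atMost)
  also have "prob (space (gamma_distribution (real n) 1) - {..x}) = 1 - prob {..x}"
    by (intro prob_compl) simp
  also have "prob {..x} = 1 - gamma_tail n x"
  proof -
    have "emeasure (gamma_distribution (real n) 1) {..x} = ennreal (erlang_CDF (n - 1) 1 x)"
      using n by (simp add: gamma_distribution_eq_erlang emeasure_erlang_density)
    then have "prob {..x} = erlang_CDF (n - 1) 1 x"
      by (simp add: measure_def)
    then show ?thesis
      unfolding cdf .
  qed
  finally show ?thesis
    by simp
qed

section \<open>Moments and uniqueness of Laplace transforms\<close>

text \<open>Integrals of Bernstein polynomials thereby become linear combinations of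
  moments.\<close>

lemma Bernstein_eq_sum_power:
  "Bernstein n k y = (\<Sum>j\<le>n - k. real (n choose k) * real ((n - k) choose j) * (-1) ^ j * y ^ (k + j))"
proof -
  have "(1 - y) ^ (n - k) = (\<Sum>j\<le>n - k. of_nat ((n - k) choose j) * (- y) ^ j * 1 ^ (n - k - j))"
    using binomial_ring[of "- y" 1 "n - k"] by simp
  then show ?thesis
    unfolding Bernstein_def
    by (simp add: sum_distrib_left power_add power_minus[of y] mult.assoc mult.left_commute)
qed

text \<open>The approximation is uniform on the unit interval, which carries the measure. Bernstein
  polynomials are nonnegative there and sum to 1, so a bound \<open>C\<close> for \<open>g\<close>
  also bounds the approximants.\<close>

lemma tendsto_integral_Bernstein:
  fixes m :: "real measure" and g :: "real \<Rightarrow> real"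
  assumes fin: "finite_measure m" and sets [measurable_cong]: "sets m = sets borel"
    and supp: "AE y in m. y \<in> {0..1}" and g: "continuous_on UNIV g"
  shows "(\<lambda>n. \<integral>y. (\<Sum>k\<le>n. g (k / n) * Bernstein n k y) \<partial>m) \<longlonglongrightarrow> (\<integral>y. g y \<partial>m)"
proof -
  interpret finite_measure m by fact
  have gc: "continuous_on {0..1} g"
    using g continuous_on_subset by blast
  have [measurable]: "g \<in> borel_measurable borel"
    using g by (rule borel_measurable_continuous_onI)
  have "bounded (g ` {0..1})"
    using gc by (intro compact_imp_bounded compact_continuous_image) auto
  then have "\<exists>C. \<forall>y\<in>{0..1}. \<bar>g y\<bar> \<le> C"
    by (auto simp: bounded_iff)
  then obtain C where C: "\<And>y. y \<in> {0..1} \<Longrightarrow> \<bar>g y\<bar> \<le> C"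
    by blast
  let ?p = "\<lambda>n y. \<Sum>k\<le>n. g (k / n) * Bernstein n k y"
  show ?thesis
  proof (rule integral_dominated_convergence[where w = "\<lambda>_. C"])
    show "AE y in m. (\<lambda>n. ?p n y) \<longlonglongrightarrow> g y"
      using supp
    proof eventually_elim
      case (elim y)
      show ?case
      proof (rule LIMSEQ_I)
        fix e :: real
        assume "0 < e"
        from Bernstein_Weierstrass[OF gc this] obtain N where
          "\<forall>n x. N \<le> n \<and> x \<in> {0..1} \<longrightarrow> \<bar>g x - ?p n x\<bar> < e" ..
        then show "\<exists>N. \<forall>n\<ge>N. norm (?p n y - g y) < e"
          using elim by (auto simp: abs_minus_commute)
      qed
    qed
    show "AE y in m. norm (?p n y) \<le> C" for n
      using supp
    proof eventually_elim
      case (elim y)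
      have "\<bar>?p n y\<bar> \<le> (\<Sum>k\<le>n. \<bar>g (k / n) * Bernstein n k y\<bar>)"
        by (rule sum_abs)
      also have "\<dots> \<le> (\<Sum>k\<le>n. C * Bernstein n k y)"
        using elim by (intro sum_mono)
            (auto simp: abs_mult Bernstein_nonneg divide_le_eq_1 intro!: mult_right_mono C)
      also have "\<dots> = C"
        by (simp add: sum_distrib_left[symmetric])
      finally show ?case
        by simp
    qed
    show "?p n \<in> borel_measurable m" for n
      unfolding Bernstein_def by measurable
  qed simp_all
qed

text \<open>Uniqueness in the Hausdorff moment problem: moments determine the integrals of Bernstein
  polynomials, hence those of continuous functions, hence the measures of half-lines.\<close>

lemma finite_measure_moments_unique:
  fixes \<mu> \<nu> :: "real measure"
  assumes fin: "finite_measure \<mu>" "finite_measure \<nu>"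
    and sets [measurable_cong]: "sets \<mu> = sets borel" "sets \<nu> = sets borel"
    and supp: "AE y in \<mu>. y \<in> {0..1}" "AE y in \<nu>. y \<in> {0..1}"
    and mom: "\<And>n. (\<integral>y. y ^ n \<partial>\<mu>) = (\<integral>y. y ^ n \<partial>\<nu>)"
  shows "\<mu> = \<nu>"
proof -
  interpret \<mu>: finite_measure \<mu> by fact
  interpret \<nu>: finite_measure \<nu> by fact
  have pow: "integrable m (\<lambda>y. y ^ n)"
    if "finite_measure m" and [measurable_cong]: "sets m = sets borel" and "AE y in m. y \<in> {0..1}"
    for m :: "real measure" and n
  proof (rule finite_measure.integrable_const_bound[OF that(1), where B = 1])
    show "AE y in m. norm (y ^ n) \<le> 1"
      using that(3) by eventually_elim (simp add: power_abs power_le_one)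
  qed simp
  note int = pow[OF fin(1) sets(1) supp(1)] pow[OF fin(2) sets(2) supp(2)]
  have "(\<integral>y. (\<Sum>k\<le>n. g (k / n) * Bernstein n k y) \<partial>\<mu>) = (\<integral>y. (\<Sum>k\<le>n. g (k / n) * Bernstein n k y) \<partial>\<nu>)"
    for g :: "real \<Rightarrow> real" and n
    unfolding Bernstein_eq_sum_power by (simp add: int mom)
  then have cont: "(\<integral>y. g y \<partial>\<mu>) = (\<integral>y. g y \<partial>\<nu>)" if "continuous_on UNIV g" for g :: "real \<Rightarrow> real"
    using tendsto_integral_Bernstein[OF fin(1) sets(1) supp(1) that]
      tendsto_integral_Bernstein[OF fin(2) sets(2) supp(2) that] by (simp add: LIMSEQ_unique)
  have atMost: "measure \<mu> {..a} = measure \<nu> {..a}" for a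
  proof -
    \<comment> \<open>For positive \<open>n\<close> a continuous ramp from 1 at \<open>a\<close>
      down to 0 at \<open>a + 1 / n\<close>; it tends pointwise to the indicator of the closed
      half-line.\<close>
    define g where "g n y = max 0 (min 1 (1 - real n * (y - a)))" for n y
    have gc: "continuous_on UNIV (g n)" for n
      unfolding g_def by (intro continuous_intros)
    have lim: "(\<lambda>n. g n y) \<longlonglongrightarrow> indicator {..a} y" for y
    proof (cases "y \<le> a")
      case True
      then have "g n y = 1" for n
        by (simp add: g_def mult_nonneg_nonpos)
      then show ?thesis
        using True by simp
    next
      case False
      then have "eventually (\<lambda>n. 1 - real n * (y - a) \<le> 0) sequentially"
        by real_asymp
      then have "eventually (\<lambda>n. 0 = g n y) sequentially"
        by eventually_elim (simp add: g_def)
      then have "(\<lambda>n. g n y) \<longlonglongrightarrow> 0"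
        by (rule Lim_transform_eventually[OF tendsto_const])
      then show ?thesis
        using False by simp
    qed
    have [measurable]: "g n \<in> borel_measurable borel" for n
      using gc by (rule borel_measurable_continuous_onI)
    have bd: "norm (g n y) \<le> 1" for n y
      by (simp add: g_def)
    have "(\<lambda>n. \<integral>y. g n y \<partial>\<mu>) \<longlonglongrightarrow> (\<integral>y. (indicator {..a} y :: real) \<partial>\<mu>)"
      by (rule integral_dominated_convergence[where w = "\<lambda>_. 1"]) (use bd in \<open>auto intro: lim\<close>)
    moreover have "(\<lambda>n. \<integral>y. g n y \<partial>\<nu>) \<longlonglongrightarrow> (\<integral>y. (indicator {..a} y :: real) \<partial>\<nu>)"
      by (rule integral_dominated_convergence[where w = "\<lambda>_. 1"]) (use bd in \<open>auto intro: lim\<close>)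
    ultimately have "(\<integral>y. (indicator {..a} y :: real) \<partial>\<mu>) = (\<integral>y. (indicator {..a} y :: real) \<partial>\<nu>)"
      unfolding cont[OF gc] by (rule LIMSEQ_unique)
    then show ?thesis
      using sets sets_eq_imp_space_eq[OF sets(1)] sets_eq_imp_space_eq[OF sets(2)] by simp
  qed
  show ?thesis
  proof (rule measure_eqI_generator_eq[where E = "range atMost" and \<Omega> = UNIV and A = "\<lambda>i. {.. real i}"])
    show "Int_stable (range (atMost :: real \<Rightarrow> real set))"
      by (auto simp: Int_stable_def)
    show "sets \<mu> = sigma_sets UNIV (range atMost)" "sets \<nu> = sigma_sets UNIV (range atMost)"
      by (simp_all add: sets borel_eq_atMost)
    show "(\<Union>i. {..real i}) = UNIV"
      using real_arch_simple by auto
    show "emeasure \<mu> X = emeasure \<nu> X" if "X \<in> range atMost" for X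
      using that atMost by (auto simp: \<mu>.emeasure_eq_measure \<nu>.emeasure_eq_measure)
  qed auto
qed

text \<open>The image under \<open>expneg\<close> lives on the unit interval and its
  \<open>n\<close>-th moment is the transform at \<open>n\<close>; as \<open>expneg\<close> is
  injective, the image determines the measure. The moment of order 0 is the total mass, which the
  values at positive \<open>s\<close> do not list, hence its own hypothesis.\<close>

lemma laplace_unique:
  fixes \<mu> \<nu> :: "ennreal measure"
  assumes fin: "finite_measure \<mu>" "finite_measure \<nu>"
    and sets [measurable_cong]: "sets \<mu> = sets borel" "sets \<nu> = sets borel"
    and total: "emeasure \<mu> UNIV = emeasure \<nu> UNIV"
    and lap: "\<And>s. 0 < s \<Longrightarrow> (\<integral>\<^sup>+x. ennreal (expneg (ennreal s * x)) \<partial>\<mu>)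
        = (\<integral>\<^sup>+x. ennreal (expneg (ennreal s * x)) \<partial>\<nu>)"
  shows "\<mu> = \<nu>"
proof -
  have sp: "space \<mu> = UNIV" "space \<nu> = UNIV"
    using sets_eq_imp_space_eq[OF sets(1)] sets_eq_imp_space_eq[OF sets(2)] by simp_all
  have "distr \<mu> borel expneg = distr \<nu> borel expneg"
  proof (rule finite_measure_moments_unique)
    show "finite_measure (distr \<mu> borel expneg)" "finite_measure (distr \<nu> borel expneg)"
      using fin by (auto intro: finite_measure.finite_measure_distr)
    show "AE y in distr \<mu> borel expneg. y \<in> {0..1}" "AE y in distr \<nu> borel expneg. y \<in> {0..1}"
      by (simp_all add: AE_distr_iff)
    fix n :: nat
    have nn: "(\<integral>\<^sup>+x. ennreal (expneg x ^ n) \<partial>\<mu>) = (\<integral>\<^sup>+x. ennreal (expneg x ^ n) \<partial>\<nu>)"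
    proof (cases "n = 0")
      case True
      then show ?thesis
        using total by (simp add: sp)
    next
      case False
      then show ?thesis
        using lap[of "real n"] by (simp add: expneg_of_nat_mult flip: ennreal_of_nat_eq_real_of_nat)
    qed
    have "(\<integral>y. y ^ n \<partial>distr m borel expneg) = enn2real (\<integral>\<^sup>+x. ennreal (expneg x ^ n) \<partial>m)"
      if [measurable_cong]: "sets m = sets borel" for m
      by (subst integral_distr) (simp_all add: integral_eq_nn_integral)
    then show "(\<integral>y. y ^ n \<partial>distr \<mu> borel expneg) = (\<integral>y. y ^ n \<partial>distr \<nu> borel expneg)"
      using nn sets by simp
  qed simp_all
  \<comment> \<open>A measurable left inverse of \<open>expneg\<close>; it returns infinity at 0,
    the image of infinity.\<close>
  moreover define inv where "inv y = (if y \<le> 0 then \<top> else ennreal (- ln y))" for y :: real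
  have [measurable]: "inv \<in> borel_measurable borel"
    unfolding inv_def[abs_def] by measurable
  have inv: "inv (expneg x) = x" for x
    by (cases x) (simp_all add: inv_def)
  have "distr (distr m borel expneg) borel inv = m" if [measurable_cong]: "sets m = sets borel" for m
    using that by (simp add: distr_distr comp_def inv distr_id2)
  ultimately show ?thesis
    using sets by metis
qed

section \<open>Differentiation of Laplace transforms\<close>

text \<open>The \<open>m\<close>-th derivative in \<open>s\<close> of \<open>exp (- s * x)\<close>,
  continued by 0 at infinite \<open>x\<close>.\<close>

definition laplace_kernel :: "nat \<Rightarrow> real \<Rightarrow> ennreal \<Rightarrow> real" where
  "laplace_kernel m s x = (if x = \<infinity> then 0 else (- enn2real x) ^ m * exp (- s * enn2real x))"

lemma borel_measurable_laplace_kernel [measurable]: "laplace_kernel m s \<in> borel_measurable borel"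
  unfolding laplace_kernel_def[abs_def] by measurable

lemma power_le_fact_mult_exp:
  fixes y :: real
  assumes "0 \<le> y"
  shows "y ^ k \<le> fact k * exp y"
proof -
  have "(\<Sum>n\<in>{k}. y ^ n /\<^sub>R fact n) \<le> (\<Sum>n. y ^ n /\<^sub>R fact n)"
    using assms by (intro sum_le_suminf summable_exp_generic) auto
  then show ?thesis
    by (simp add: exp_def field_simps)
qed

text \<open>The power is compared with a single term of the exponential series of
  \<open>s * y\<close>; the resulting bound is free of \<open>y\<close>.\<close>

lemma power_mult_exp_bound:
  fixes s y :: real
  assumes "0 < s" "0 \<le> y"
  shows "y ^ k * exp (- s * y) \<le> fact k / s ^ k"
proof -
  have "(s * y) ^ k \<le> fact k * exp (s * y)"
    using assms by (intro power_le_fact_mult_exp) simp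
  then have "(s * y) ^ k * exp (- (s * y)) \<le> fact k * exp (s * y) * exp (- (s * y))"
    by (intro mult_right_mono) auto
  then have "(s * y) ^ k * exp (- (s * y)) \<le> fact k"
    by (simp add: mult.assoc exp_minus_inverse)
  then show ?thesis
    using assms by (simp add: power_mult_distrib field_simps)
qed

lemma abs_laplace_kernel_le:
  assumes "0 < s"
  shows "\<bar>laplace_kernel m s x\<bar> \<le> fact m / s ^ m"
  using assms power_mult_exp_bound[of s "enn2real x" m]
  by (auto simp: laplace_kernel_def abs_mult power_abs)

text \<open>With \<open>u = - h * y\<close>, the inequality \<open>\<bar>exp u - 1\<bar> \<le>
  \<bar>u\<bar> * exp \<bar>u\<bar>\<close> costs a factor \<open>exp (\<bar>h\<bar> * y)\<close>,
  for which half of the decay rate \<open>s\<close> is given up.\<close>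

lemma abs_exp_diff_le:
  fixes s h y :: real
  assumes "0 < s" "\<bar>h\<bar> \<le> s / 2" "0 \<le> y"
  shows "\<bar>exp (- (s + h) * y) - exp (- s * y)\<bar> \<le> \<bar>h\<bar> * (y * exp (- (s / 2) * y))"
proof -
  have *: "\<bar>exp u - 1\<bar> \<le> \<bar>u\<bar> * exp \<bar>u\<bar>" for u :: real
  proof (cases "0 \<le> u")
    case True
    have "1 - u \<le> exp (- u)"
      using exp_ge_add_one_self[of "- u"] by simp
    then have "(1 - u) * exp u \<le> exp (- u) * exp u"
      by (intro mult_right_mono) auto
    then show ?thesis
      using True by (simp add: exp_minus_inverse mult.commute algebra_simps)
  next
    case False
    then have "1 - exp u \<le> - u"
      using exp_ge_add_one_self[of u] by linarith
    also have "\<dots> \<le> - u * exp (- u)"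
      using False mult_left_mono[of 1 "exp (- u)" "- u"] by simp
    finally show ?thesis
      using False by simp
  qed
  have "\<bar>exp (- (s + h) * y) - exp (- s * y)\<bar> = exp (- s * y) * \<bar>exp (- h * y) - 1\<bar>"
    by (simp add: abs_mult_pos' right_diff_distrib exp_add[symmetric] algebra_simps flip: abs_mult_pos)
  also have "\<dots> \<le> exp (- s * y) * (\<bar>- h * y\<bar> * exp \<bar>- h * y\<bar>)"
    by (intro mult_left_mono *) auto
  also have "\<dots> = \<bar>h\<bar> * (y * exp (- s * y + \<bar>h\<bar> * y))"
    unfolding exp_add using assms by (simp add: abs_mult)
  also have "\<dots> \<le> \<bar>h\<bar> * (y * exp (- (s / 2) * y))"
  proof -
    have "\<bar>h\<bar> * y \<le> s / 2 * y"
      using assms by (intro mult_right_mono) auto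
    then show ?thesis
      using assms by (intro mult_left_mono) (auto simp: algebra_simps)
  qed
  finally show ?thesis .
qed

text \<open>The bound involves neither \<open>h\<close> nor \<open>x\<close>, so it can serve as a
  constant dominating function; its shape comes from the remaining decay rate
  \<open>s / 2\<close>.\<close>

lemma laplace_kernel_diff_le:
  assumes "0 < s" "\<bar>h\<bar> \<le> s / 2" "h \<noteq> 0"
  shows "\<bar>(laplace_kernel m (s + h) x - laplace_kernel m s x) / h\<bar> \<le> fact (Suc m) / (s / 2) ^ Suc m"
proof (cases "x = \<infinity>")
  case False
  define y where "y = enn2real x"
  have y: "0 \<le> y"
    by (simp add: y_def)
  have "\<bar>(laplace_kernel m (s + h) x - laplace_kernel m s x) / h\<bar>
      = y ^ m * (\<bar>exp (- (s + h) * y) - exp (- s * y)\<bar> / \<bar>h\<bar>)"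
    using False y by (simp add: laplace_kernel_def y_def[symmetric] abs_mult power_abs flip:
        right_diff_distrib)
  also have "\<dots> \<le> y ^ m * (y * exp (- (s / 2) * y))"
    using abs_exp_diff_le[OF assms(1,2) y] assms(3) y
    by (intro mult_left_mono) (simp_all add: divide_le_eq mult.commute)
  also have "\<dots> = y ^ Suc m * exp (- (s / 2) * y)"
    by simp
  also have "\<dots> \<le> fact (Suc m) / (s / 2) ^ Suc m"
    using assms y by (intro power_mult_exp_bound) auto
  finally show ?thesis .
qed (use assms in \<open>simp add: laplace_kernel_def\<close>)

lemma DERIV_laplace_kernel: "((\<lambda>s. laplace_kernel m s x) has_field_derivative laplace_kernel
    (Suc m) s x) (at s)"
  by (cases "x = \<infinity>") (auto simp: laplace_kernel_def intro!: derivative_eq_intros)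

lemma (in prob_space) DERIV_integral_laplace_kernel:
  assumes Y [measurable]: "Y \<in> borel_measurable M" and s: "0 < s"
  shows "((\<lambda>s. \<integral>w. laplace_kernel m s (Y w) \<partial>M) has_field_derivative
      (\<integral>w. laplace_kernel (Suc m) s (Y w) \<partial>M)) (at s)"
  unfolding DERIV_def tendsto_at_iff_sequentially comp_def
proof (intro allI impI)
  fix h :: "nat \<Rightarrow> real"
  assume h: "\<forall>n. h n \<in> UNIV - {0}" "h \<longlonglongrightarrow> 0"
  have int: "integrable M (\<lambda>w. laplace_kernel m t (Y w))" if "0 < t" for t
    using abs_laplace_kernel_le[OF that]
        by (intro integrable_const_bound[where B = "fact m / t ^ m"]) auto
  have "eventually (\<lambda>n. \<bar>h n\<bar> < s / 2) sequentially"
    using tendstoD[OF h(2), of "s / 2"] s by simp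
  \<comment> \<open>The dominating constant is available for increments up to \<open>s / 2\<close>;
    shifting the sequence by \<open>k\<close> reaches that range.\<close>
  then obtain k where k: "\<And>n. k \<le> n \<Longrightarrow> \<bar>h n\<bar> \<le> s / 2"
    by (auto simp: eventually_sequentially intro: less_imp_le)
  have "(\<lambda>n. \<integral>w. (laplace_kernel m (s + h (n + k)) (Y w) - laplace_kernel m s (Y w)) / h (n + k) \<partial>M)
      \<longlonglongrightarrow> (\<integral>w. laplace_kernel (Suc m) s (Y w) \<partial>M)"
  proof (rule integral_dominated_convergence[where w = "\<lambda>_. fact (Suc m) / (s / 2) ^ Suc m"])
    show "AE w in M. (\<lambda>n. (laplace_kernel m (s + h (n + k)) (Y w) - laplace_kernel m s (Y w))
        / h (n + k))
        \<longlonglongrightarrow> laplace_kernel (Suc m) s (Y w)"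
    proof (rule AE_I2)
      fix w
      have "(\<lambda>n. (laplace_kernel m (s + h n) (Y w) - laplace_kernel m s (Y w))
          / h n) \<longlonglongrightarrow> laplace_kernel (Suc m) s (Y w)"
        using DERIV_laplace_kernel[of m "Y w" s] h
        unfolding DERIV_def tendsto_at_iff_sequentially comp_def by blast
      then show "(\<lambda>n. (laplace_kernel m (s + h (n + k)) (Y w) - laplace_kernel m s (Y w)) / h (n + k))
        \<longlonglongrightarrow> laplace_kernel (Suc m) s (Y w)"
        by (rule LIMSEQ_ignore_initial_segment)
    qed
    show "AE w in M. norm ((laplace_kernel m (s + h (n + k)) (Y w) - laplace_kernel m s (Y w))
        / h (n + k))
        \<le> fact (Suc m) / (s / 2) ^ Suc m" for n
      using laplace_kernel_diff_le[OF s k[of "n + k"]] h(1)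
          by (intro AE_I2) (simp del: abs_divide power_Suc fact_Suc)
  qed simp_all
  then have "(\<lambda>n. ((\<integral>w. laplace_kernel m (s + h (n + k)) (Y w) \<partial>M)
      - (\<integral>w. laplace_kernel m s (Y w) \<partial>M)) / h (n + k))
      \<longlonglongrightarrow> (\<integral>w. laplace_kernel (Suc m) s (Y w) \<partial>M)"
  proof (rule Lim_transform_eventually, intro always_eventually allI)
    fix n
    have "0 < s + h (n + k)"
      using k[of "n + k"] s by simp
    then show "(\<integral>w. (laplace_kernel m (s + h (n + k)) (Y w) - laplace_kernel m s (Y w)) / h (n + k) \<partial>M)
        = ((\<integral>w. laplace_kernel m (s + h (n + k)) (Y w) \<partial>M) - (\<integral>w. laplace_kernel m s (Y w) \<partial>M)) / h
            (n + k)"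
      using int s by simp
  qed
  then show "(\<lambda>n. ((\<integral>w. laplace_kernel m (s + h n) (Y w) \<partial>M) - (\<integral>w. laplace_kernel m s (Y w) \<partial>M)) / h n)
      \<longlonglongrightarrow> (\<integral>w. laplace_kernel (Suc m) s (Y w) \<partial>M)"
    by (rule LIMSEQ_offset)
qed

text \<open>The formula is proved on the open half-line of positive \<open>s\<close>, so the
  induction step differentiates functions that agree in a neighbourhood of \<open>s\<close>.\<close>

lemma (in prob_space) deriv_laplace_transform:
  assumes Y: "Y \<in> borel_measurable M"
  shows "0 < s \<Longrightarrow> (deriv ^^ m) (laplace_transform M Y) s = (\<integral>w. laplace_kernel m s (Y w) \<partial>M)"
proof (induction m arbitrary: s)
  case 0
  then show ?case
    by (auto simp: laplace_transform_def laplace_kernel_def intro!: Bochner_Integration.integral_cong)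
next
  case (Suc m)
  have "eventually (\<lambda>t. t \<in> {0<..}) (nhds s)"
    using Suc.prems by (intro eventually_nhds_in_open) auto
  then have "eventually (\<lambda>t. (deriv ^^ m) (laplace_transform M Y) t
      = (\<integral>w. laplace_kernel m t (Y w) \<partial>M)) (nhds s)"
    by eventually_elim (simp add: Suc.IH)
  then have "deriv ((deriv ^^ m) (laplace_transform M Y)) s
      = deriv (\<lambda>t. \<integral>w. laplace_kernel m t (Y w) \<partial>M) s"
    by (rule deriv_cong_ev) simp
  then show ?case
    using DERIV_imp_deriv[OF DERIV_integral_laplace_kernel[OF Y Suc.prems]] by simp
qed

text \<open>The value 0 at infinity is the limit of the tail and matches the convention in
  \<open>laplace_kernel\<close>.\<close>

definition gamma_tail_ext :: "nat \<Rightarrow> ennreal \<Rightarrow> real" where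
  "gamma_tail_ext n x = (if x = \<infinity> then 0 else gamma_tail n (enn2real x))"

lemma (in prob_space) integral_gamma_tail:
  assumes Y [measurable]: "Y \<in> borel_measurable M" and s: "0 < s"
  shows "(\<integral>w. gamma_tail_ext n (ennreal s * Y w) \<partial>M)
    = (\<Sum>m<n. s ^ m * ((- 1) ^ m / Gamma (real m + 1)) * (deriv ^^ m) (laplace_transform M Y) s)"
proof -
  have int: "integrable M (\<lambda>w. laplace_kernel m s (Y w))" for m
    using abs_laplace_kernel_le[OF s] by (intro integrable_const_bound[where B = "fact m / s ^ m"]) auto
  have "gamma_tail_ext n (ennreal s * x)
      = (\<Sum>m<n. s ^ m * ((- 1) ^ m / Gamma (real m + 1)) * laplace_kernel m s x)" for x
  proof (cases x)
    case (real r)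
    have "Gamma (real m + 1) = fact m" for m
      using Gamma_fact[of m, where ?'a = real] by (simp add: add.commute)
    then have "(s * r) ^ m / fact m * exp (- (s * r))
        = s ^ m * ((- 1) ^ m / Gamma (real m + 1)) * ((- r) ^ m * exp (- s * r))" for m
      by (cases "even m") (simp_all add: power_mult_distrib)
    then show ?thesis
      using real s by (simp add: gamma_tail_ext_def laplace_kernel_def gamma_tail_def
          ennreal_mult[symmetric])
  qed (use s in \<open>simp add: gamma_tail_ext_def laplace_kernel_def ennreal_mult_top\<close>)
  then show ?thesis
    using s by (simp add: int deriv_laplace_transform[OF Y])
qed

lemma gamma_tail_nonneg: "0 \<le> x \<Longrightarrow> 0 \<le> gamma_tail n x"
  by (simp add: gamma_tail_def sum_nonneg)

lemma gamma_tail_le_1: 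
  assumes "0 \<le> x"
  shows "gamma_tail n x \<le> 1"
proof -
  have "(\<Sum>m<n. x ^ m /\<^sub>R fact m) \<le> exp x"
    unfolding exp_def using assms by (intro sum_le_suminf summable_exp_generic) auto
  then have "(\<Sum>m<n. x ^ m /\<^sub>R fact m) * exp (- x) \<le> exp x * exp (- x)"
    by (intro mult_right_mono) auto
  then show ?thesis
    by (simp add: gamma_tail_def sum_distrib_left exp_minus_inverse divide_inverse mult_ac)
qed

lemma gamma_tail_ext_bounds: "0 \<le> gamma_tail_ext n x" "gamma_tail_ext n x \<le> 1"
  by (simp_all add: gamma_tail_ext_def gamma_tail_nonneg gamma_tail_le_1)

lemma borel_measurable_gamma_tail_ext [measurable]: "gamma_tail_ext n \<in> borel_measurable borel"
  unfolding gamma_tail_ext_def[abs_def] gamma_tail_def by measurable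

lemma AE_gamma_pos:
  assumes n: "0 < n"
  shows "AE y in gamma_distribution (real n) 1. 0 < y"
proof -
  have "AE y in lborel. y \<noteq> (0::real)"
    by (rule AE_lborel_singleton)
  then show ?thesis
    unfolding gamma_distribution_eq_erlang[OF n]
    by (subst AE_density) (auto simp: erlang_density_def elim!: eventually_mono split: if_splits)
qed

text \<open>For a zero signal the quotient is infinite, since \<open>y\<close> is almost surely
  positive; for an infinite signal it is 0. Otherwise the event says \<open>r / c \<le> y\<close>,
  which is a gamma tail.\<close>

lemma nn_integral_gamma_secure:
  assumes n: "0 < n" and c: "0 < c"
  shows "(\<integral>\<^sup>+y. indicator {y. ennreal (c * y) / x \<ge> 1} y \<partial>gamma_distribution (real n) 1)
    = ennreal (gamma_tail_ext n (ennreal (1 / c) * x))"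
proof -
  note pos = AE_gamma_pos[OF n]
  show ?thesis
  proof (cases x)
    case (real r)
    have "AE y in gamma_distribution (real n) 1.
        indicator {y. ennreal (c * y) / x \<ge> 1} y = (indicator {r / c..} y :: ennreal)"
      using pos
    proof eventually_elim
      case (elim y)
      have "ennreal (c * y) / x \<ge> 1 \<longleftrightarrow> r \<le> c * y"
      proof (cases "r = 0")
        case True
        then show ?thesis
          using elim c real by (simp add: ennreal_divide_zero)
      next
        case False
        then show ?thesis
          using elim c real by (simp add: divide_ennreal)
      qed
      then show ?case
        using c by (simp add: field_simps split: split_indicator)
    qed
    then have "(\<integral>\<^sup>+y. indicator {y. ennreal (c * y) / x \<ge> 1} y \<partial>gamma_distribution (real n) 1)
        = emeasure (gamma_distribution (real n) 1) {r / c..}"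
      by (subst nn_integral_cong_AE) auto
    then show ?thesis
      using c real n by (simp add: emeasure_gamma_atLeast gamma_tail_ext_def ennreal_mult[symmetric])
  next
    case top
    then show ?thesis
      using c by (simp add: gamma_tail_ext_def ennreal_mult_top)
  qed
qed

section \<open>Laplace transform of the colluding signal\<close>

text \<open>Besides restricting the index set it exchanges kernels that agree on the sets of
  \<open>K\<close>; this reconciles a law given on a larger sigma-algebra with a kernel on
  \<open>K\<close>.\<close>

lemma cond_indep_given_subset:
  assumes "cond_indep_given M N V I K Y \<kappa>" "I' \<subseteq> I"
    "\<And>i w B. i \<in> I' \<Longrightarrow> w \<in> space M \<Longrightarrow> B \<in> sets K \<Longrightarrow> emeasure (\<kappa> i w) B = emeasure (\<kappa>' i w) B"
  shows "cond_indep_given M N V I' K Y \<kappa>'"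
  unfolding cond_indep_given_def
proof (intro conjI allI impI; (elim conjE)?)
  show "V \<in> measurable M N" "\<forall>i\<in>I'. Y i \<in> measurable M K"
    using assms by (auto simp: cond_indep_given_def)
  fix J B A
  assume J: "J \<subseteq> I'" "finite J" "\<forall>i\<in>J. B i \<in> sets K" "A \<in> sets N"
  then have "emeasure M {w \<in> space M. V w \<in> A \<and> (\<forall>i\<in>J. Y i w \<in> B i)}
      = (\<integral>\<^sup>+ w. indicator A (V w) * (\<Prod>i\<in>J. emeasure (\<kappa> i w) (B i)) \<partial>M)"
    using assms(1,2) by (auto simp: cond_indep_given_def)
  also have "\<dots> = (\<integral>\<^sup>+ w. indicator A (V w) * (\<Prod>i\<in>J. emeasure (\<kappa>' i w) (B i)) \<partial>M)"
    using J assms(3) by (intro nn_integral_cong) (auto intro!: arg_cong2[where f = "(*)"] prod.cong)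
  finally show "emeasure M {w \<in> space M. V w \<in> A \<and> (\<forall>i\<in>J. Y i w \<in> B i)}
      = (\<integral>\<^sup>+ w. indicator A (V w) * (\<Prod>i\<in>J. emeasure (\<kappa>' i w) (B i)) \<partial>M)" .
qed

text \<open>The state selects exponents and shapes; with only two states, measurability reduces to a
  case distinction.\<close>

lemma measurable_link_state_case:
  assumes [measurable]: "f \<in> measurable M (count_space UNIV)"
    and [measurable]: "h LOS \<in> measurable M N" "h NLOS \<in> measurable M N"
  shows "(\<lambda>x. h (f x) x) \<in> measurable M N"
proof -
  have "(\<lambda>x. h (f x) x) = (\<lambda>x. if f x = LOS then h LOS x else h NLOS x)"
    by (rule ext) (metis link_state.exhaust)
  then show ?thesis
    by simp
qed

lemma measurable_path_loss [measurable (raw)]: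
  assumes "f \<in> measurable M (count_space UNIV)" and [measurable]: "g \<in> borel_measurable M"
  shows "(\<lambda>x. path_loss P (f x) (g x)) \<in> borel_measurable M"
  by (rule measurable_link_state_case[OF assms(1), of "\<lambda>j x. path_loss P j (g x)"])
    (simp_all add: path_loss_def)

section \<open>The serving station as a function of locations and link states\<close>

abbreviation user_space :: "((nat \<Rightarrow> plane) \<times> (nat \<Rightarrow> link_state)) measure" where
  "user_space \<equiv> PiM UNIV (\<lambda>_. borel) \<Otimes>\<^sub>M PiM UNIV (\<lambda>_. count_space UNIV)"

definition user_view :: "'w network \<Rightarrow> 'w \<Rightarrow> (nat \<Rightarrow> plane) \<times> (nat \<Rightarrow> link_state)" where
  "user_view W w = (\<lambda>i. bs W i w, \<lambda>i. state W i User w)"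

text \<open>If no maximum is attained, the index is arbitrary, but it still depends measurably on the
  argument, and the proof uses nothing else.\<close>
definition server :: "net_params \<Rightarrow> (nat \<Rightarrow> plane) \<times> (nat \<Rightarrow> link_state) \<Rightarrow> nat" where
  "server P u = (LEAST i. is_arg_max (\<lambda>k. path_loss P (snd u k) (norm (fst u k))) (\<lambda>_. True) i)"

lemma serving_eq_server: "serving P W w = server P (user_view W w)"
  by (simp add: serving_def server_def link_loss_def link_length_def position_def user_view_def)

lemma measurable_server [measurable]: "server P \<in> measurable user_space (count_space UNIV)"
  unfolding server_def[abs_def] is_arg_max_def by measurable

text \<open>The index takes countably many values, so evaluation at it is measurable piece by
  piece.\<close>

lemma measurable_random_index:
  fixes g :: "'a \<Rightarrow> nat"
  assumes f: "f \<in> measurable M (PiM UNIV (\<lambda>_. K))" and g: "g \<in> measurable M (count_space UNIV)"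
  shows "(\<lambda>x. f x (g x)) \<in> measurable M K"
  using measurable_compose_countable[of
      "\<lambda>i x. f x i" M K g] g measurable_compose[OF f measurable_component_singleton]
  by simp

type_synonym loc_state = "((nat \<Rightarrow> plane) \<times> (nat \<Rightarrow> plane)) \<times> (nat \<times> receiver \<Rightarrow> link_state)"

abbreviation loc_state_space :: "loc_state measure" where
  "loc_state_space \<equiv> location_space \<Otimes>\<^sub>M state_space"

text \<open>Serving index, receiver state and path loss are rewritten as functions of locations and
  states, the variable conditioned upon, so that kernels and integrands visibly depend on the
  outcome through it.\<close>

definition serv_of :: "net_params \<Rightarrow> loc_state \<Rightarrow> nat" where
  "serv_of P v = server P (fst (fst v), \<lambda>i. snd v (i, User))"

definition state_of :: "net_params \<Rightarrow> receiver \<Rightarrow> loc_state \<Rightarrow> link_state" where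
  "state_of P u v = snd v (serv_of P v, u)"

definition loss_of :: "net_params \<Rightarrow> nat \<Rightarrow> loc_state \<Rightarrow> real" where
  "loss_of P k v = path_loss P (state_of P (Eve k) v)
      (norm (fst (fst v) (serv_of P v) - snd (fst v) k))"

lemma measurable_states_at [measurable]:
  "(\<lambda>v. \<lambda>i. snd v (i, u)) \<in> measurable loc_state_space (PiM (UNIV :: nat set) (\<lambda>_. count_space UNIV))"
  by (rule measurable_PiM_single') (auto simp: space_PiM)

lemma measurable_serv_of [measurable]: "serv_of P \<in> measurable loc_state_space (count_space UNIV)"
  unfolding serv_of_def[abs_def] by measurable

lemma measurable_state_of [measurable]: "state_of P u \<in> measurable loc_state_space (count_space UNIV)"
  unfolding state_of_def[abs_def]
  by (rule measurable_random_index[of "\<lambda>v i. snd v (i, u)"]) measurable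

lemma measurable_loss_of [measurable]: "loss_of P k \<in> borel_measurable loc_state_space"
proof -
  have [measurable]: "(\<lambda>v. fst (fst v) (serv_of P v)) \<in> borel_measurable loc_state_space"
    by (rule measurable_random_index[of "\<lambda>v. fst (fst v)"]) measurable
  show ?thesis
    unfolding loss_of_def[abs_def] by measurable
qed

definition loc_states :: "'w network \<Rightarrow> 'w \<Rightarrow> loc_state" where
  "loc_states W w = (locations W w, states W w)"

lemma loc_states_simps:
  "serv_of P (loc_states W w) = serving P W w"
  "state_of P u (loc_states W w) = state W (serving P W w) u w"
  "loss_of P k (loc_states W w) = link_loss P W (serving P W w) (Eve k) w"
proof -
  show 1: "serv_of P (loc_states W w) = serving P W w"
    by (simp add: serv_of_def serving_eq_server loc_states_def locations_def states_def user_view_def)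
  show 2: "state_of P u (loc_states W w) = state W (serving P W w) u w" for u
    unfolding state_of_def 1 by (simp add: loc_states_def states_def)
  show "loss_of P k (loc_states W w) = link_loss P W (serving P W w) (Eve k) w"
    unfolding loss_of_def 1 2
    by (simp add: link_loss_def link_length_def position_def loc_states_def locations_def)
qed

context secure_network
begin

abbreviation eve_state :: "nat \<Rightarrow> 'w \<Rightarrow> link_state" where
  "eve_state k w \<equiv> state W (serving P W w) (Eve k) w"

abbreviation eve_loss :: "nat \<Rightarrow> 'w \<Rightarrow> real" where
  "eve_loss k w \<equiv> link_loss P W (serving P W w) (Eve k) w"

lemma loc_states_measurable [measurable]: "loc_states W \<in> measurable M loc_state_space"
  using gains_law by (simp add: cond_indep_given_def loc_states_def[abs_def])

lemma locations_measurable [measurable]: "locations W \<in> measurable M location_space"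
  using states_law by (simp add: cond_indep_given_def)

lemma state_measurable [measurable]: "state W i u \<in> measurable M (count_space UNIV)"
  using states_law by (auto simp: cond_indep_given_def)

lemma gain_measurable [measurable]: "gain W k \<in> borel_measurable M"
  using gains_law by (auto simp: cond_indep_given_def)

lemma fading_measurable [measurable]: "fading W u \<in> borel_measurable M"
  using fading_law by (auto simp: cond_indep_given_def)

lemma bs_measurable [measurable]: "bs W i \<in> borel_measurable M"
  using BSs_PPP by (simp add: enumerates_def)

lemma eve_measurable [measurable]: "eve W i \<in> borel_measurable M"
  using Eves_PPP by (simp add: enumerates_def)

lemma user_view_measurable [measurable]: "user_view W \<in> measurable M user_space"
  unfolding user_view_def[abs_def]
  by (intro measurable_Pair measurable_PiM_single') (auto simp: space_PiM)

lemma serving_measurable [measurable]: "serving P W \<in> measurable M (count_space UNIV)"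
  unfolding serving_eq_server[abs_def] by measurable

lemma serving_bs_measurable [measurable]: "serving_bs P W \<in> borel_measurable M"
  unfolding serving_bs_def[abs_def]
  by (rule measurable_compose_countable[of "\<lambda>i w. bs W i w"]) measurable

lemma link_loss_measurable [measurable]: "eve_loss k \<in> borel_measurable M"
  unfolding loc_states_simps(3)[symmetric] by measurable

lemma colluding_signal_measurable [measurable]: "colluding_signal P W \<in> borel_measurable M"
  unfolding colluding_signal_def[abs_def] by measurable

end

definition user_part :: "loc_state \<Rightarrow> (nat \<Rightarrow> plane) \<times> (nat \<Rightarrow> link_state)" where
  "user_part v = (fst (fst v), \<lambda>i. snd v (i, User))"

lemma user_part_measurable [measurable]: "user_part \<in> measurable loc_state_space user_space"
  unfolding user_part_def[abs_def] by measurable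

lemma user_part_loc_states: "user_part (loc_states W w) = user_view W w"
  by (simp add: user_part_def loc_states_def locations_def states_def user_view_def)

lemma nn_integral_state_law:
  assumes "0 \<le> los_prob P r" "los_prob P r \<le> 1"
  shows "(\<integral>\<^sup>+j. f j \<partial>state_law P r) = (\<Sum>j\<in>{LOS, NLOS}. ennreal (state_prob P j r) * f j)"
  using assms
  by (simp add: state_law_def state_prob_def nn_integral_bernoulli_pmf mult.commute)

lemma state_law_in_subprob: "state_law P r \<in> space (subprob_algebra (count_space UNIV))"
  unfolding state_law_def by (simp add: space_subprob_algebra measure_pmf.subprob_space_axioms)

lemma measurable_state_law [measurable]:
    "state_law P \<in> measurable borel (subprob_algebra (count_space UNIV))"
proof -
  \<comment> \<open>The law is constant on each side of the blockage radius, so one sample radius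
    per side represents it.\<close>
  have "state_law P = (\<lambda>r. if r
      \<le> block_D P then state_law P (block_D P) else state_law P (block_D P + 1))"
    by (rule ext) (simp add: state_law_def los_prob_def)
  moreover have "(\<lambda>r. if r \<le> block_D P then state_law P (block_D P) else state_law P (block_D P + 1))
      \<in> measurable borel (subprob_algebra (count_space UNIV))"
    by (intro measurable_If measurable_const state_law_in_subprob) measurable
  ultimately show ?thesis
    by simp
qed

section \<open>Averaging over fadings, gains and link states\<close>

context secure_network
begin

lemma gamma_kernel_measurable:
  "(\<lambda>j. gamma_distribution (real (nak P j)) 1) \<in> measurable (count_space UNIV) (subprob_algebra borel)"
proof -
  have "gamma_distribution (real (nak P j)) 1 \<in> space (subprob_algebra borel)" for j
    using prob_space_gamma[OF fading_shape[of j]]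
    by (simp add: space_subprob_algebra prob_space_imp_subprob_space)
  then show ?thesis
    by simp
qed

abbreviation marked_view :: "'w \<Rightarrow> loc_state \<times> (nat \<Rightarrow> real)" where
  "marked_view w \<equiv> (loc_states W w, \<lambda>k. gain W k w)"

lemma fading_cond_indep:
  "cond_indep_given M (loc_state_space \<Otimes>\<^sub>M PiM UNIV (\<lambda>_. borel)) marked_view UNIV borel (fading W)
    (\<lambda>u w. (\<lambda>v. gamma_distribution (real (nak P (state_of P u (fst v)))) 1) (marked_view w))"
  using fading_law by (simp add: loc_states_simps) (simp add: loc_states_def)

lemma fading_kernel_measurable:
  "(\<lambda>v. gamma_distribution (real (nak P (state_of P u (fst v)))) 1)
    \<in> measurable (loc_state_space \<Otimes>\<^sub>M PiM UNIV (\<lambda>_. borel)) (subprob_algebra borel)"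
  by (rule measurable_compose[OF _ gamma_kernel_measurable]) measurable

text \<open>Given locations, states and gains, the fadings are independent gamma variables, so each
  factor becomes a gamma Laplace transform. Gains are positive only almost surely;
  \<open>max 0\<close> mirrors the truncation by \<open>ennreal\<close> on the other
  outcomes.\<close>

lemma fading_step:
  assumes s: "0 < s" and H: "H \<in> borel_measurable (loc_state_space \<Otimes>\<^sub>M PiM UNIV (\<lambda>_. borel))"
  shows "(\<integral>\<^sup>+w. H (marked_view w) * (\<Prod>k<K. ennreal (expneg (ennreal s *
        ennreal (gain W k w * eve_loss k w * fading W (Eve k) w)))) \<partial>M)
    = (\<integral>\<^sup>+w. H (marked_view w) *
        (\<Prod>k<K. ennreal (1 / (1 + s * max 0 (gain W k w * eve_loss k w)) ^ nak P (eve_state k w))) \<partial>M)"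
proof -
  define F where "F u x = (case u of User \<Rightarrow> 1
    | Eve k \<Rightarrow> ennreal (expneg (ennreal s * ennreal
        (snd (fst x) k * loss_of P k (fst (fst x)) * snd x))))"
    for u and x :: "(loc_state \<times> (nat \<Rightarrow> real)) \<times> real"
  have F: "F u \<in> borel_measurable ((loc_state_space \<Otimes>\<^sub>M PiM UNIV (\<lambda>_. borel)) \<Otimes>\<^sub>M borel)" for u
    unfolding F_def[abs_def] by (cases u) simp_all
  have int: "(\<integral>\<^sup>+y. F (Eve k) (v, y) \<partial>gamma_distribution (real (nak P j)) 1)
      = ennreal (1 / (1 + s * max 0 (snd v k * loss_of P k (fst v))) ^ nak P j)" for k v j
  proof -
    let ?c = "max 0 (snd v k * loss_of P k (fst v))"
    have "(\<integral>\<^sup>+y. F (Eve k) (v, y) \<partial>gamma_distribution (real (nak P j)) 1)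
        = (\<integral>\<^sup>+y. ennreal (expneg (ennreal (s * ?c * y))) \<partial>gamma_distribution (real (nak P j)) 1)"
    proof (rule nn_integral_cong_AE)
      show "AE y in gamma_distribution (real (nak P j)) 1. F (Eve k) (v, y)
          = ennreal (expneg (ennreal (s * ?c * y)))"
        using AE_gamma_pos[OF fading_shape[of j]]
      proof eventually_elim
        case (elim y)
        have "ennreal (snd v k * loss_of P k (fst v) * y) = ennreal (?c * y)"
        proof (cases "0 \<le> snd v k * loss_of P k (fst v)")
          case False
          then have "snd v k * loss_of P k (fst v) * y \<le> 0"
            using elim mult_nonpos_nonneg[of "snd v k * loss_of P k (fst v)" y] by simp
          then show ?thesis
            using False by (simp add: ennreal_neg max_def)
        qed simp
        then show ?case
          using s elim by (simp add: F_def ennreal_mult[symmetric] mult.assoc)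
      qed
    qed
    also have "\<dots> = ennreal (1 / (1 + s * ?c) ^ nak P j)"
      using s by (intro gamma_laplace fading_shape) simp
    finally show ?thesis .
  qed
  have inj: "inj_on Eve {..<K}"
    by (auto simp: inj_on_def)
  have "(\<integral>\<^sup>+w. H (marked_view w) * (\<Prod>u\<in>Eve ` {..<K}. F u (marked_view w, fading W u w)) \<partial>M)
    = (\<integral>\<^sup>+w. H (marked_view w) * (\<Prod>u\<in>Eve ` {..<K}. \<integral>\<^sup>+y. F u (marked_view w, y)
        \<partial>gamma_distribution (real (nak P (state_of P u (fst (marked_view w))))) 1) \<partial>M)"
    by (rule cond_indep_given_prod[OF fading_cond_indep finite_measure_axioms
        fading_kernel_measurable _ _ F H]) auto
  then show ?thesis
    by (simp add: prod.reindex[OF inj] int) (simp add: F_def loc_states_simps)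
qed

text \<open>\<^const>\<open>gain_law\<close> lives on the full power set, but a kernel has to live on the Borel sets.\<close>
definition gain_kernel :: "real measure" where
  "gain_kernel = distr (gain_law P) borel (\<lambda>x. x)"

lemma gain_kernel_in_subprob: "gain_kernel \<in> space (subprob_algebra borel)"
proof -
  interpret G: prob_space "gain_law P"
    unfolding gain_law_def by (rule measure_pmf.prob_space_axioms)
  have "(\<lambda>x. x) \<in> measurable (gain_law P) borel"
    by (simp add: gain_law_def)
  then show ?thesis
    unfolding gain_kernel_def
    by (simp add: space_subprob_algebra prob_space_imp_subprob_space G.prob_space_distr)
qed

lemma gains_cond_indep:
  "cond_indep_given M loc_state_space (loc_states W) UNIV borel (gain W)
      (\<lambda>k w. (\<lambda>_. gain_kernel) (loc_states W w))"
proof (rule cond_indep_given_subset)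
  have "(\<lambda>w. (locations W w, states W w)) = loc_states W"
    by (simp add: fun_eq_iff loc_states_def)
  with gains_law show "cond_indep_given M loc_state_space (loc_states W) UNIV borel (gain W)
      (\<lambda>_ _. gain_law P)"
    by simp
next
  fix B :: "real set"
  assume "B \<in> sets borel"
  then show "emeasure (gain_law P) B = emeasure gain_kernel B"
    by (simp add: gain_kernel_def emeasure_distr gain_law_def)
qed simp

lemma nn_integral_gain_kernel:
  assumes [measurable]: "f \<in> borel_measurable borel"
  shows "(\<integral>\<^sup>+y. f y \<partial>gain_kernel) = (\<Sum>v\<in>{Main, Side}. ennreal (lobe_prob P v) * f (lobe_gain P v))"
proof -
  have "lobe_prob P Side = 1 - lobe_prob P Main"
    using sum_lobe_prob by simp
  moreover have "(\<integral>\<^sup>+y. f y \<partial>gain_kernel) = (\<integral>\<^sup>+y. f y \<partial>gain_law P)"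
    unfolding gain_kernel_def by (intro nn_integral_distr) (simp_all add: gain_law_def)
  ultimately show ?thesis
    using lobe_prob_nonneg[of Main] lobe_prob_nonneg[of Side]
    by (simp add: gain_law_def nn_integral_bernoulli_pmf mult.commute)
qed

text \<open>Path losses are nonnegative and both lobe gains positive, so \<open>max 0\<close>
  disappears when the gain is averaged over the lobes.\<close>

lemma gain_step:
  assumes s: "0 < s" and H: "H \<in> borel_measurable loc_state_space"
  shows "(\<integral>\<^sup>+w. H (loc_states W w)
      * (\<Prod>k<K. ennreal (1 / (1 + s * max 0 (gain W k w * eve_loss k w)) ^ nak P (eve_state k w))) \<partial>M)
    = (\<integral>\<^sup>+w. H (loc_states W w) * (\<Prod>k<K. ennreal (link_laplace P s (eve_state k w) (eve_loss k w))) \<partial>M)"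
proof -
  define F where "F k x = ennreal (1
      / (1 + s * max 0 (snd x * loss_of P k (fst x))) ^ nak P (state_of P (Eve k) (fst x)))"
    for k and x :: "loc_state \<times> real"
  have F: "F k \<in> borel_measurable (loc_state_space \<Otimes>\<^sub>M borel)" for k
    unfolding F_def[abs_def]
    by (rule measurable_link_state_case[of "\<lambda>x. state_of P (Eve k) (fst x)" _
          "\<lambda>j x. ennreal (1 / (1 + s * max 0 (snd x * loss_of P k (fst x))) ^ nak P j)"]) measurable
  have int: "(\<integral>\<^sup>+y. F k (loc_states W w, y) \<partial>gain_kernel)
      = ennreal (link_laplace P s (state_of P (Eve k) (loc_states W w))
          (loss_of P k (loc_states W w)))" for k w
  proof -
    have l: "0 \<le> loss_of P k (loc_states W w)"
      by (simp add: loss_of_def path_loss_nonneg)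
    then have m: "max 0 (lobe_gain P v * loss_of P k (loc_states W w))
        = lobe_gain P v * loss_of P k (loc_states W w)" for v
      using gains_pos[of v] by (simp add: max_absorb2)
    have nn: "0 \<le> lobe_prob P v
        * (1 / (1 + s * (lobe_gain P v * loss_of P k (loc_states W w))) ^ n)" for v n
      using gains_pos[of v] l s lobe_prob_nonneg[of v]
      by (intro mult_nonneg_nonneg divide_nonneg_nonneg zero_le_power add_nonneg_nonneg) auto
    have "(\<integral>\<^sup>+y. F k (loc_states W w, y) \<partial>gain_kernel)
        = (\<Sum>v\<in>{Main, Side}. ennreal (lobe_prob P v) * F k (loc_states W w, lobe_gain P v))"
      by (rule nn_integral_gain_kernel) (simp add: F_def)
    also have "\<dots> = (\<Sum>v\<in>{Main, Side}. ennreal (lobe_prob P v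
        * (1 / (1 + s * (lobe_gain P v * loss_of P k (loc_states W w))) ^ nak P
            (state_of P (Eve k) (loc_states W w)))))"
      using lobe_prob_nonneg by (intro sum.cong refl)
          (simp only: F_def fst_conv snd_conv m ennreal_mult'[symmetric])
    also have "\<dots> = ennreal (link_laplace P s (state_of P (Eve k) (loc_states W w))
        (loss_of P k (loc_states W w)))"
      unfolding link_laplace_def using nn by (intro sum_ennreal) blast
    finally show ?thesis .
  qed
  have "(\<integral>\<^sup>+w. H (loc_states W w) * (\<Prod>k<K. F k (loc_states W w, gain W k w)) \<partial>M)
      = (\<integral>\<^sup>+w. H (loc_states W w) * (\<Prod>k<K. \<integral>\<^sup>+y. F k (loc_states W w, y) \<partial>gain_kernel) \<partial>M)"
    by (rule cond_indep_given_prod[OF gains_cond_indep finite_measure_axioms _ _ _ F H])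
      (simp_all add: gain_kernel_in_subprob)
  then show ?thesis
    unfolding int by (simp add: F_def loc_states_simps)
qed

lemma states_cond_indep:
  "cond_indep_given M location_space (locations W) UNIV (count_space UNIV) (\<lambda>(i, u). state W i u)
    (\<lambda>p w. (\<lambda>v. state_law P (norm (fst v (fst p) - (case snd p of User \<Rightarrow> 0 | Eve k \<Rightarrow> snd v k))))
        (locations W w))"
  using states_law
  by (rule cond_indep_given_subset)
      (auto simp: link_length_def position_def locations_def split: receiver.split)

lemma state_kernel_measurable:
  "(\<lambda>v. state_law P (norm (fst v (fst p) - (case snd p of User \<Rightarrow> 0 | Eve k \<Rightarrow> snd v k))))
    \<in> measurable location_space (subprob_algebra (count_space UNIV))"
  by (cases "snd p") (simp_all add: measurable_compose[OF _ measurable_state_law])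

text \<open>The relevant states sit at the random serving index. On the event that this index is
  \<open>i\<close> they are marks at fixed indices, and the event depends only on locations and on
  states towards the user, which can be conditioned upon.\<close>

lemma state_step:
  assumes s: "0 < s" and A: "A \<in> sets user_space"
  shows "(\<integral>\<^sup>+w. indicator A (user_view W w)
      * (\<Prod>k<K. ennreal (link_laplace P s (eve_state k w) (eve_loss k w))) \<partial>M)
    = (\<integral>\<^sup>+w. indicator A (user_view W w) *
        (\<Prod>k<K. ennreal (eve_laplace P s (norm (serving_bs P W w - eve W k w)))) \<partial>M)"
proof -
  let ?L = "\<lambda>w. (\<Prod>k<K. ennreal (link_laplace P s (eve_state k w) (eve_loss k w)))"
  let ?E = "\<lambda>w. (\<Prod>k<K. ennreal (eve_laplace P s (norm (serving_bs P W w - eve W k w))))"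
  let ?AI = "\<lambda>i w. indicator A (user_view W w) * indicator {i} (serving P W w) :: ennreal"
  note A [measurable]
  \<comment> \<open>Links to the user are absorbed into the conditioning because they determine the
    server; links to eavesdroppers remain as marks.\<close>
  let ?Iu = "range (\<lambda>i::nat. (i, User))"
  let ?Ie = "range (\<lambda>(i::nat, k). (i, Eve k))"
  let ?N = "location_space \<Otimes>\<^sub>M PiM ?Iu (\<lambda>_. count_space UNIV :: link_state measure)"
  define V where "V w = (locations W w, \<lambda>p\<in>?Iu. (case p of (i, u) \<Rightarrow> state W i u) w)" for w
  define kern where "kern p x = state_law P
      (norm (fst (fst x) (fst p) - (case snd p of User \<Rightarrow> 0 | Eve k \<Rightarrow> snd (fst x) k)))"
    for p and x :: "loc_state"
  have cig: "cond_indep_given M ?N V ?Ie (count_space UNIV) (\<lambda>(i, u). state W i u) (\<lambda>p w. kern p (V w))"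
    unfolding V_def[abs_def] kern_def fst_conv
    by (rule cond_indep_given_absorb[OF states_cond_indep finite_measure_axioms
        state_kernel_measurable]) auto
  have kern: "kern p \<in> measurable ?N (subprob_algebra (count_space UNIV))" for p
    unfolding kern_def[abs_def] by (rule measurable_compose[OF measurable_fst state_kernel_measurable])
  define uv where "uv x = (fst (fst x), \<lambda>i. snd x (i, User))" for x :: "loc_state"
  have [measurable]: "(\<lambda>x. \<lambda>i. snd x (i, User))
      \<in> measurable ?N (PiM (UNIV :: nat set) (\<lambda>_. count_space UNIV))"
    by (rule measurable_PiM_single')
        (auto simp: space_PiM intro!:
            measurable_compose[OF measurable_snd measurable_component_singleton])
  have uv [measurable]: "uv \<in> measurable ?N user_space"
    unfolding uv_def[abs_def] by measurable
  have uvV: "uv (V w) = user_view W w" for w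
    by (simp add: uv_def V_def user_view_def locations_def)
  define F where "F p x = (case snd p of User \<Rightarrow> 1
    | Eve k \<Rightarrow> ennreal (link_laplace P s (snd x)
        (path_loss P (snd x) (norm (fst (fst (fst x)) (fst p) - snd (fst (fst x)) k)))))"
    for p and x :: "(loc_state) \<times> link_state"
  have F: "F p \<in> borel_measurable (?N \<Otimes>\<^sub>M count_space UNIV)" for p
  proof (cases "snd p")
    case (Eve k)
    let ?h = "\<lambda>j x. ennreal (link_laplace P s j
        (path_loss P j (norm (fst (fst (fst x)) (fst p) - snd (fst (fst x)) k))))"
    have "(\<lambda>x. ?h (snd x) x) \<in> borel_measurable (?N \<Otimes>\<^sub>M count_space UNIV)"
      by (rule measurable_link_state_case[of snd _ ?h]) (simp_all add: link_laplace_def)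
    then show ?thesis
      by (simp add: F_def[abs_def] Eve)
  qed (simp add: F_def[abs_def])
  have int: "(\<integral>\<^sup>+j. F (i, Eve k) (x, j) \<partial>kern (i, Eve k) x)
      = ennreal (eve_laplace P s (norm (fst (fst x) i - snd (fst x) k)))" for i k x
  proof -
    let ?r = "norm (fst (fst x) i - snd (fst x) k)"
    have "(\<integral>\<^sup>+j. F (i, Eve k) (x, j) \<partial>kern (i, Eve k) x)
        = (\<Sum>j\<in>{LOS, NLOS}. ennreal (state_prob P j ?r) * ennreal
            (link_laplace P s j (path_loss P j ?r)))"
      unfolding kern_def by (subst nn_integral_state_law) (simp_all add: los_prob_bounds F_def)
    also have "\<dots> = (\<Sum>j\<in>{LOS, NLOS}. ennreal (state_prob P j ?r
        * link_laplace P s j (path_loss P j ?r)))"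
      using state_prob_nonneg by (simp add: ennreal_mult')
    also have "\<dots> = ennreal (eve_laplace P s ?r)"
      unfolding eve_laplace_def
      using state_prob_nonneg link_laplace_bounds[OF s path_loss_nonneg]
      by (intro sum_ennreal mult_nonneg_nonneg) (auto intro: less_imp_le)
    finally show ?thesis .
  qed
  \<comment> \<open>The serving index is frozen at \<open>i\<close>, and both indicators in
    \<open>?AI\<close> are weights in \<open>V\<close>.\<close>
  have step: "(\<integral>\<^sup>+w. ?AI i w * ?L w \<partial>M)
    = (\<integral>\<^sup>+w. ?AI i w * ?E w \<partial>M)"
    for i
  proof -
    let ?J = "(\<lambda>k. (i, Eve k)) ` {..<K}"
    let ?H = "\<lambda>x. indicator A (uv x) * indicator {i} (server P (uv x)) :: ennreal"
    have inj: "inj_on (\<lambda>k. (i, Eve k)) {..<K}"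
      by (auto simp: inj_on_def)
    have "(\<lambda>x. server P (uv x)) \<in> measurable ?N (count_space UNIV)"
      by (rule measurable_compose[OF uv measurable_server])
    then have "(\<lambda>x. indicator {i} (server P (uv x)) :: ennreal) \<in> borel_measurable ?N"
      by (rule measurable_compose) simp
    moreover have "(\<lambda>x. indicator A (uv x) :: ennreal) \<in> borel_measurable ?N"
      by measurable
    ultimately have H: "?H \<in> borel_measurable ?N"
      by (rule borel_measurable_times_ennreal[rotated])
    have HV: "?H (V w) = indicator A (user_view W w) * indicator {i} (serving P W w)" for w
      by (simp add: uvV serving_eq_server)
    have locV: "fst (fst (V w)) = (\<lambda>i. bs W i w)" "snd (fst (V w)) = (\<lambda>k. eve W k w)" for w
      by (simp_all add: V_def locations_def)
    have FV: "F (i, Eve k) (V w, j)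
        = ennreal (link_laplace P s j (path_loss P j (norm (bs W i w - eve W k w))))" for k j w
      by (simp add: F_def locV)
    have J: "?J \<subseteq> ?Ie"
      by auto
    have "(\<integral>\<^sup>+w. ?H (V w) * (\<Prod>p\<in>?J. F p (V w, (case p of (i, u) \<Rightarrow> state W i u) w)) \<partial>M)
        = (\<integral>\<^sup>+w. ?H (V w) * (\<Prod>p\<in>?J. \<integral>\<^sup>+j. F p (V w, j) \<partial>kern p (V w)) \<partial>M)"
      by (rule cond_indep_given_prod[OF cig finite_measure_axioms kern _ J F H]) simp
    then have "(\<integral>\<^sup>+w. ?H (V w) * (\<Prod>k<K. F (i, Eve k) (V w, state W i (Eve k) w)) \<partial>M)
        = (\<integral>\<^sup>+w. ?H (V w) * (\<Prod>k<K. ennreal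
            (eve_laplace P s (norm (fst (fst (V w)) i - snd (fst (V w)) k)))) \<partial>M)"
      by (simp add: prod.reindex[OF inj] int)
    moreover have "(\<integral>\<^sup>+w. ?H (V w) * (\<Prod>k<K. F (i, Eve k) (V w, state W i (Eve k) w)) \<partial>M)
        = (\<integral>\<^sup>+w. ?AI i w * ?L w \<partial>M)"
      unfolding HV FV
      by (intro nn_integral_cong)
          (auto simp: link_loss_def link_length_def position_def split: split_indicator)
    moreover have "(\<integral>\<^sup>+w. ?H (V w)
        * (\<Prod>k<K. ennreal (eve_laplace P s (norm (fst (fst (V w)) i - snd (fst (V w)) k)))) \<partial>M)
        = (\<integral>\<^sup>+w. ?AI i w * ?E w \<partial>M)"
      unfolding HV locV
      by (intro nn_integral_cong) (auto simp: serving_bs_def split: split_indicator)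
    ultimately show ?thesis
      by simp
  qed
  \<comment> \<open>Exactly one value of \<open>i\<close> has a nonzero indicator, so the pieces add
    up to the whole integral.\<close>
  have split: "(\<integral>\<^sup>+w. f w * g w \<partial>M) = (\<Sum>i. \<integral>\<^sup>+w. (f w * indicator {i} (serving P W w)) * g w \<partial>M)"
    if [measurable]: "f \<in> borel_measurable M" "g \<in> borel_measurable M" for f g :: "'w \<Rightarrow> ennreal"
  proof -
    have "f w * g w = (\<Sum>i. (f w * indicator {i} (serving P W w)) * g w)" for w
    proof -
      have "(\<Sum>i. (f w * indicator {i} (serving P W w)) * g w)
          = (\<Sum>i\<in>{serving P W w}. (f w * indicator {i} (serving P W w)) * g w)"
        by (intro suminf_finite) (auto split: split_indicator)
      then show ?thesis
        by simp
    qed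
    then have "(\<integral>\<^sup>+w. f w * g w \<partial>M) = (\<integral>\<^sup>+w. (\<Sum>i. (f w * indicator {i} (serving P W w)) * g w) \<partial>M)"
      by (intro nn_integral_cong)
    also have "\<dots> = (\<Sum>i. \<integral>\<^sup>+w. (f w * indicator {i} (serving P W w)) * g w \<partial>M)"
    proof (rule nn_integral_suminf)
      fix i
      have [measurable]: "(\<lambda>w. indicator {i} (serving P W w) :: ennreal) \<in> borel_measurable M"
        by (rule measurable_compose[OF serving_measurable]) simp
      show "(\<lambda>w. (f w * indicator {i} (serving P W w)) * g w) \<in> borel_measurable M"
        by measurable
    qed
    finally show ?thesis .
  qed
  have st [measurable]: "(\<lambda>w. eve_state k w) \<in> measurable M (count_space UNIV)" for k
    unfolding loc_states_simps(2)[symmetric] by measurable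
  have [measurable]: "(\<lambda>w. link_laplace P s (eve_state k w) (eve_loss k w)) \<in> borel_measurable M" for k
    by (rule measurable_link_state_case[OF st, of "\<lambda>j w. link_laplace P s j (eve_loss k w)"])
      (simp_all add: link_laplace_def)
  show ?thesis
    by (subst (1 2) split) (simp_all add: step)
qed

end

text \<open>Partial sums converge in \<open>[0, \<infinity>]\<close>, \<open>expneg\<close> is
  continuous there, and the products are bounded by 1.\<close>

lemma (in prob_space) tendsto_nn_integral_indicator_prod:
  assumes x [measurable]: "\<And>k. x k \<in> borel_measurable M" and A [measurable]: "Measurable.pred M A"
  shows "(\<lambda>K. \<integral>\<^sup>+w. indicator {w. A w} w * (\<Prod>k<K. ennreal (expneg (x k w))) \<partial>M)
    \<longlonglongrightarrow> (\<integral>\<^sup>+w. indicator {w. A w} w * ennreal (expneg (\<Sum>k. x k w)) \<partial>M)"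
proof (rule nn_integral_dominated_convergence[where w = "\<lambda>_. 1"])
  have pe: "(\<Prod>k<K. ennreal (expneg (x k w))) = ennreal (expneg (\<Sum>k<K. x k w))" for K w
    by (simp add: expneg_sum prod_ennreal)
  have [measurable]: "(\<lambda>w. indicator {w. A w} w :: ennreal) \<in> borel_measurable M"
    using A by (simp add: indicator_def[abs_def])
  show "(\<lambda>w. indicator {w. A w} w * (\<Prod>k<K. ennreal (expneg (x k w)))) \<in> borel_measurable M" for K
    by measurable
  show "(\<lambda>w. indicator {w. A w} w * ennreal (expneg (\<Sum>k. x k w))) \<in> borel_measurable M"
    by measurable
  show "AE w in M. indicator {w. A w} w * (\<Prod>k<K. ennreal (expneg (x k w))) \<le> 1" for K
    by (intro AE_I2) (auto simp: pe split: split_indicator)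
  show "AE w in M. (\<lambda>K. indicator {w. A w} w * (\<Prod>k<K. ennreal (expneg (x k w))))
      \<longlonglongrightarrow> indicator {w. A w} w * ennreal (expneg (\<Sum>k. x k w))"
  proof (rule AE_I2)
    fix w
    have "(\<lambda>K. \<Sum>k<K. x k w) \<longlonglongrightarrow> (\<Sum>k. x k w)"
      by (rule summable_LIMSEQ) simp
    then show "(\<lambda>K. indicator {w. A w} w * (\<Prod>k<K. ennreal (expneg (x k w))))
      \<longlonglongrightarrow> indicator {w. A w} w * ennreal (expneg (\<Sum>k. x k w))"
      unfolding pe by (intro ennreal_tendsto_cmult tendsto_ennrealI tendsto_expneg)
          (simp_all split: split_indicator)
  qed
qed (simp_all add: less_top[symmetric])

section \<open>Independence of the colluding signal from the user's side\<close>

context secure_network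
begin

text \<open>The locations of stations and eavesdroppers are independent, and the law of the state of
  a link to the user involves only the position of the station, so these states inherit the
  independence.\<close>

lemma user_view_indep_eves:
  assumes A: "A \<in> sets user_space" and C: "C \<in> sets (PiM UNIV (\<lambda>_. borel))"
  shows "emeasure M {w \<in> space M. user_view W w \<in> A \<and> (\<lambda>k. eve W k w) \<in> C}
    = emeasure M {w \<in> space M. user_view W w \<in> A} * emeasure M {w \<in> space M. (\<lambda>k. eve W k w) \<in> C}"
proof -
  let ?Iu = "range (\<lambda>i::nat. (i, User))"
  let ?N = "PiM UNIV (\<lambda>_. borel :: plane measure) \<Otimes>\<^sub>M PiM ?Iu
      (\<lambda>_. count_space UNIV :: link_state measure)"
  define V where "V w = (\<lambda>i. bs W i w, \<lambda>p\<in>?Iu. (case p of (i, u) \<Rightarrow> state W i u) w)" for w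
  define uv where "uv x = (fst x, \<lambda>i. snd x (i, User))"
      for x :: "(nat \<Rightarrow> plane) \<times> (nat \<times> receiver \<Rightarrow> link_state)"
  have [measurable]: "(\<lambda>x. \<lambda>i. snd x (i, User))
      \<in> measurable ?N (PiM (UNIV :: nat set) (\<lambda>_. count_space UNIV))"
    by (rule measurable_PiM_single')
        (auto simp: space_PiM intro!:
            measurable_compose[OF measurable_snd measurable_component_singleton])
  have uv [measurable]: "uv \<in> measurable ?N user_space"
    unfolding uv_def[abs_def] by measurable
  have uvV: "uv (V w) = user_view W w" for w
    by (simp add: uv_def V_def user_view_def)
  have V: "V \<in> measurable M ?N"
    unfolding V_def[abs_def] by (intro measurable_Pair measurable_PiM_single' measurable_restrict)
        (auto simp: space_PiM)
  have A': "uv -` A \<inter> space ?N \<in> sets ?N"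
    using uv A by (rule measurable_sets)
  have cig: "cond_indep_given M location_space (\<lambda>w. (\<lambda>i. bs W i w, \<lambda>k. eve W k w)) ?Iu
      (count_space UNIV) (\<lambda>(i, u). state W i u)
    (\<lambda>p w. (\<lambda>x. state_law P (norm (x (fst p)))) (\<lambda>i. bs W i w))"
    unfolding locations_def[symmetric]
    by (rule cond_indep_given_subset[OF states_law]) (auto simp: link_length_def position_def)
  have kern: "(\<lambda>x. state_law P (norm (x i)))
      \<in> measurable (PiM UNIV (\<lambda>_. borel)) (subprob_algebra (count_space UNIV))"
    for i :: nat
    by (rule measurable_compose[OF _ measurable_state_law]) measurable
  have "emeasure M {w \<in> space M. V w \<in> uv -` A \<inter> space ?N \<and> (\<lambda>k. eve W k w) \<in> C}
      = emeasure M {w \<in> space M. V w \<in> uv -` A \<inter> space ?N} * emeasure M {w \<in> space M.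
          (\<lambda>k. eve W k w) \<in> C}"
    unfolding V_def by (rule cond_indep_given_pair_indep[OF cig prob_space_axioms kern
        BSs_Eves_indep A' C])
  moreover have "V w \<in> uv -` A \<inter> space ?N \<longleftrightarrow> user_view W w \<in> A" if "w \<in> space M" for w
    using measurable_space[OF V that] by (simp add: uvV)
  then have "{w \<in> space M. V w \<in> uv -` A \<inter> space ?N \<and> (\<lambda>k. eve W k w) \<in> C}
      = {w \<in> space M. user_view W w \<in> A \<and> (\<lambda>k. eve W k w) \<in> C}"
    "{w \<in> space M. V w \<in> uv -` A \<inter> space ?N} = {w \<in> space M. user_view W w \<in> A}"
    by blast+
  ultimately show ?thesis
    by simp
qed

text \<open>The logarithm turns the product over eavesdroppers into a functional of the point
  process; a shift by \<open>x\<close> then centres the integral at the origin, where it is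
  radial.\<close>

lemma eves_laplace:
  assumes s: "0 < s" and \<alpha>: "2 < pl_exp P NLOS"
  shows "(\<integral>\<^sup>+w. ennreal (expneg (\<Sum>k. ennreal (- ln (eve_laplace P s (norm (x - eve W k w)))))) \<partial>M)
      = ennreal (exp (Xi P s))"
proof -
  let ?f = "\<lambda>z. ennreal (- ln (eve_laplace P s (norm (x - z))))"
  have e: "expneg (?f z) = eve_laplace P s (norm (x - z))" for z
    using eve_laplace_bounds[OF s, of "norm (x - z)"] by simp
  have "(\<integral>\<^sup>+w. ennreal (expneg (\<Sum>k. ?f (eve W k w))) \<partial>M)
      = ennreal (expneg (ennreal (lamE P) * (\<integral>\<^sup>+z. ennreal (1 - expneg (?f z)) \<partial>lborel)))"
    using intensities by (intro PPP_laplace_functional[OF Eves_PPP]) auto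
  also have "(\<integral>\<^sup>+z. ennreal (1 - expneg (?f z)) \<partial>lborel)
      = (\<integral>\<^sup>+z. ennreal (1 - eve_laplace P s (norm z)) \<partial>distr lborel borel ((+) (- x)))"
    unfolding e by (subst nn_integral_distr) (simp_all add: norm_minus_commute add.commute[of "- x"])
  also have "\<dots> = (\<integral>\<^sup>+z. ennreal (1 - eve_laplace P s (norm (z :: plane))) \<partial>lborel)"
    by (simp add: lborel_distr_plus)
  finally show ?thesis
    using nn_integral_one_minus_eve_laplace[OF s \<alpha>] by simp
qed

text \<open>The value in \<open>eves_laplace\<close> is the same for every centre \<open>x\<close>,
  so the random serving position leaves no trace; as \<open>A\<close> is arbitrary, the conditional
  transform given the user view is constant.\<close>

lemma signal_laplace:
  assumes s: "0 < s" and \<alpha>: "2 < pl_exp P NLOS" and A: "A \<in> sets user_space"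
  shows "(\<integral>\<^sup>+w. indicator A (user_view W w) * ennreal (expneg (ennreal s * colluding_signal P W w)) \<partial>M)
    = emeasure M {w \<in> space M. user_view W w \<in> A} * ennreal (exp (Xi P s))"
proof -
  note A [measurable]
  let ?A = "\<lambda>w. user_view W w \<in> A"
  have ind: "indicator {w. ?A w} w = (indicator A (user_view W w) :: ennreal)" for w
    by (auto split: split_indicator)
  let ?x = "\<lambda>k w. ennreal s * ennreal (gain W k w * eve_loss k w * fading W (Eve k) w)"
  let ?y = "\<lambda>k w. ennreal (- ln (eve_laplace P s (norm (serving_bs P W w - eve W k w))))"
  \<comment> \<open>Written as \<open>expneg\<close> of a nonnegative number, the averaged factors
    fall under the same limit lemma as the original ones.\<close>
  have ey: "eve_laplace P s r = expneg (ennreal (- ln (eve_laplace P s r)))" for r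
    using eve_laplace_bounds[OF s, of r] by simp
  have eq: "(\<integral>\<^sup>+w. indicator {w. ?A w} w * (\<Prod>k<K. ennreal (expneg (?x k w))) \<partial>M)
      = (\<integral>\<^sup>+w. indicator {w. ?A w} w * (\<Prod>k<K. ennreal (expneg (?y k w))) \<partial>M)" for K
  proof -
    have "(\<integral>\<^sup>+w. indicator {w. ?A w} w * (\<Prod>k<K. ennreal (expneg (?x k w))) \<partial>M)
        = (\<integral>\<^sup>+w. (\<lambda>v. indicator A (user_part (fst v))) (marked_view w) *
            (\<Prod>k<K. ennreal (expneg (?x k w))) \<partial>M)"
      by (simp add: ind user_part_loc_states)
    also have "\<dots> = (\<integral>\<^sup>+w. (\<lambda>v. indicator A (user_part v)) (loc_states W w)
        * (\<Prod>k<K. ennreal (1 / (1 + s * max 0 (gain W k w * eve_loss k w)) ^ nak P (eve_state k w))) \<partial>M)"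
      by (subst fading_step[OF s]) simp_all
    also have "\<dots> = (\<integral>\<^sup>+w. indicator A (user_view W w)
        * (\<Prod>k<K. ennreal (link_laplace P s (eve_state k w) (eve_loss k w))) \<partial>M)"
      by (subst gain_step[OF s]) (simp_all add: user_part_loc_states)
    also have "\<dots> = (\<integral>\<^sup>+w. indicator A (user_view W w)
        * (\<Prod>k<K. ennreal (eve_laplace P s (norm (serving_bs P W w - eve W k w)))) \<partial>M)"
      by (rule state_step[OF s A])
    finally show ?thesis
      unfolding ind ey[symmetric] .
  qed
  have "(\<lambda>K. \<integral>\<^sup>+w. indicator {w. ?A w} w * (\<Prod>k<K. ennreal (expneg (?x k w))) \<partial>M)
      \<longlonglongrightarrow> (\<integral>\<^sup>+w. indicator {w. ?A w} w * ennreal (expneg (\<Sum>k. ?x k w)) \<partial>M)"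
    by (rule tendsto_nn_integral_indicator_prod) measurable
  moreover have "(\<lambda>K. \<integral>\<^sup>+w. indicator {w. ?A w} w * (\<Prod>k<K. ennreal (expneg (?y k w))) \<partial>M)
      \<longlonglongrightarrow> (\<integral>\<^sup>+w. indicator {w. ?A w} w * ennreal (expneg (\<Sum>k. ?y k w)) \<partial>M)"
    by (rule tendsto_nn_integral_indicator_prod) measurable
  ultimately have "(\<integral>\<^sup>+w. indicator {w. ?A w} w * ennreal (expneg (\<Sum>k. ?x k w)) \<partial>M)
      = (\<integral>\<^sup>+w. indicator {w. ?A w} w * ennreal (expneg (\<Sum>k. ?y k w)) \<partial>M)"
    unfolding eq by (rule LIMSEQ_unique)
  moreover have "(\<Sum>k. ?x k w) = ennreal s * colluding_signal P W w" for w
    by (simp add: colluding_signal_def)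
  ultimately have "(\<integral>\<^sup>+w. indicator A (user_view W w)
      * ennreal (expneg (ennreal s * colluding_signal P W w)) \<partial>M)
      = (\<integral>\<^sup>+w. indicator A (user_view W w) * ennreal (expneg (\<Sum>k. ?y k w)) \<partial>M)"
    by (simp add: ind)
  also have "\<dots> = (\<integral>\<^sup>+w. indicator A (user_view W w) * ennreal (exp (Xi P s)) \<partial>M)"
  proof -
    let ?E = "PiM UNIV (\<lambda>_. borel) :: (nat \<Rightarrow> plane) measure"
    let ?Y = "\<lambda>w k. eve W k w"
    \<comment> \<open>The user view and the eavesdropper positions are separate arguments, so the
      latter can be averaged with the former frozen.\<close>
    define F where "F x = indicator A (fst x) *
        ennreal (expneg (\<Sum>k. ennreal
            (- ln (eve_laplace P s (norm (fst (fst x) (server P (fst x)) - snd x k))))))"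
      for x :: "((nat \<Rightarrow> plane) \<times> (nat \<Rightarrow> link_state)) \<times> (nat \<Rightarrow> plane)"
    have "(\<lambda>x. fst (fst x) (server P (fst x))) \<in> borel_measurable (user_space \<Otimes>\<^sub>M ?E)"
      by (rule measurable_random_index[of "\<lambda>x. fst (fst x)"]) measurable
    then have F: "F \<in> borel_measurable (user_space \<Otimes>\<^sub>M ?E)"
      unfolding F_def[abs_def] by measurable
    have Y [measurable]: "?Y \<in> measurable M ?E"
      by (rule measurable_PiM_single') (auto simp: space_PiM)
    have "(\<integral>\<^sup>+w. F (user_view W w, ?Y w) \<partial>M) = (\<integral>\<^sup>+w. (\<integral>\<^sup>+w'. F (user_view W w, ?Y w') \<partial>M) \<partial>M)"
      by (rule nn_integral_indep[OF user_view_measurable Y user_view_indep_eves F])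
    moreover have "(\<integral>\<^sup>+w. F (u, ?Y w) \<partial>M) = indicator A u * ennreal (exp (Xi P s))" for u
    proof -
      have "(\<integral>\<^sup>+w. F (u, ?Y w) \<partial>M)
          = indicator A u * (\<integral>\<^sup>+w. ennreal
              (expneg (\<Sum>k. ennreal
                  (- ln (eve_laplace P s (norm (fst u (server P u) - eve W k w)))))) \<partial>M)"
        unfolding F_def fst_conv snd_conv by (rule nn_integral_cmult) measurable
      then show ?thesis
        by (simp add: eves_laplace[OF s \<alpha>])
    qed
    moreover have "F (user_view W w, ?Y w)
        = indicator A (user_view W w) * ennreal (expneg (\<Sum>k. ?y k w))" for w
      by (simp add: F_def serving_eq_server[symmetric] serving_bs_def) (simp add: user_view_def)
    ultimately show ?thesis
      by simp
  qed
  also have "\<dots> = (\<integral>\<^sup>+w. indicator A (user_view W w) \<partial>M) * ennreal (exp (Xi P s))"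
    by (rule nn_integral_multc) measurable
  also have "(\<integral>\<^sup>+w. indicator A (user_view W w) \<partial>M) = emeasure M {w \<in> space M. user_view W w \<in> A}"
    by (rule nn_integral_indicator_vimage[OF user_view_measurable A])
  finally show ?thesis .
qed

lemma laplace_colluding_signal:
  assumes s: "0 < s" and \<alpha>: "2 < pl_exp P NLOS"
  shows "laplace_transform M (colluding_signal P W) s = exp (Xi P s)"
proof -
  let ?I = "colluding_signal P W"
  have eq: "(if x = \<infinity> then 0 else exp (- s * enn2real x)) = expneg (ennreal s * x)" for x
    using s by (cases x) (simp_all add: ennreal_mult[symmetric] ennreal_mult_top)
  have "laplace_transform M ?I s = (\<integral>w. expneg (ennreal s * ?I w) \<partial>M)"
    unfolding laplace_transform_def eq ..
  also have "\<dots> = enn2real (\<integral>\<^sup>+w. ennreal (expneg (ennreal s * ?I w)) \<partial>M)"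
    by (rule integral_eq_nn_integral) simp_all
  also have "(\<integral>\<^sup>+w. ennreal (expneg (ennreal s * ?I w)) \<partial>M) = ennreal (exp (Xi P s))"
  proof -
    have "{w \<in> space M. user_view W w \<in> space user_space} = space M"
      using measurable_space[OF user_view_measurable] by auto
    then show ?thesis
      using signal_laplace[OF s \<alpha> sets.top] measurable_space[OF user_view_measurable]
      by (simp add: emeasure_space_1 cong: nn_integral_cong)
  qed
  finally show ?thesis
    by simp
qed

text \<open>The law of the signal on the event \<open>A\<close> and its full law scaled by the
  probability \<open>p\<close> of that event have equal Laplace transforms, hence coincide. Leaving
  both with mass \<open>p\<close> instead of normalising includes \<open>p = 0\<close>.\<close>

lemma user_view_indep_signal:
  assumes \<alpha>: "2 < pl_exp P NLOS" and A [measurable]: "A \<in> sets user_space"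
      and B [measurable]: "B \<in> sets borel"
  shows "emeasure M {w \<in> space M. user_view W w \<in> A \<and> colluding_signal P W w \<in> B}
    = emeasure M {w \<in> space M. user_view W w \<in> A} * emeasure M {w \<in> space M. colluding_signal P W w
        \<in> B}"
proof -
  let ?I = "colluding_signal P W"
  define p where "p = emeasure M {w \<in> space M. user_view W w \<in> A}"
  define \<mu> where "\<mu> = distr (density M (\<lambda>w. indicator A (user_view W w))) borel ?I"
  define \<nu> where "\<nu> = distr (density M (\<lambda>_. p)) borel ?I"
  have p: "(\<integral>\<^sup>+w. indicator A (user_view W w) \<partial>M) = p"
    unfolding p_def by (rule nn_integral_indicator_vimage[OF user_view_measurable A])
  have pfin: "p < \<infinity>"
    by (simp add: p_def less_top[symmetric])
  have all: "(\<integral>\<^sup>+w. indicator (space user_space) (user_view W w) * f w \<partial>M) = (\<integral>\<^sup>+w. f w \<partial>M)"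
      for f :: "'w \<Rightarrow> ennreal"
    using measurable_space[OF user_view_measurable] by (intro nn_integral_cong) simp
  have "{w \<in> space M. user_view W w \<in> space user_space} = space M"
    using measurable_space[OF user_view_measurable] by auto
  then have lap: "(\<integral>\<^sup>+w. ennreal (expneg (ennreal s * ?I w)) \<partial>M) = ennreal (exp (Xi P s))"
      if "0 < s" for s
    using signal_laplace[OF that \<alpha> sets.top] unfolding all by (simp add: emeasure_space_1)
  have "\<mu> = \<nu>"
  proof (rule laplace_unique)
    have \<mu>U: "emeasure \<mu> UNIV = p" and \<nu>U: "emeasure \<nu> UNIV = p"
      by (simp_all add: \<mu>_def \<nu>_def emeasure_distr_density p emeasure_space_1)
    then show "emeasure \<mu> UNIV = emeasure \<nu> UNIV"
      by simp
    show "finite_measure \<mu>" "finite_measure \<nu>"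
      using \<mu>U \<nu>U pfin by (auto intro!: finite_measureI simp: \<mu>_def \<nu>_def)
    fix s :: real
    assume s: "0 < s"
    have "(\<integral>\<^sup>+x. ennreal (expneg (ennreal s * x)) \<partial>\<mu>)
        = (\<integral>\<^sup>+w. indicator A (user_view W w) * ennreal (expneg (ennreal s * ?I w)) \<partial>M)"
      by (simp add: \<mu>_def nn_integral_distr nn_integral_density)
    also have "\<dots> = p * ennreal (exp (Xi P s))"
      unfolding p_def by (rule signal_laplace[OF s \<alpha> A])
    also have "\<dots> = (\<integral>\<^sup>+x. ennreal (expneg (ennreal s * x)) \<partial>\<nu>)"
      by (simp add: \<nu>_def nn_integral_distr nn_integral_density nn_integral_cmult lap[OF s])
    finally show "(\<integral>\<^sup>+x. ennreal (expneg (ennreal s * x)) \<partial>\<mu>)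
        = (\<integral>\<^sup>+x. ennreal (expneg (ennreal s * x)) \<partial>\<nu>)" .
  qed (simp_all add: \<mu>_def \<nu>_def)
  then have "emeasure \<mu> B = emeasure \<nu> B"
    by simp
  moreover have "emeasure \<mu> B = emeasure M {w \<in> space M. user_view W w \<in> A \<and> ?I w \<in> B}"
    unfolding \<mu>_def by (subst emeasure_distr_density)
      (auto intro!: nn_integral_indicator_Collect split: split_indicator)
  moreover have "emeasure \<nu> B = p * emeasure M {w \<in> space M. ?I w \<in> B}"
  proof -
    have "emeasure \<nu> B = (\<integral>\<^sup>+w. indicator B (?I w) * p \<partial>M)"
      unfolding \<nu>_def by (rule emeasure_distr_density) simp_all
    also have "\<dots> = (\<integral>\<^sup>+w. indicator B (?I w) \<partial>M) * p"
      by (rule nn_integral_multc) measurable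
    also have "(\<integral>\<^sup>+w. indicator B (?I w) \<partial>M) = emeasure M {w \<in> space M. ?I w \<in> B}"
      by (rule nn_integral_indicator_vimage[OF colluding_signal_measurable B])
    finally show ?thesis
      by (simp add: mult.commute)
  qed
  ultimately show ?thesis
    by (simp add: p_def)
qed

end

section \<open>Secure connectivity\<close>

context secure_network
begin

definition serving_state :: "'w \<Rightarrow> link_state" where
  "serving_state w = state W (serving P W w) User w"

text \<open>At a positive distance \<open>r\<close>, the connection is secure when the user's fading
  is at least this number times a finite signal; it is also the point at which the Laplace transform
  is differentiated.\<close>

definition threshold :: "link_state \<Rightarrow> real \<Rightarrow> real" where
  "threshold j r = r powr pl_exp P j / (lobe_gain P Main * pl_C P j)"

lemma threshold_pos: "r \<noteq> 0 \<Longrightarrow> 0 < threshold j r"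
  using gains_pos pl_C_pos[of j] by (simp add: threshold_def)

lemma serving_state_measurable [measurable]: "serving_state \<in> measurable M (count_space UNIV)"
  unfolding serving_state_def[abs_def] loc_states_simps(2)[symmetric] by measurable

text \<open>A single point has area zero, so its Poisson count vanishes almost surely. At distance 0
  both the formal path loss and the threshold are 0, outside the range in which transforms are
  differentiated.\<close>

lemma AE_bs_nonzero: "AE w in M. \<forall>i. bs W i w \<noteq> 0"
proof -
  note PPP = BSs_PPP(1)[unfolded homogeneous_PPP_def]
  have fin: "AE w in M. \<forall>B. bounded B \<longrightarrow> finite (BSs W w \<inter> B)"
    using PPP by simp
  have count: "(\<lambda>w. card (BSs W w \<inter> {0})) \<in> measurable M (count_space UNIV)
      \<and> (\<forall>k. measure M {w \<in> space M. card (BSs W w \<inter> {0}) = k}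
        = (lamB P * measure lborel {0::plane}) ^ k / fact k * exp
            (- (lamB P * measure lborel {0::plane})))"
  proof (rule PPP[THEN conjunct2, THEN conjunct1, THEN spec[of _ "{0}"], THEN mp])
    show "{0::plane} \<in> sets borel \<and> bounded {0::plane}"
      by simp
  qed
  then have card: "(\<lambda>w. card (BSs W w \<inter> {0})) \<in> measurable M (count_space UNIV)"
      "measure M {w \<in> space M. card (BSs W w \<inter> {0}) = 0}
          = (lamB P * 0) ^ 0 / fact 0 * exp (- (lamB P * 0))"
    by (simp_all only: measure_lborel_singleton)
  then have card_0: "measure M {w \<in> space M. card (BSs W w \<inter> {0}) = 0} = 1"
    by (simp only: mult_zero_right power_0 fact_0 exp_zero minus_zero div_by_1 mult_1)
  have "AE w in M. card (BSs W w \<inter> {0}) = 0"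
    using card(1) card_0 by (subst prob_Collect_eq_1[symmetric]) (measurable, simp only:)
  then show ?thesis
    using fin AE_space
  proof eventually_elim
    case (elim w)
    then have "BSs W w = range (\<lambda>i. bs W i w)"
      using BSs_PPP(2) by (simp add: enumerates_def)
    moreover have "BSs W w \<inter> {0} = {}"
      using elim by simp
    ultimately have "0 \<notin> range (\<lambda>i. bs W i w)"
      by simp
    then show ?case
      by (metis rangeI)
  qed
qed

text \<open>The event is phrased through positions; as the stations are almost surely distinct, the
  index can be recovered from its position.\<close>

lemma AE_assoc_event: "AE w in M. w \<in> assoc_event M P W j \<longleftrightarrow> serving_state w = j"
proof -
  have "AE w in M. inj (\<lambda>i. bs W i w)"
    using BSs_PPP(2) by (simp add: enumerates_def)
  then show ?thesis
    using AE_space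
  proof eventually_elim
    case (elim w)
    then have "serving_bs P W w \<in> BSs_in_state W j w \<longleftrightarrow> state W (serving P W w) User w = j"
      by (auto simp: BSs_in_state_def serving_bs_def dest: injD)
    then show ?case
      using elim by (simp add: assoc_event_def serving_state_def)
  qed
qed

lemma assoc_event_sets [measurable]: "assoc_event M P W j \<in> sets M"
proof -
  have "assoc_event M P W j = {w \<in> space M. \<exists>i. serving_bs P W w = bs W i w \<and> state W i User w = j}"
    by (auto simp: assoc_event_def BSs_in_state_def)
  also have "\<dots> \<in> sets M"
    by measurable
  finally show ?thesis .
qed

text \<open>The eavesdroppers' fadings join the conditioning, so the signal is fixed while the
  user's fading, still gamma distributed, is integrated.\<close>

lemma secure_prob_fading:
  "ennreal (secure_prob_colluding M P W)
    = (\<integral>\<^sup>+w. ennreal (gamma_tail_ext (nak P (serving_state w))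
        (ennreal (threshold (serving_state w) (norm (serving_bs P W w))) * colluding_signal P W w)) \<partial>M)"
proof -
  let ?N = "loc_state_space \<Otimes>\<^sub>M PiM UNIV (\<lambda>_. borel :: real measure)"
  let ?I1 = "range Eve"
  let ?NI = "?N \<Otimes>\<^sub>M PiM ?I1 (\<lambda>_. borel :: real measure)"
  define c where "c v = lobe_gain P Main
      * path_loss P (state_of P User v) (norm (fst (fst v) (serv_of P v)))" for v
  define I where "I u = (\<Sum>k. ennreal (snd (fst u) k * loss_of P k (fst (fst u)) * snd u (Eve k)))"
    for u :: "(loc_state \<times> (nat \<Rightarrow> real)) \<times> (receiver \<Rightarrow> real)"
  define F where "F x = (if 1 \<le> ennreal (c (fst (fst (fst x))) * snd x)
      / I (fst x) then 1 else 0 :: ennreal)"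
    for x :: "((loc_state \<times> (nat \<Rightarrow> real)) \<times> (receiver \<Rightarrow> real)) \<times> real"
  let ?u = "\<lambda>w. (marked_view w, \<lambda>u\<in>?I1. fading W u w)"
  have [measurable]: "(\<lambda>v. fst (fst v) (serv_of P v)) \<in> borel_measurable loc_state_space"
    by (rule measurable_random_index[of "\<lambda>v. fst (fst v)"]) measurable
  have c_meas [measurable]: "c \<in> borel_measurable loc_state_space"
    unfolding c_def[abs_def] by measurable
  have [measurable]: "(\<lambda>u. snd u (Eve k)) \<in> borel_measurable ?NI" for k
    by (rule measurable_compose[OF measurable_snd measurable_component_singleton]) simp
  have I_meas [measurable]: "I \<in> borel_measurable ?NI"
    unfolding I_def[abs_def] by measurable
  have F: "F \<in> borel_measurable (?NI \<Otimes>\<^sub>M borel)"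
    unfolding F_def[abs_def] by measurable
  have cv: "c (loc_states W w) = lobe_gain P Main * link_loss P W (serving P W w) User w" for w
    by (simp add: c_def loc_states_simps link_loss_def link_length_def position_def)
        (simp add: loc_states_def locations_def)
  have Iv: "I (?u w) = colluding_signal P W w" for w
    by (simp add: I_def loc_states_simps colluding_signal_def)
  have [measurable]: "(\<lambda>w. link_loss P W (serving P W w) User w) \<in> borel_measurable M"
  proof -
    have "(\<lambda>w. c (loc_states W w) / lobe_gain P Main) \<in> borel_measurable M"
      by measurable
    then show ?thesis
      using gains_pos[of Main] by (simp add: cv)
  qed
  have "ennreal (secure_prob_colluding M P W)
      = (\<integral>\<^sup>+w. F (?u w, fading W User w) \<partial>M)"
    unfolding secure_prob_colluding_def emeasure_eq_measure[symmetric]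
    by (intro nn_integral_indicator_Collect[symmetric]) (simp_all add: F_def cv Iv)
  also have "\<dots> = (\<integral>\<^sup>+w. (\<integral>\<^sup>+y. F (?u w, y) \<partial>gamma_distribution
      (real (nak P (state_of P User (fst (marked_view w))))) 1) \<partial>M)"
    by (rule cond_indep_given_single[OF fading_cond_indep finite_measure_axioms
        fading_kernel_measurable _ _ _ F]) auto
  also have "\<dots> = (\<integral>\<^sup>+w. ennreal (gamma_tail_ext (nak P (serving_state w))
        (ennreal (threshold (serving_state w) (norm (serving_bs P W w))) * colluding_signal P W w)) \<partial>M)"
  proof (rule nn_integral_cong_AE)
    show "AE w in M. (\<integral>\<^sup>+y. F (?u w, y) \<partial>gamma_distribution
        (real (nak P (state_of P User (fst (marked_view w))))) 1)
        = ennreal (gamma_tail_ext (nak P (serving_state w))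
            (ennreal (threshold (serving_state w) (norm (serving_bs P W w))) * colluding_signal P W w))"
      using AE_bs_nonzero
    proof eventually_elim
      case (elim w)
      let ?r = "norm (serving_bs P W w)" and ?j = "serving_state w"
      have r: "0 < ?r"
        using elim by (simp add: serving_bs_def)
      have c: "c (loc_states W w) = lobe_gain P Main * (pl_C P ?j * ?r powr (- pl_exp P ?j))"
        by (simp add: cv link_loss_def link_length_def position_def path_loss_def serving_state_def
            serving_bs_def)
      have cpos: "0 < c (loc_states W w)"
        unfolding c using r gains_pos[of Main] pl_C_pos[of ?j] by simp
      have thr: "1 / c (loc_states W w) = threshold ?j ?r"
        unfolding c threshold_def by (simp add: powr_minus field_simps)
      have "(\<integral>\<^sup>+y. F (?u w, y) \<partial>gamma_distribution (real (nak P ?j)) 1)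
          = (\<integral>\<^sup>+y. indicator {y. ennreal (c (loc_states W w) * y) / colluding_signal P W w \<ge> 1} y
              \<partial>gamma_distribution (real (nak P ?j)) 1)"
        by (intro nn_integral_cong) (simp add: F_def Iv split: split_indicator)
      also have "\<dots> = ennreal (gamma_tail_ext (nak P ?j) (ennreal (1 / c (loc_states W w))
          * colluding_signal P W w))"
        by (rule nn_integral_gamma_secure[OF fading_shape cpos])
      finally show ?case
        unfolding thr by (simp add: loc_states_simps serving_state_def)
    qed
  qed
  finally show ?thesis .
qed

section \<open>Conditioning on the serving station\<close>

text \<open>The derivative formula of the theorem at a fixed state and distance; for nonzero
  \<open>r\<close> it equals the mean gamma tail at threshold times signal.\<close>

definition conditional_prob :: "link_state \<Rightarrow> real \<Rightarrow> real" where
  "conditional_prob j r = (\<Sum>m<nak P j. (threshold j r) ^ m * ((- 1) ^ m / Gamma (real m + 1))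
    * (deriv ^^ m) (laplace_transform M (colluding_signal P W)) (threshold j r))"

lemma conditional_prob_eq:
  "r \<noteq> 0 \<Longrightarrow> conditional_prob j r
      = (\<integral>w. gamma_tail_ext (nak P j) (ennreal (threshold j r) * colluding_signal P W w) \<partial>M)"
  unfolding conditional_prob_def
  by (rule integral_gamma_tail[symmetric]) (simp_all add: threshold_pos)

text \<open>Iterated derivatives at a moving point are not evidently measurable, but the integral
  form is; \<open>r = 0\<close>, which \<open>conditional_prob_eq\<close> does not cover, is split
  off.\<close>

lemma conditional_prob_measurable [measurable]: "conditional_prob j \<in> borel_measurable borel"
proof -
  have "conditional_prob j = (\<lambda>r. if r = 0 then conditional_prob j 0
      else (\<integral>w. gamma_tail_ext (nak P j) (ennreal (threshold j r) * colluding_signal P W w) \<partial>M))"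
    using conditional_prob_eq by auto
  moreover have "(\<lambda>r. \<integral>w. gamma_tail_ext (nak P j) (ennreal (threshold j r)
      * colluding_signal P W w) \<partial>M) \<in> borel_measurable borel"
    unfolding threshold_def by measurable
  then have "(\<lambda>r. if r = 0 then conditional_prob j 0
      else (\<integral>w. gamma_tail_ext (nak P j) (ennreal (threshold j r) * colluding_signal P W w) \<partial>M)) \<in>
          borel_measurable borel"
    by (intro measurable_If) simp_all
  ultimately show ?thesis
    by simp
qed

lemma conditional_prob_bounds: "r \<noteq> 0 \<Longrightarrow> 0 \<le> conditional_prob j r \<and> conditional_prob j r \<le> 1"
  unfolding conditional_prob_eq
  by (intro conjI integral_nonneg integral_le_const integrable_const_bound[where B = 1])
    (simp_all add: gamma_tail_ext_bounds)

abbreviation conditional_prob_at :: "'w \<Rightarrow> real" where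
  "conditional_prob_at w \<equiv> conditional_prob (serving_state w) (norm (serving_bs P W w))"

text \<open>Independence from the user view lets the signal be averaged with serving state and
  distance frozen, and that average is \<open>conditional_prob\<close>.\<close>

lemma secure_prob_eq:
  assumes \<alpha>: "2 < pl_exp P NLOS"
  shows "secure_prob_colluding M P W = (\<integral>w. conditional_prob_at w \<partial>M)"
proof -
  let ?I = "colluding_signal P W"
  let ?us = "\<lambda>u :: (nat \<Rightarrow> plane) \<times> (nat \<Rightarrow> link_state). snd u (server P u)"
  let ?ub = "\<lambda>u :: (nat \<Rightarrow> plane) \<times> (nat \<Rightarrow> link_state). fst u (server P u)"
  define F where "F x = ennreal (gamma_tail_ext (nak P (?us (fst x)))
      (ennreal (threshold (?us (fst x)) (norm (?ub (fst x)))) * snd x))"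
    for x :: "((nat \<Rightarrow> plane) \<times> (nat \<Rightarrow> link_state)) \<times> ennreal"
  have us [measurable]: "?us \<in> measurable user_space (count_space UNIV)"
    by (rule measurable_random_index[of snd]) measurable
  have ub [measurable]: "?ub \<in> borel_measurable user_space"
    by (rule measurable_random_index[of fst]) measurable
  have F: "F \<in> borel_measurable (user_space \<Otimes>\<^sub>M borel)"
    unfolding F_def[abs_def]
    by (rule measurable_link_state_case[of "\<lambda>x. ?us (fst x)" _
          "\<lambda>j x. ennreal (gamma_tail_ext (nak P j) (ennreal (threshold j (norm (?ub (fst x))))
              * snd x))"])
      (simp_all add: threshold_def)
  have usv: "?us (user_view W w) = serving_state w"
      and ubv: "?ub (user_view W w) = serving_bs P W w" for w
    by (simp_all add: serving_eq_server[symmetric] serving_state_def serving_bs_def)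
        (simp_all add: user_view_def)
  have "ennreal (secure_prob_colluding M P W) = (\<integral>\<^sup>+w. F (user_view W w, ?I w) \<partial>M)"
    unfolding secure_prob_fading F_def fst_conv snd_conv usv ubv ..
  also have "\<dots> = (\<integral>\<^sup>+w. (\<integral>\<^sup>+w'. F (user_view W w, ?I w') \<partial>M) \<partial>M)"
    by (rule nn_integral_indep[OF user_view_measurable colluding_signal_measurable
        user_view_indep_signal[OF \<alpha>] F])
  also have "\<dots> = (\<integral>\<^sup>+w. ennreal (conditional_prob_at w) \<partial>M)"
  proof (rule nn_integral_cong_AE)
    show "AE w in M. (\<integral>\<^sup>+w'. F (user_view W w, ?I w') \<partial>M) = ennreal (conditional_prob_at w)"
      using AE_bs_nonzero
    proof eventually_elim
      case (elim w)
      let ?j = "serving_state w" and ?r = "norm (serving_bs P W w)"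
      have "?r \<noteq> 0"
        using elim by (simp add: serving_bs_def)
      have "(\<integral>\<^sup>+w'. F (user_view W w, ?I w') \<partial>M)
          = (\<integral>\<^sup>+w'. ennreal (gamma_tail_ext (nak P ?j) (ennreal (threshold ?j ?r) * ?I w')) \<partial>M)"
        unfolding F_def fst_conv snd_conv usv ubv ..
      also have "\<dots> = ennreal (conditional_prob ?j ?r)"
        unfolding conditional_prob_eq[OF \<open>?r \<noteq> 0\<close>]
        by (intro nn_integral_eq_integral integrable_const_bound[where B = 1])
            (simp_all add: gamma_tail_ext_bounds)
      finally show ?case .
    qed
  qed
  also have "\<dots> = ennreal (\<integral>w. conditional_prob_at w \<partial>M)"
  proof (rule nn_integral_eq_integral)
    have bd: "AE w in M. 0 \<le> conditional_prob_at w
        \<and> conditional_prob_at w \<le> 1"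
      using AE_bs_nonzero by eventually_elim (simp add: conditional_prob_bounds serving_bs_def)
    then show "AE w in M. 0 \<le> conditional_prob_at w"
      by eventually_elim simp
    have "conditional_prob_at \<in> borel_measurable M"
      by (rule measurable_link_state_case[OF serving_state_measurable, of
          "\<lambda>j w. conditional_prob j (norm (serving_bs P W w))"])
        measurable
    then show "integrable M conditional_prob_at"
      using bd by (intro integrable_const_bound[where B = 1]) (auto elim: eventually_mono)
  qed
  finally have "ennreal (secure_prob_colluding M P W) = ennreal (\<integral>w. conditional_prob_at w \<partial>M)" .
  moreover have "0 \<le> (\<integral>w. conditional_prob_at w \<partial>M)"
    using AE_bs_nonzero
    by (intro integral_nonneg_AE)
        (auto elim!: eventually_mono simp: conditional_prob_bounds serving_bs_def)
  ultimately show ?thesis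
    by (simp add: secure_prob_colluding_def)
qed

text \<open>Scaling the conditional law by the probability of the event gives the restriction to the
  event. For a null event both sides are 0, in line with the convention for such terms.\<close>

lemma assoc_prob_integral:
  "assoc_prob M P W j * (\<integral>r. conditional_prob j r \<partial>serving_dist_law M P W j)
    = (\<integral>w. indicator (assoc_event M P W j) w * conditional_prob j (norm (serving_bs P W w)) \<partial>M)"
proof -
  let ?A = "assoc_event M P W j" and ?g = "\<lambda>w. conditional_prob j (norm (serving_bs P W w))"
  show ?thesis
  proof (cases "measure M ?A = 0")
    case True
    then have "AE w in M. w \<notin> ?A"
      by (intro AE_not_in) (simp add: null_sets_def emeasure_eq_measure)
    then have "(\<integral>w. indicator ?A w * ?g w \<partial>M) = 0"
      by (intro integral_eq_zero_AE) (auto elim!: eventually_mono)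
    then show ?thesis
      using True by (simp add: assoc_prob_def)
  next
    case False
    then have pos: "0 < measure M ?A"
      by (simp add: zero_less_measure_iff)
    have inv: "1 / ennreal (measure M ?A) = ennreal (1 / measure M ?A)"
      using divide_ennreal[of 1 "measure M ?A"] pos by simp
    have "uniform_measure M ?A = density M (\<lambda>w. ennreal (indicator ?A w / measure M ?A))"
      unfolding uniform_measure_def
      using pos by (intro density_cong AE_I2)
          (auto simp: emeasure_eq_measure inv split: split_indicator)
    then have "(\<integral>w. ?g w \<partial>uniform_measure M ?A) = (\<integral>w. (indicator ?A w / measure M ?A) *\<^sub>R ?g w \<partial>M)"
      by (simp add: integral_density)
    moreover have "(\<integral>r. conditional_prob j r \<partial>serving_dist_law M P W j)
        = (\<integral>w. ?g w \<partial>uniform_measure M ?A)"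
      unfolding serving_dist_law_def by (rule integral_distr) simp_all
    ultimately show ?thesis
      using pos by (simp add: assoc_prob_def)
  qed
qed

text \<open>Almost surely exactly one of the two association events occurs, and on it the serving
  state is the fixed \<open>j\<close>.\<close>

lemma secure_prob_decomposition:
  assumes \<alpha>: "2 < pl_exp P NLOS"
  shows "secure_prob_colluding M P W
    = (\<Sum>j\<in>{LOS, NLOS}. assoc_prob M P W j * (\<integral>r. conditional_prob j r \<partial>serving_dist_law M P W j))"
proof -
  let ?g = "\<lambda>j w. indicator (assoc_event M P W j) w * conditional_prob j (norm (serving_bs P W w))"
  have int: "integrable M (?g j)" for j
  proof (rule integrable_const_bound[where B = 1])
    show "AE w in M. norm (?g j w) \<le> 1"
      using AE_bs_nonzero
      by eventually_elim (auto simp: conditional_prob_bounds serving_bs_def abs_mult split: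
          split_indicator)
  qed measurable
  have meas: "conditional_prob_at \<in> borel_measurable M"
    by (rule measurable_link_state_case[OF serving_state_measurable, of
        "\<lambda>j w. conditional_prob j (norm (serving_bs P W w))"])
      measurable
  have "(\<integral>w. conditional_prob_at w \<partial>M) = (\<integral>w. ?g LOS w + ?g NLOS w \<partial>M)"
  proof (rule integral_cong_AE[OF meas])
    show "AE w in M. conditional_prob_at w = ?g LOS w + ?g NLOS w"
      using AE_assoc_event[of LOS] AE_assoc_event[of NLOS]
    proof eventually_elim
      case (elim w)
      then show ?case
        by (cases "serving_state w") simp_all
    qed
  qed measurable
  also have "\<dots> = (\<Sum>j\<in>{LOS, NLOS}. \<integral>w. ?g j w \<partial>M)"
    by (simp add: int)
  finally show ?thesis
    unfolding secure_prob_eq[OF \<alpha>] assoc_prob_integral .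
qed

end

theorem theorem3:
  fixes M :: "'w measure" and P :: net_params and W :: "'w network"
  assumes "secure_network M P W"
    and "2 < pl_exp P NLOS"
  shows "(\<forall>s>0. laplace_transform M (colluding_signal P W) s = exp (Xi P s)) \<and>
    secure_prob_colluding M P W =
      (\<Sum>j\<in>{LOS, NLOS}. assoc_prob M P W j *
        (\<integral>r. (\<Sum>m<nak P j.
            (r powr pl_exp P j / (lobe_gain P Main * pl_C P j)) ^ m * ((- 1) ^ m / Gamma (real m + 1))
            * (deriv ^^ m) (laplace_transform M (colluding_signal P W))
                (r powr pl_exp P j / (lobe_gain P Main * pl_C P j)))
          \<partial>serving_dist_law M P W j))"
proof -
  interpret secure_network M P W
    by fact
  show ?thesis
    using laplace_colluding_signal[OF _ assms(2)] secure_prob_decomposition[OF assms(2)]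
    by (simp only: conditional_prob_def[abs_def] threshold_def) simp
qed

end
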